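(* Consider the Euler--Maruyama-based BUG integrator ($\theta=\mathrm{EM}$) and the Heun-based BUG integrator ($\theta=\mathrm{Heun}$) with basis augmentation and conservative truncation, as defined in the context, for the stochastic Vlasov--Poisson equation, with fixed velocity modes containing the constant mode, the $d$ momentum modes and the quadratic mode ($m\ge d+2$). Put $$\Theta_{\mathrm{EM}}^n=\frac{\tau}{2}\operatorname{Tr}(\sigma\sigma^\top(x))\rho^n,\qquad \Theta_{\mathrm{Heun}}^n=\frac12\sum_{s,r=1}^K\Delta\beta_n^s\Delta\beta_n^r\,(\sigma_s(x)\cdot\sigma_r(x))\,\rho^n .$$ Let $P_{x,n+1}$ be the $\langle\cdot,\cdot\rangle_x$-orthogonal projection onto the span of the final spatial basis obtained after augmentation and conservative truncation. Assume that $P_{x,n+1}(\Theta_\theta^n)=\Theta_\theta^n$ for both integrators. For the Heun-based integrator assume in addition that $$P_{x,n+1}\Big(\tau E^n\cdot J^n+\sum_{s=1}^K\Delta\beta_n^s\sigma_s\cdot J^n\Big)=\tau E^n\cdot J^n+\sum_{s=1}^K\Delta\beta_n^s\sigma_s\cdot J^n .$$ Then both schemes satisfy the pathwise identity $$e^{n+1}-e^n+\tau\nabla_x\cdot Q^n-\sum_{s=1}^K\Delta\beta_n^s\,\sigma_s(x)\cdot J^n-\Theta_\theta^n-\mathcal R_E^n=0,$$ where $\rho^n=\int f^n\,dv$, $J^n=\int vf^n\,dv$, $e^n=\frac12\int|v|^2f^n\,dv+\frac12|E^n|^2$, $Q^n=\frac12\int|v|^2v\,f^n\,dv$, and $$\mathcal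 R_E^n=\frac12\big(|E^{n+1}|^2-|E^n|^2\big)+\tau E^n\cdot J^n=\tau E^n\cdot\Big(\frac{E^{n+1}-E^n}{\tau}+J^n\Big)+\frac12|E^{n+1}-E^n|^2 .$$ In particular, for the Heun-based integrator, $$\mathbb E\big[\Theta_{\mathrm{Heun}}^n\mid\mathcal F_n\big]=\frac{\tau}{2}\operatorname{Tr}(\sigma\sigma^\top(x))\rho^n,$$ provided the Brownian increments are independent of $\mathcal F_n$ and satisfy $\mathbb E[\Delta\beta_n^s\Delta\beta_n^r\mid\mathcal F_n]=\tau\delta_{sr}$.
   Context: Model. $x\in\mathbb T^d$, $v\in\mathbb R^d$; $\beta_1,\dots,\beta_K$ are independent Brownian motions on a complete filtered probability space $(\Omega,\mathcal F,\{\mathcal F_t\},\mathbb P)$; $\sigma_s:\mathbb T^d\to\mathbb R^d$ are given (deterministic) and $\sigma=(\sigma_1,\dots,\sigma_K)$ is the $d\times K$ matrix with these columns. The stochastic Vlasov--Poisson equation in Stratonovich form is $df+(v\cdot\nabla_xf+E\cdot\nabla_vf)\,dt+\sum_{s}\sigma_s(x)\cdot\nabla_vf\star d\beta_s=0$, with $E=-\nabla u$, $-\Delta u=\int f\,dv-1$. Time step $\tau>0$, $t_n=n\tau$, $0\le n\le N$, $\Delta\beta_n^s=\beta_s(t_{n+1})-\beta_s(t_n)$, $\mathcal F_n=\mathcal F_{t_n}$; $f^n$ is $\mathcal F_n$-measurable. Inner products and fixed modes. $f_{0v}(v)>0$ is a fixed weight (e.g. Gaussian) such that $1$, $v_i$,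 $|v|^2$ belong to $L^2(\mathbb R^d;f_{0v})$. $\langle g,h\rangle_x=\int gh\,dx$; $\langle g,h\rangle_v=\int f_{0v}gh\,dv$ with norm $\|\cdot\|_v$; $(\cdot,\cdot)_v$ and $(\cdot,\cdot)_{xv}$ are the unweighted $L^2$ products in $v$ and $(x,v)$. With $\alpha_2=\langle|v|^2,1\rangle_v/\langle1,1\rangle_v$ and $\chi_2=|v|^2-\alpha_2$, the fixed modes are $U_1=1/\|1\|_v$, $U_{i+1}=v_i/\|v_i\|_v$ ($1\le i\le d$), $U_{d+2}=\chi_2/\|\chi_2\|_v$ (and possibly more, $m\ge d+2$ in total); the weight is such that they are orthonormal. Calculus conventions. In the fully discrete scheme integrals and derivatives in $x$ and $v$ are discretized (centered differences) so as to retain the continuous identities: linearity; periodicity in $x$; integration by parts in $v$ against polynomials of degree at most two without boundary terms, e.g. $\int\partial_{v_l}g\,dv=0$, $\int v_i\,\partial_{v_l}g\,dv=-\delta_{il}\int g\,dv$, $\int|v|^2\partial_{v_l}g\,dv=-2\int v_lg\,dv$; functions of $x$ commute with $\partial_v$. Continuous notation is used throughout; the exact integrals and derivatives (with enough regularity and velocity decay) also satisfy these rules. Low-rank state. $f^n=f_{0v}\sum_{i,j=1}^rX_i^nS_{ij}^nV_j^n$ with $(X_i^n)$ orthonormal for $\langle\cdot,\cdot\rangle_x$, $(V_j^n)$ orthonormal for $\langle\cdot,\cdot\rangle_v$; $V_a^n=U_a$ is fixed for $a\le m$, and $V_p^n=W_p^n$ for $m<p\le r$. $E^n$ is the electric field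 obtained from $f^n$ by the Poisson equation. Increments. $\mathcal D(f^n)=-v\cdot\nabla_xf^n-E^n\cdot\nabla_vf^n$; $\mathcal S_{\mathrm{EM}}(f)=-\sum_s\sigma_s\cdot\nabla_vf\,\Delta\beta_n^s+\frac{\tau}{2}\nabla_v\cdot(\sigma\sigma^\top\nabla_vf)$; $\mathcal S_{\mathrm{Heun}}(f)=-\frac12\sum_s(\sigma_s\cdot\nabla_vf+\sigma_s\cdot\nabla_v\widetilde f)\Delta\beta_n^s$ with $\widetilde f=f-\sum_s\sigma_s\cdot\nabla_vf\,\Delta\beta_n^s$. One step of the BUG integrator of type $\theta\in\{\mathrm{EM},\mathrm{Heun}\}$: (1) K-step: with $K_k^n=\sum_iX_i^nS_{ik}^n$, set $K_k^{n+1}=K_k^n+\tau(V_k^n,\mathcal D(f^n))_v+(V_k^n,\mathcal S_\theta(f^n))_v$, $1\le k\le r$. (2) L-step: with $L_q^n=\sum_{ip}S_{iq}^nS_{ip}^nW_p^n$, for $m<q\le r$ set $L_q^{n+1}=L_q^n+\frac1{f_{0v}}\sum_iS_{iq}^n\langle X_i^n,\tau\mathcal D(f^n)+\mathcal S_\theta(f^n)\rangle_x-\sum_{il}S_{iq}^n(X_i^nV_l^n,\tau\mathcal D(f^n)+\mathcal S_\theta(f^n))_{xv}V_l^n$. (3) Augmentation: $(\widetilde X_k^{n+1})_k$ is an orthonormal basis of $\mathrm{span}\{X_i^n,\partial_{x_l}X_i^n,K_i^{n+1}\}$, possibly enlarged by further functions; $(\widetilde V_l^{n+1})_l$ is an orthonormal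 basis of $\mathrm{span}\{U_a,W_p^n,L_p^{n+1}\}$ whose first $m$ elements are $U_1,\dots,U_m$. (4) S-step: with $M_{ki}=\langle\widetilde X_k^{n+1},X_i^n\rangle_x$, $N^\top_{jl}=\langle V_j^n,\widetilde V_l^{n+1}\rangle_v$ and $f_{aug}^{n+1}=f_{0v}\sum_{kijl}\widetilde X_k^{n+1}M_{ki}S_{ij}^nN^\top_{jl}\widetilde V_l^{n+1}$, set $\widetilde S_{kl}^{n+1}=\sum_{ij}M_{ki}S_{ij}^nN^\top_{jl}+\tau(\widetilde X_k^{n+1}\widetilde V_l^{n+1},\mathcal D(f_{aug}^{n+1}))_{xv}+(\widetilde X_k^{n+1}\widetilde V_l^{n+1},\mathcal S_\theta(f_{aug}^{n+1}))_{xv}$ (the electric field in $\mathcal D(f_{aug}^{n+1})$ is the one associated with $f_{aug}^{n+1}$). (5) Conservative truncation: let $\widetilde K_l=\sum_k\widetilde X_k^{n+1}\widetilde S_{kl}^{n+1}$. The columns $\widetilde K_1,\dots,\widetilde K_m$ (coefficients of $U_1,\dots,U_m$) are kept exactly, with QR factorization $\widetilde K^{cons}=X^{cons}S^{cons}$. The remaining columns are factored as $\widetilde K^{rem}=\widetilde X^{rem}\widetilde S^{rem}$ (QR), and $\widetilde S^{rem}\approx\hat U\hat S\hat W^\top$ is the SVD truncated to the $r-m$ largest singular values; $X^{rem}=\widetilde X^{rem}\hat U$, $S^{rem}=\hat S$, $W^{n+1}=(\widetilde V^{n+1}_l)_{l>m}\hat W$, $V^{n+1}=[U\ W^{n+1}]$.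 Finally $[X^{cons}\ X^{rem}]=X^{n+1}R$ (QR, the columns of $X^{n+1}$ spanning the column space, hence contained in $\mathrm{span}\{\widetilde X_k^{n+1}\}$) and $S^{n+1}=R\,\mathrm{diag}(S^{cons},S^{rem})$, so that $f^{n+1}=f_{0v}\sum_{ij}X_i^{n+1}S_{ij}^{n+1}V_j^{n+1}$. The final spatial basis is $(X_i^{n+1})_i$. *)

theory Defs
  imports "HOL-Probability.Probability" "HOL-Library.Function_Algebras"
begin

section \<open>Functions as a real vector space\<close>

global_interpretation funs: vector_space "\<lambda>(c::real) (g::'a \<Rightarrow> real) x. c * g x"
  by unfold_locales (auto simp: fun_eq_iff algebra_simps)


section \<open>Phase-space calculus\<close>

text \<open>
  The scheme is stated for integrals and derivatives that may be the exact ones or centered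
  differences with quadrature; what is common to both is collected here.  Points of the spatial
  torus have type \<open>'x\<close> and velocity points have type \<open>'v\<close>; these are either the continuous domains or
  grids.  \<open>Mx\<close>, \<open>Mv\<close> are Lebesgue measure or the weighted counting measure of the quadrature,
  \<open>vel\<close> gives the velocity vector at a velocity point, and \<open>Dx l\<close>, \<open>Dv l\<close> are the (exact
  or discrete) partial derivatives.  \<open>Rx\<close> and \<open>Rv\<close> are the functions that are regular enough, and
  decay fast enough in the velocity, to be differentiated.  Instances: \<open>exact_calculus\<close> and
  \<open>grid_calculus\<close>, at the end of this theory.
\<close>

record ('x, 'v, 'd) calculus =
  Mx :: "'x measure"
  Mv :: "'v measure"
  vel :: "'v \<Rightarrow> real^'d"
  Dx :: "'d \<Rightarrow> ('x \<Rightarrow> real) \<Rightarrow> 'x \<Rightarrow> real"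
  Dv :: "'d \<Rightarrow> ('v \<Rightarrow> real) \<Rightarrow> 'v \<Rightarrow> real"
  Rx :: "('x \<Rightarrow> real) set"
  Rv :: "('v \<Rightarrow> real) set"

locale vp_calculus =
  fixes C :: "('x, 'v, 'd::finite) calculus"
  assumes finite_Mx: "finite_measure (Mx C)"
    and sigma_finite_Mv: "sigma_finite_measure (Mv C)"
    and space_Mx: "space (Mx C) = UNIV"
    and space_Mv: "space (Mv C) = UNIV"
    and vel_measurable: "vel C \<in> borel_measurable (Mv C)"
    and subspace_Rx: "funs.subspace (Rx C)"
    and Rx_measurable: "g \<in> Rx C \<Longrightarrow> g \<in> borel_measurable (Mx C)"
    and Rx_bounded: "g \<in> Rx C \<Longrightarrow> bounded (range g)"
    and Dx_linear: "g \<in> Rx C \<Longrightarrow> h \<in> Rx C \<Longrightarrow>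
          Dx C l (\<lambda>x. a * g x + b * h x) = (\<lambda>x. a * Dx C l g x + b * Dx C l h x)"
    and Dx_integrable: "g \<in> Rx C \<Longrightarrow> integrable (Mx C) (Dx C l g)"
    and Dx_periodic: "g \<in> Rx C \<Longrightarrow> (\<integral>x. Dx C l g x \<partial>Mx C) = 0"
    and subspace_Rv: "funs.subspace (Rv C)"
    and Rv_moments: "p \<in> Rv C \<Longrightarrow> k \<le> 3 \<Longrightarrow> integrable (Mv C) (\<lambda>v. norm (vel C v) ^ k * p v)"
    and Dv_linear: "p \<in> Rv C \<Longrightarrow> q \<in> Rv C \<Longrightarrow>
          Dv C l (\<lambda>v. a * p v + b * q v) = (\<lambda>v. a * Dv C l p v + b * Dv C l q v)"
    and Dv_moments: "p \<in> Rv C \<Longrightarrow> k \<le> 2 \<Longrightarrow>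
          integrable (Mv C) (\<lambda>v. norm (vel C v) ^ k * Dv C l p v)"
    and Dv_const: "p \<in> Rv C \<Longrightarrow> (\<integral>v. Dv C l p v \<partial>Mv C) = 0"
    and Dv_coord: "p \<in> Rv C \<Longrightarrow>
          (\<integral>v. vel C v $ i * Dv C l p v \<partial>Mv C) = - (if i = l then 1 else 0) * (\<integral>v. p v \<partial>Mv C)"
    and Dv_square: "p \<in> Rv C \<Longrightarrow>
          (\<integral>v. (norm (vel C v))\<^sup>2 * Dv C l p v \<partial>Mv C) = - 2 * (\<integral>v. vel C v $ l * p v \<partial>Mv C)"


section \<open>Data of the scheme\<close>

text \<open>
  \<open>sig x\<close> is the \<open>d \<times> K\<close> matrix with columns \<open>\<sigma>\<^sub>s(x)\<close>; the indices \<open>s\<close> of the noises form the finite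
  type \<open>'k\<close>.  \<open>coord\<close> numbers the coordinates by \<open>1..d\<close>.  Modes and basis functions are numbered
  from \<open>1\<close>.
\<close>

record ('x, 'v, 'd, 'k) vp_data =
  wt :: "'v \<Rightarrow> real"                     \<comment> \<open>the weight \<open>f\<^sub>0\<^sub>v\<close>\<close>
  sig :: "'x \<Rightarrow> real^'k^'d"
  tau :: real
  coord :: "nat \<Rightarrow> 'd"
  rk :: nat                               \<comment> \<open>the rank \<open>r\<close>\<close>
  nfix :: nat                             \<comment> \<open>the number \<open>m\<close> of fixed velocity modes\<close>
  Umode :: "nat \<Rightarrow> 'v \<Rightarrow> real"

definition ipx :: "('x, 'v, 'd::finite) calculus \<Rightarrow> ('x \<Rightarrow> real) \<Rightarrow> ('x \<Rightarrow> real) \<Rightarrow> real" where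
  "ipx C g h = (\<integral>x. g x * h x \<partial>Mx C)"

definition ipv :: "('x, 'v, 'd::finite) calculus \<Rightarrow> ('x, 'v, 'd, 'k::finite) vp_data \<Rightarrow>
    ('v \<Rightarrow> real) \<Rightarrow> ('v \<Rightarrow> real) \<Rightarrow> real" where
  "ipv C P g h = (\<integral>v. wt P v * g v * h v \<partial>Mv C)"

definition normv :: "('x, 'v, 'd::finite) calculus \<Rightarrow> ('x, 'v, 'd, 'k::finite) vp_data \<Rightarrow>
    ('v \<Rightarrow> real) \<Rightarrow> real" where
  "normv C P g = sqrt (ipv C P g g)"

text \<open>The unweighted products \<open>(\<cdot>,\<cdot>)\<^sub>v\<close> and \<open>(\<cdot>,\<cdot>)\<^sub>x\<^sub>v\<close>.\<close>

definition prv :: "('x, 'v, 'd::finite) calculus \<Rightarrow> ('v \<Rightarrow> real) \<Rightarrow> ('v \<Rightarrow> real) \<Rightarrow> real" where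
  "prv C g h = (\<integral>v. g v * h v \<partial>Mv C)"

definition prxv :: "('x, 'v, 'd::finite) calculus \<Rightarrow> ('x \<Rightarrow> 'v \<Rightarrow> real) \<Rightarrow> ('x \<Rightarrow> 'v \<Rightarrow> real) \<Rightarrow> real" where
  "prxv C g h = (\<integral>(x, v). g x v * h x v \<partial>(Mx C \<Otimes>\<^sub>M Mv C))"

definition L2x :: "('x, 'v, 'd::finite) calculus \<Rightarrow> ('x \<Rightarrow> real) set" where
  "L2x C = {g. g \<in> borel_measurable (Mx C) \<and> integrable (Mx C) (\<lambda>x. (g x)\<^sup>2)}"

definition L2v :: "('x, 'v, 'd::finite) calculus \<Rightarrow> ('x, 'v, 'd, 'k::finite) vp_data \<Rightarrow> ('v \<Rightarrow> real) set" where
  "L2v C P = {g. g \<in> borel_measurable (Mv C) \<and> integrable (Mv C) (\<lambda>v. wt P v * (g v)\<^sup>2)}"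

definition orthonormal_x :: "('x, 'v, 'd::finite) calculus \<Rightarrow> nat \<Rightarrow> (nat \<Rightarrow> 'x \<Rightarrow> real) \<Rightarrow> bool" where
  "orthonormal_x C n X \<longleftrightarrow> (\<forall>i\<in>{1..n}. X i \<in> L2x C) \<and>
     (\<forall>i\<in>{1..n}. \<forall>j\<in>{1..n}. ipx C (X i) (X j) = (if i = j then 1 else 0))"

definition orthonormal_v :: "('x, 'v, 'd::finite) calculus \<Rightarrow> ('x, 'v, 'd, 'k::finite) vp_data \<Rightarrow>
    nat \<Rightarrow> (nat \<Rightarrow> 'v \<Rightarrow> real) \<Rightarrow> bool" where
  "orthonormal_v C P n V \<longleftrightarrow> (\<forall>i\<in>{1..n}. V i \<in> L2v C P) \<and>
     (\<forall>i\<in>{1..n}. \<forall>j\<in>{1..n}. ipv C P (V i) (V j) = (if i = j then 1 else 0))"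

text \<open>Orthogonal projection onto the span of the orthonormal family \<open>X\<^sub>1, \<dots>, X\<^sub>n\<close>.\<close>

definition proj_x :: "('x, 'v, 'd::finite) calculus \<Rightarrow> nat \<Rightarrow> (nat \<Rightarrow> 'x \<Rightarrow> real) \<Rightarrow> ('x \<Rightarrow> real) \<Rightarrow> 'x \<Rightarrow> real" where
  "proj_x C n X g = (\<lambda>x. \<Sum>i=1..n. ipx C (X i) g * X i x)"

definition alpha2 :: "('x, 'v, 'd::finite) calculus \<Rightarrow> ('x, 'v, 'd, 'k::finite) vp_data \<Rightarrow> real" where
  "alpha2 C P = ipv C P (\<lambda>v. (norm (vel C v))\<^sup>2) (\<lambda>_. 1) / ipv C P (\<lambda>_. 1) (\<lambda>_. 1)"

definition chi2 :: "('x, 'v, 'd::finite) calculus \<Rightarrow> ('x, 'v, 'd, 'k::finite) vp_data \<Rightarrow> 'v \<Rightarrow> real" where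
  "chi2 C P = (\<lambda>v. (norm (vel C v))\<^sup>2 - alpha2 C P)"

definition valid_data :: "('x, 'v, 'd::finite) calculus \<Rightarrow> ('x, 'v, 'd, 'k::finite) vp_data \<Rightarrow> bool" where
  "valid_data C P \<longleftrightarrow>
     0 < tau P \<and>
     wt P \<in> borel_measurable (Mv C) \<and> (\<forall>v. 0 < wt P v) \<and>
     (\<lambda>_. 1) \<in> L2v C P \<and> (\<forall>i. (\<lambda>v. vel C v $ i) \<in> L2v C P) \<and>
     (\<lambda>v. (norm (vel C v))\<^sup>2) \<in> L2v C P \<and>
     (\<forall>i s. (\<lambda>x. sig P x $ i $ s) \<in> borel_measurable (Mx C) \<and> bounded (range (\<lambda>x. sig P x $ i $ s))) \<and>
     bij_betw (coord P) {1..CARD('d)} UNIV \<and>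
     CARD('d) + 2 \<le> nfix P \<and> nfix P \<le> rk P \<and>
     Umode P 1 = (\<lambda>v. 1 / normv C P (\<lambda>_. 1)) \<and>
     (\<forall>i\<in>{1..CARD('d)}. Umode P (i + 1) =
        (\<lambda>v. vel C v $ coord P i / normv C P (\<lambda>w. vel C w $ coord P i))) \<and>
     Umode P (CARD('d) + 2) = (\<lambda>v. chi2 C P v / normv C P (chi2 C P)) \<and>
     orthonormal_v C P (nfix P) (Umode P)"


section \<open>Moments and electric field\<close>

definition rho :: "('x, 'v, 'd::finite) calculus \<Rightarrow> ('x \<Rightarrow> 'v \<Rightarrow> real) \<Rightarrow> 'x \<Rightarrow> real" where
  "rho C f x = (\<integral>v. f x v \<partial>Mv C)"

definition Jmom :: "('x, 'v, 'd::finite) calculus \<Rightarrow> ('x \<Rightarrow> 'v \<Rightarrow> real) \<Rightarrow> 'x \<Rightarrow> real^'d" where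
  "Jmom C f x = (\<chi> l. \<integral>v. vel C v $ l * f x v \<partial>Mv C)"

definition Qflux :: "('x, 'v, 'd::finite) calculus \<Rightarrow> ('x \<Rightarrow> 'v \<Rightarrow> real) \<Rightarrow> 'x \<Rightarrow> real^'d" where
  "Qflux C f x = (\<chi> l. 1 / 2 * (\<integral>v. (norm (vel C v))\<^sup>2 * vel C v $ l * f x v \<partial>Mv C))"

definition div_x :: "('x, 'v, 'd::finite) calculus \<Rightarrow> ('x \<Rightarrow> real^'d) \<Rightarrow> 'x \<Rightarrow> real" where
  "div_x C q x = (\<Sum>l\<in>UNIV. Dx C l (\<lambda>y. q y $ l) x)"

definition poisson_field :: "('x, 'v, 'd::finite) calculus \<Rightarrow> ('x \<Rightarrow> real) \<Rightarrow> ('x \<Rightarrow> real^'d) \<Rightarrow> bool" where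
  "poisson_field C \<rho> E \<longleftrightarrow> (\<exists>u. u \<in> Rx C \<and> (\<forall>l. Dx C l u \<in> Rx C) \<and>
     (\<forall>x. - (\<Sum>l\<in>UNIV. Dx C l (Dx C l u) x) = \<rho> x - 1) \<and>
     (\<forall>x. E x = (\<chi> l. - Dx C l u x)))"

text \<open>
  A solver assigns to every density for which the Poisson equation is solvable a field.  For the exact
  calculus the field is unique; for a difference calculus the solver is part of the scheme.
\<close>

definition poisson_solver :: "('x, 'v, 'd::finite) calculus \<Rightarrow> (('x \<Rightarrow> real) \<Rightarrow> 'x \<Rightarrow> real^'d) \<Rightarrow> bool" where
  "poisson_solver C \<E> \<longleftrightarrow> (\<forall>\<rho>. (\<exists>E. poisson_field C \<rho> E) \<longrightarrow> poisson_field C \<rho> (\<E> \<rho>))"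

definition energy :: "('x, 'v, 'd::finite) calculus \<Rightarrow> ('x \<Rightarrow> 'v \<Rightarrow> real) \<Rightarrow> ('x \<Rightarrow> real^'d) \<Rightarrow> 'x \<Rightarrow> real" where
  "energy C f E x = 1 / 2 * (\<integral>v. (norm (vel C v))\<^sup>2 * f x v \<partial>Mv C) + 1 / 2 * (norm (E x))\<^sup>2"


section \<open>Increments\<close>

datatype integrator = EM | Heun

definition transport :: "('x, 'v, 'd::finite) calculus \<Rightarrow> (('x \<Rightarrow> real) \<Rightarrow> 'x \<Rightarrow> real^'d) \<Rightarrow>
    ('x \<Rightarrow> 'v \<Rightarrow> real) \<Rightarrow> 'x \<Rightarrow> 'v \<Rightarrow> real" where
  "transport C \<E> f x v =
     - (\<Sum>l\<in>UNIV. vel C v $ l * Dx C l (\<lambda>y. f y v) x)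
     - (\<Sum>l\<in>UNIV. \<E> (rho C f) x $ l * Dv C l (f x) v)"

definition noise_term :: "('x, 'v, 'd::finite) calculus \<Rightarrow> ('x, 'v, 'd, 'k::finite) vp_data \<Rightarrow> 'k \<Rightarrow>
    ('x \<Rightarrow> 'v \<Rightarrow> real) \<Rightarrow> 'x \<Rightarrow> 'v \<Rightarrow> real" where
  "noise_term C P s f x v = (\<Sum>l\<in>UNIV. column s (sig P x) $ l * Dv C l (f x) v)"

definition sig_sq :: "('x, 'v, 'd::finite, 'k::finite) vp_data \<Rightarrow> 'x \<Rightarrow> real^'d^'d" where
  "sig_sq P x = sig P x ** transpose (sig P x)"

definition S_EM :: "('x, 'v, 'd::finite) calculus \<Rightarrow> ('x, 'v, 'd, 'k::finite) vp_data \<Rightarrow> ('k \<Rightarrow> real) \<Rightarrow>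
    ('x \<Rightarrow> 'v \<Rightarrow> real) \<Rightarrow> 'x \<Rightarrow> 'v \<Rightarrow> real" where
  "S_EM C P \<Delta>\<beta> f x v =
     - (\<Sum>s\<in>UNIV. noise_term C P s f x v * \<Delta>\<beta> s)
     + tau P / 2 * (\<Sum>i\<in>UNIV. Dv C i (\<lambda>w. \<Sum>j\<in>UNIV. sig_sq P x $ i $ j * Dv C j (f x) w) v)"

definition S_Heun :: "('x, 'v, 'd::finite) calculus \<Rightarrow> ('x, 'v, 'd, 'k::finite) vp_data \<Rightarrow> ('k \<Rightarrow> real) \<Rightarrow>
    ('x \<Rightarrow> 'v \<Rightarrow> real) \<Rightarrow> 'x \<Rightarrow> 'v \<Rightarrow> real" where
  "S_Heun C P \<Delta>\<beta> f x v =
     (let ft = (\<lambda>y w. f y w - (\<Sum>s\<in>UNIV. noise_term C P s f y w * \<Delta>\<beta> s))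
      in - (1 / 2) * (\<Sum>s\<in>UNIV. (noise_term C P s f x v + noise_term C P s ft x v) * \<Delta>\<beta> s))"

definition S_inc :: "integrator \<Rightarrow> ('x, 'v, 'd::finite) calculus \<Rightarrow> ('x, 'v, 'd, 'k::finite) vp_data \<Rightarrow>
    ('k \<Rightarrow> real) \<Rightarrow> ('x \<Rightarrow> 'v \<Rightarrow> real) \<Rightarrow> 'x \<Rightarrow> 'v \<Rightarrow> real" where
  "S_inc \<theta> = (case \<theta> of EM \<Rightarrow> S_EM | Heun \<Rightarrow> S_Heun)"

definition Theta :: "integrator \<Rightarrow> ('x, 'v, 'd::finite, 'k::finite) vp_data \<Rightarrow>
    ('k \<Rightarrow> real) \<Rightarrow> ('x \<Rightarrow> real) \<Rightarrow> 'x \<Rightarrow> real" where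
  "Theta \<theta> P \<Delta>\<beta> \<rho> x = (case \<theta> of
     EM \<Rightarrow> tau P / 2 * trace (sig_sq P x) * \<rho> x
   | Heun \<Rightarrow> 1 / 2 * (\<Sum>s\<in>UNIV. \<Sum>r\<in>UNIV.
       \<Delta>\<beta> s * \<Delta>\<beta> r * (column s (sig P x) \<bullet> column r (sig P x))) * \<rho> x)"


section \<open>Low-rank states\<close>

text \<open>
  \<open>nx\<close> is the number of spatial basis functions.  It is \<open>r\<close>, unless the columns from
  which the spatial basis of a step is computed were linearly dependent.
\<close>

record ('x, 'v) lr_state =
  nx :: nat
  Xb :: "nat \<Rightarrow> 'x \<Rightarrow> real"
  Sc :: "nat \<Rightarrow> nat \<Rightarrow> real"
  Vb :: "nat \<Rightarrow> 'v \<Rightarrow> real"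

definition dens :: "('x, 'v, 'd::finite, 'k::finite) vp_data \<Rightarrow> ('x, 'v) lr_state \<Rightarrow> 'x \<Rightarrow> 'v \<Rightarrow> real" where
  "dens P st x v = wt P v * (\<Sum>i=1..nx st. \<Sum>j=1..rk P. Xb st i x * Sc st i j * Vb st j v)"

text \<open>The last three conjuncts are the regularity and velocity decay needed to apply the increments.\<close>

definition low_rank_state :: "('x, 'v, 'd::finite) calculus \<Rightarrow> ('x, 'v, 'd, 'k::finite) vp_data \<Rightarrow>
    ('x, 'v) lr_state \<Rightarrow> bool" where
  "low_rank_state C P st \<longleftrightarrow>
     orthonormal_x C (nx st) (Xb st) \<and> orthonormal_v C P (rk P) (Vb st) \<and>
     (\<forall>a\<in>{1..nfix P}. Vb st a = Umode P a) \<and>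
     (\<forall>i\<in>{1..nx st}. Xb st i \<in> Rx C) \<and>
     (\<forall>j\<in>{1..rk P}. (\<lambda>v. wt P v * Vb st j v) \<in> Rv C) \<and>
     (\<forall>j\<in>{1..rk P}. \<forall>l. Dv C l (\<lambda>v. wt P v * Vb st j v) \<in> Rv C)"


section \<open>One step of the BUG integrator\<close>

definition K_old :: "('x, 'v) lr_state \<Rightarrow> nat \<Rightarrow> 'x \<Rightarrow> real" where
  "K_old st k x = (\<Sum>i=1..nx st. Xb st i x * Sc st i k)"

definition K_new :: "integrator \<Rightarrow> ('x, 'v, 'd::finite) calculus \<Rightarrow> ('x, 'v, 'd, 'k::finite) vp_data \<Rightarrow>
    (('x \<Rightarrow> real) \<Rightarrow> 'x \<Rightarrow> real^'d) \<Rightarrow> ('k \<Rightarrow> real) \<Rightarrow> ('x, 'v) lr_state \<Rightarrow> nat \<Rightarrow> 'x \<Rightarrow> real" where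
  "K_new \<theta> C P \<E> \<Delta>\<beta> st k x = K_old st k x
     + tau P * prv C (Vb st k) (transport C \<E> (dens P st) x)
     + prv C (Vb st k) (S_inc \<theta> C P \<Delta>\<beta> (dens P st) x)"

definition L_old :: "('x, 'v, 'd::finite, 'k::finite) vp_data \<Rightarrow> ('x, 'v) lr_state \<Rightarrow> nat \<Rightarrow> 'v \<Rightarrow> real" where
  "L_old P st q v = (\<Sum>i=1..nx st. \<Sum>p=nfix P + 1..rk P. Sc st i q * Sc st i p * Vb st p v)"

definition full_inc :: "integrator \<Rightarrow> ('x, 'v, 'd::finite) calculus \<Rightarrow> ('x, 'v, 'd, 'k::finite) vp_data \<Rightarrow>
    (('x \<Rightarrow> real) \<Rightarrow> 'x \<Rightarrow> real^'d) \<Rightarrow> ('k \<Rightarrow> real) \<Rightarrow> ('x \<Rightarrow> 'v \<Rightarrow> real) \<Rightarrow> 'x \<Rightarrow> 'v \<Rightarrow> real" where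
  "full_inc \<theta> C P \<E> \<Delta>\<beta> f x v = tau P * transport C \<E> f x v + S_inc \<theta> C P \<Delta>\<beta> f x v"

definition L_new :: "integrator \<Rightarrow> ('x, 'v, 'd::finite) calculus \<Rightarrow> ('x, 'v, 'd, 'k::finite) vp_data \<Rightarrow>
    (('x \<Rightarrow> real) \<Rightarrow> 'x \<Rightarrow> real^'d) \<Rightarrow> ('k \<Rightarrow> real) \<Rightarrow> ('x, 'v) lr_state \<Rightarrow> nat \<Rightarrow> 'v \<Rightarrow> real" where
  "L_new \<theta> C P \<E> \<Delta>\<beta> st q v = L_old P st q v
     + 1 / wt P v * (\<Sum>i=1..nx st. Sc st i q *
         ipx C (Xb st i) (\<lambda>x. full_inc \<theta> C P \<E> \<Delta>\<beta> (dens P st) x v))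
     - (\<Sum>i=1..nx st. \<Sum>l=1..rk P. Sc st i q *
         prxv C (\<lambda>x w. Xb st i x * Vb st l w) (full_inc \<theta> C P \<E> \<Delta>\<beta> (dens P st)) * Vb st l v)"

text \<open>The set \<open>G\<close> contains the further functions by which the spatial basis may be enlarged.\<close>

definition augmentation :: "integrator \<Rightarrow> ('x, 'v, 'd::finite) calculus \<Rightarrow> ('x, 'v, 'd, 'k::finite) vp_data \<Rightarrow>
    (('x \<Rightarrow> real) \<Rightarrow> 'x \<Rightarrow> real^'d) \<Rightarrow> ('k \<Rightarrow> real) \<Rightarrow> ('x, 'v) lr_state \<Rightarrow>
    nat \<Rightarrow> (nat \<Rightarrow> 'x \<Rightarrow> real) \<Rightarrow> nat \<Rightarrow> (nat \<Rightarrow> 'v \<Rightarrow> real) \<Rightarrow> bool" where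
  "augmentation \<theta> C P \<E> \<Delta>\<beta> st na Xa nb Va \<longleftrightarrow>
     orthonormal_x C na Xa \<and>
     (\<exists>G. funs.span (Xa ` {1..na}) =
        funs.span (Xb st ` {1..nx st} \<union> (\<Union>l. (\<lambda>i. Dx C l (Xb st i)) ` {1..nx st}) \<union>
          K_new \<theta> C P \<E> \<Delta>\<beta> st ` {1..rk P} \<union> G)) \<and>
     orthonormal_v C P nb Va \<and>
     funs.span (Va ` {1..nb}) =
       funs.span (Umode P ` {1..nfix P} \<union> Vb st ` {nfix P + 1..rk P} \<union>
         L_new \<theta> C P \<E> \<Delta>\<beta> st ` {nfix P + 1..rk P}) \<and>
     nfix P \<le> nb \<and> (\<forall>a\<in>{1..nfix P}. Va a = Umode P a)"

definition S_proj :: "('x, 'v, 'd::finite) calculus \<Rightarrow> ('x, 'v, 'd, 'k::finite) vp_data \<Rightarrow> ('x, 'v) lr_state \<Rightarrow>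
    (nat \<Rightarrow> 'x \<Rightarrow> real) \<Rightarrow> (nat \<Rightarrow> 'v \<Rightarrow> real) \<Rightarrow> nat \<Rightarrow> nat \<Rightarrow> real" where
  "S_proj C P st Xa Va k l =
     (\<Sum>i=1..nx st. \<Sum>j=1..rk P. ipx C (Xa k) (Xb st i) * Sc st i j * ipv C P (Vb st j) (Va l))"

definition dens_aug :: "('x, 'v, 'd::finite) calculus \<Rightarrow> ('x, 'v, 'd, 'k::finite) vp_data \<Rightarrow> ('x, 'v) lr_state \<Rightarrow>
    nat \<Rightarrow> (nat \<Rightarrow> 'x \<Rightarrow> real) \<Rightarrow> nat \<Rightarrow> (nat \<Rightarrow> 'v \<Rightarrow> real) \<Rightarrow> 'x \<Rightarrow> 'v \<Rightarrow> real" where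
  "dens_aug C P st na Xa nb Va x v =
     wt P v * (\<Sum>k=1..na. \<Sum>l=1..nb. Xa k x * S_proj C P st Xa Va k l * Va l v)"

definition S_new :: "integrator \<Rightarrow> ('x, 'v, 'd::finite) calculus \<Rightarrow> ('x, 'v, 'd, 'k::finite) vp_data \<Rightarrow>
    (('x \<Rightarrow> real) \<Rightarrow> 'x \<Rightarrow> real^'d) \<Rightarrow> ('k \<Rightarrow> real) \<Rightarrow> ('x, 'v) lr_state \<Rightarrow>
    nat \<Rightarrow> (nat \<Rightarrow> 'x \<Rightarrow> real) \<Rightarrow> nat \<Rightarrow> (nat \<Rightarrow> 'v \<Rightarrow> real) \<Rightarrow> nat \<Rightarrow> nat \<Rightarrow> real" where
  "S_new \<theta> C P \<E> \<Delta>\<beta> st na Xa nb Va k l =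
     (let f = dens_aug C P st na Xa nb Va in
      S_proj C P st Xa Va k l
      + tau P * prxv C (\<lambda>x v. Xa k x * Va l v) (transport C \<E> f)
      + prxv C (\<lambda>x v. Xa k x * Va l v) (S_inc \<theta> C P \<Delta>\<beta> f))"

text \<open>\<open>A = Q R\<close> for the columns \<open>A\<^sub>1, \<dots>, A\<^sub>n\<close>, with \<open>Q\<close> having \<open>p\<close> orthonormal columns.\<close>

definition qr_fact :: "('x, 'v, 'd::finite) calculus \<Rightarrow> nat \<Rightarrow> (nat \<Rightarrow> 'x \<Rightarrow> real) \<Rightarrow>
    nat \<Rightarrow> (nat \<Rightarrow> 'x \<Rightarrow> real) \<Rightarrow> (nat \<Rightarrow> nat \<Rightarrow> real) \<Rightarrow> bool" where
  "qr_fact C n A p Q R \<longleftrightarrow> orthonormal_x C p Q \<and>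
     (\<forall>j\<in>{1..n}. \<forall>x. A j x = (\<Sum>i=1..p. Q i x * R i j)) \<and>
     (\<forall>i\<in>{1..p}. \<forall>j\<in>{1..n}. j < i \<longrightarrow> R i j = 0)"

definition svd :: "nat \<Rightarrow> nat \<Rightarrow> (nat \<Rightarrow> nat \<Rightarrow> real) \<Rightarrow>
    (nat \<Rightarrow> nat \<Rightarrow> real) \<Rightarrow> (nat \<Rightarrow> real) \<Rightarrow> (nat \<Rightarrow> nat \<Rightarrow> real) \<Rightarrow> bool" where
  "svd q p A u \<sigma> w \<longleftrightarrow>
     (\<forall>a\<in>{1..min q p}. \<forall>b\<in>{1..min q p}. (\<Sum>i=1..q. u i a * u i b) = (if a = b then 1 else 0)) \<and>
     (\<forall>a\<in>{1..min q p}. \<forall>b\<in>{1..min q p}. (\<Sum>l=1..p. w l a * w l b) = (if a = b then 1 else 0)) \<and>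
     (\<forall>a\<in>{1..min q p}. 0 \<le> \<sigma> a) \<and>
     (\<forall>a\<in>{1..min q p}. \<forall>b\<in>{1..min q p}. a \<le> b \<longrightarrow> \<sigma> b \<le> \<sigma> a) \<and>
     (\<forall>i\<in>{1..q}. \<forall>l\<in>{1..p}. A i l = (\<Sum>a=1..min q p. u i a * \<sigma> a * w l a))"

text \<open>
  \<open>cons_truncation \<dots> na Xa nb Va St st'\<close>: the coefficients \<open>St\<close> with respect to the augmented bases \<open>Xa\<close>,
  \<open>Va\<close> are truncated to the state \<open>st'\<close>.  The columns of \<open>X\<^sup>c\<^sup>o\<^sup>n\<^sup>s\<close> and of
  \<open>X\<^sup>r\<^sup>e\<^sup>m\<close> before the SVD (here \<open>Xc\<close> and \<open>Xr\<close>) lie in the span of \<open>Xa\<close>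
  because the factorizations are those of coefficient matrices with respect to \<open>Xa\<close>; this is not
  implied by \<open>qr_fact\<close> if the factored columns are linearly dependent.  \<open>blkX\<close> and \<open>blkS\<close> are
  the columns \<open>[X\<^sup>c\<^sup>o\<^sup>n\<^sup>s X\<^sup>r\<^sup>e\<^sup>m]\<close> and the block-diagonal matrix of
  \<open>S\<^sup>c\<^sup>o\<^sup>n\<^sup>s\<close> and \<open>S\<^sup>r\<^sup>e\<^sup>m\<close>.
\<close>

definition cons_truncation :: "('x, 'v, 'd::finite) calculus \<Rightarrow> ('x, 'v, 'd, 'k::finite) vp_data \<Rightarrow>
    nat \<Rightarrow> (nat \<Rightarrow> 'x \<Rightarrow> real) \<Rightarrow> nat \<Rightarrow> (nat \<Rightarrow> 'v \<Rightarrow> real) \<Rightarrow> (nat \<Rightarrow> nat \<Rightarrow> real) \<Rightarrow>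
    ('x, 'v) lr_state \<Rightarrow> bool" where
  "cons_truncation C P na Xa nb Va St st' \<longleftrightarrow>
    (let m = nfix P; r = rk P; Kt = (\<lambda>l x. \<Sum>k=1..na. Xa k x * St k l) in
     \<exists>c Xc Scons q Xr Sr u \<sigma> w R.
       qr_fact C m Kt c Xc Scons \<and> Xc ` {1..c} \<subseteq> funs.span (Xa ` {1..na}) \<and>
       qr_fact C (nb - m) (\<lambda>l. Kt (m + l)) q Xr Sr \<and> Xr ` {1..q} \<subseteq> funs.span (Xa ` {1..na}) \<and>
       svd q (nb - m) Sr u \<sigma> w \<and> r - m \<le> min q (nb - m) \<and>
       (let Xrem = (\<lambda>a x. \<Sum>i=1..q. Xr i x * u i a);
            blkX = (\<lambda>a. if a \<le> c then Xc a else Xrem (a - c));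
            blkS = (\<lambda>a j. if a \<le> c \<and> j \<le> m then Scons a j
                          else if c < a \<and> m < j \<and> a - c = j - m then \<sigma> (a - c) else 0)
        in
        (\<forall>j\<in>{1..r}. Vb st' j =
           (if j \<le> m then Umode P j else (\<lambda>v. \<Sum>l=1..nb - m. Va (m + l) v * w l (j - m)))) \<and>
        qr_fact C (c + (r - m)) blkX (nx st') (Xb st') R \<and>
        funs.span (Xb st' ` {1..nx st'}) = funs.span (blkX ` {1..c + (r - m)}) \<and>
        (\<forall>i\<in>{1..nx st'}. \<forall>j\<in>{1..r}. Sc st' i j = (\<Sum>a=1..c + (r - m). R i a * blkS a j))))"

definition bug_step :: "integrator \<Rightarrow> ('x, 'v, 'd::finite) calculus \<Rightarrow> ('x, 'v, 'd, 'k::finite) vp_data \<Rightarrow>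
    (('x \<Rightarrow> real) \<Rightarrow> 'x \<Rightarrow> real^'d) \<Rightarrow> ('k \<Rightarrow> real) \<Rightarrow> ('x, 'v) lr_state \<Rightarrow> ('x, 'v) lr_state \<Rightarrow> bool" where
  "bug_step \<theta> C P \<E> \<Delta>\<beta> st st' \<longleftrightarrow>
     (\<exists>na Xa nb Va. augmentation \<theta> C P \<E> \<Delta>\<beta> st na Xa nb Va \<and>
        cons_truncation C P na Xa nb Va (S_new \<theta> C P \<E> \<Delta>\<beta> st na Xa nb Va) st')"


section \<open>The driving noise\<close>

text \<open>The index set of the filtration and of the processes is the type of real numbers; only times
  \<open>t \<ge> 0\<close> matter.\<close>

definition complete_filtered_space :: "'w measure \<Rightarrow> (real \<Rightarrow> 'w measure) \<Rightarrow> bool" where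
  "complete_filtered_space M F \<longleftrightarrow> prob_space M \<and> complete_measure M \<and>
     filtration (space M) F \<and> (\<forall>t. subalgebra M (F t)) \<and> (\<forall>t\<ge>0. null_sets M \<subseteq> sets (F t))"

definition brownian_motion :: "'w measure \<Rightarrow> (real \<Rightarrow> 'w measure) \<Rightarrow> (real \<Rightarrow> 'w \<Rightarrow> real) \<Rightarrow> bool" where
  "brownian_motion M F B \<longleftrightarrow>
     (\<forall>t\<ge>0. B t \<in> borel_measurable (F t)) \<and>
     (AE \<omega> in M. B 0 \<omega> = 0 \<and> continuous_on {0..} (\<lambda>t. B t \<omega>)) \<and>
     (\<forall>s t. 0 \<le> s \<and> s < t \<longrightarrow>
        distributed M lborel (\<lambda>\<omega>. B t \<omega> - B s \<omega>) (\<lambda>x. ennreal (normal_density 0 (sqrt (t - s)) x))) \<and>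
     (\<forall>(k::nat) (ts::nat \<Rightarrow> real). 0 \<le> ts 0 \<and> mono ts \<longrightarrow>
        prob_space.indep_vars M (\<lambda>_. borel) (\<lambda>i \<omega>. B (ts (Suc i)) \<omega> - B (ts i) \<omega>) {..<k})"

definition independent_brownian_motions :: "'w measure \<Rightarrow> (real \<Rightarrow> 'w measure) \<Rightarrow>
    ('k::finite \<Rightarrow> real \<Rightarrow> 'w \<Rightarrow> real) \<Rightarrow> bool" where
  "independent_brownian_motions M F \<beta> \<longleftrightarrow> (\<forall>s. brownian_motion M F (\<beta> s)) \<and>
     prob_space.indep_vars M (\<lambda>_. Pi\<^sub>M {0..} (\<lambda>_. borel)) (\<lambda>s \<omega>. \<lambda>t\<in>{0..}. \<beta> s t \<omega>) UNIV"

definition dB :: "('k \<Rightarrow> real \<Rightarrow> 'w \<Rightarrow> real) \<Rightarrow> real \<Rightarrow> nat \<Rightarrow> 'w \<Rightarrow> 'k \<Rightarrow> real" where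
  "dB \<beta> \<tau> n \<omega> s = \<beta> s (real (n + 1) * \<tau>) \<omega> - \<beta> s (real n * \<tau>) \<omega>"


section \<open>The exact calculus\<close>

definition partial_d :: "'d \<Rightarrow> (real^'d::finite \<Rightarrow> real) \<Rightarrow> real^'d \<Rightarrow> real" where
  "partial_d l h x = deriv (\<lambda>s. h (x + s *\<^sub>R axis l 1)) 0"

definition C1_fun :: "(real^'d::finite \<Rightarrow> real) set" where
  "C1_fun = {h. continuous_on UNIV h \<and>
     (\<forall>l x. (\<lambda>s. h (x + s *\<^sub>R axis l 1)) field_differentiable at 0) \<and>
     (\<forall>l. continuous_on UNIV (partial_d l h))}"

definition unit_cube :: "(real^'d::finite) set" where
  "unit_cube = {x. \<forall>i. 0 \<le> x $ i \<and> x $ i < 1}"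

typedef ('d::finite) torus = "unit_cube :: (real^'d) set"
  by (rule exI[of _ 0]) (simp add: unit_cube_def)

definition tproj :: "real^'d::finite \<Rightarrow> 'd torus" where
  "tproj x = Abs_torus (\<chi> i. frac (x $ i))"

definition exact_calculus :: "('d::finite torus, real^'d, 'd) calculus" where
  "exact_calculus = \<lparr>
     Mx = distr (restrict_space lborel unit_cube) (vimage_algebra UNIV Rep_torus borel) Abs_torus,
     Mv = lborel,
     vel = (\<lambda>v. v),
     Dx = (\<lambda>l g t. partial_d l (\<lambda>x. g (tproj x)) (Rep_torus t)),
     Dv = partial_d,
     Rx = {g. (\<lambda>x. g (tproj x)) \<in> C1_fun},
     Rv = {p \<in> C1_fun. (\<forall>k\<le>3. integrable lborel (\<lambda>v. norm v ^ k * p v)) \<and>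
             (\<forall>l. \<forall>k\<le>2. integrable lborel (\<lambda>v. norm v ^ k * partial_d l p v))} \<rparr>"

lemma C1_has_derivative_line:
  assumes "h \<in> C1_fun"
  shows "((\<lambda>s. h (x + s *\<^sub>R axis l 1)) has_real_derivative partial_d l h (x + t *\<^sub>R axis l 1)) (at t)"
proof -
  have "(\<lambda>s. h ((x + t *\<^sub>R axis l 1) + s *\<^sub>R axis l 1)) field_differentiable at 0"
    using assms by (simp add: C1_fun_def)
  then have "((\<lambda>s. h ((x + t *\<^sub>R axis l 1) + s *\<^sub>R axis l 1)) has_real_derivative
      partial_d l h (x + t *\<^sub>R axis l 1)) (at 0)"
    unfolding partial_d_def using DERIV_deriv_iff_field_differentiable by blast
  then have "((\<lambda>s. h (x + (s + t) *\<^sub>R axis l 1)) has_real_derivative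
      partial_d l h (x + t *\<^sub>R axis l 1)) (at 0)"
    by (simp add: algebra_simps)
  then show ?thesis
    using DERIV_shift[of "\<lambda>s. h (x + s *\<^sub>R axis l 1)" _ 0 t] by simp
qed

lemma C1_deriv0:
  "h \<in> C1_fun \<Longrightarrow> ((\<lambda>s. h (x + s *\<^sub>R axis l 1)) has_real_derivative partial_d l h x) (at 0)"
  using C1_has_derivative_line[of h x l 0] by simp

lemma C1_continuous: "h \<in> C1_fun \<Longrightarrow> continuous_on UNIV h"
  and C1_continuous_partial: "h \<in> C1_fun \<Longrightarrow> continuous_on UNIV (partial_d l h)"
  by (auto simp: C1_fun_def)

lemma C1_I:
  assumes "continuous_on UNIV h"
    and "\<And>l x. ((\<lambda>s. h (x + s *\<^sub>R axis l 1)) has_real_derivative D l x) (at 0)"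
    and "\<And>l. continuous_on UNIV (D l)"
  shows "h \<in> C1_fun" and "partial_d l h = D l"
proof -
  show *: "partial_d l h = D l" for l
    unfolding partial_d_def using assms(2) by (auto simp: fun_eq_iff intro!: DERIV_imp_deriv)
  show "h \<in> C1_fun"
    unfolding C1_fun_def using assms by (auto simp: * field_differentiable_def)
qed

lemma C1_lin:
  assumes "g \<in> C1_fun" "h \<in> C1_fun"
  shows "(\<lambda>x. a * g x + b * h x) \<in> C1_fun"
    and "partial_d l (\<lambda>x. a * g x + b * h x) = (\<lambda>x. a * partial_d l g x + b * partial_d l h x)"
proof -
  have D: "((\<lambda>s. a * g (x + s *\<^sub>R axis l 1) + b * h (x + s *\<^sub>R axis l 1)) has_real_derivative
     a * partial_d l g x + b * partial_d l h x) (at 0)" for l x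
    by (intro DERIV_add DERIV_cmult C1_deriv0[OF assms(1)] C1_deriv0[OF assms(2)])
  have c: "continuous_on UNIV (\<lambda>x. a * g x + b * h x)"
    "continuous_on UNIV (\<lambda>x. a * partial_d l g x + b * partial_d l h x)" for l
    by (intro continuous_on_mult continuous_on_add continuous_on_const C1_continuous[OF assms(1)]
        C1_continuous[OF assms(2)] C1_continuous_partial[OF assms(1)] C1_continuous_partial[OF assms(2)])+
  show "(\<lambda>x. a * g x + b * h x) \<in> C1_fun"
    and "partial_d l (\<lambda>x. a * g x + b * h x) = (\<lambda>x. a * partial_d l g x + b * partial_d l h x)"
    using C1_I[OF c(1) D c(2)] by auto
qed

lemma C1_mult:
  assumes "g \<in> C1_fun" "h \<in> C1_fun"
  shows "(\<lambda>x. g x * h x) \<in> C1_fun"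
    and "partial_d l (\<lambda>x. g x * h x) = (\<lambda>x. g x * partial_d l h x + partial_d l g x * h x)"
proof -
  have "((\<lambda>s. g (x + s *\<^sub>R axis l 1) * h (x + s *\<^sub>R axis l 1)) has_real_derivative
     g x * partial_d l h x + partial_d l g x * h x) (at 0)" for l x
    using DERIV_mult[OF C1_deriv0[OF assms(1), of x l] C1_deriv0[OF assms(2), of x l]]
    by (simp add: algebra_simps)
  note D = this
  have c: "continuous_on UNIV (\<lambda>x. g x * h x)"
    "continuous_on UNIV (\<lambda>x. g x * partial_d l h x + partial_d l g x * h x)" for l
    by (intro continuous_on_mult continuous_on_add C1_continuous[OF assms(1)] C1_continuous[OF assms(2)]
        C1_continuous_partial[OF assms(1)] C1_continuous_partial[OF assms(2)])+
  show "(\<lambda>x. g x * h x) \<in> C1_fun"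
    and "partial_d l (\<lambda>x. g x * h x) = (\<lambda>x. g x * partial_d l h x + partial_d l g x * h x)"
    using C1_I[OF c(1) D c(2)] by auto
qed

lemma C1_const:
  shows "(\<lambda>x::real^'d::finite. c) \<in> C1_fun"
    and partial_const[simp]: "partial_d l (\<lambda>x::real^'d::finite. c) = (\<lambda>_. 0)"
  by (rule C1_I[where D="\<lambda>_ _. 0"]; auto)+

lemma C1_coord:
  shows "(\<lambda>x::real^'d::finite. x $ i) \<in> C1_fun"
    and "partial_d l (\<lambda>x::real^'d. x $ i) = (\<lambda>_. if i = l then 1 else 0)"
proof -
  have D: "((\<lambda>s. (x + s *\<^sub>R axis l 1) $ i) has_real_derivative (if i = l then 1 else 0)) (at 0)"
    for x :: "real^'d" and l
    by (auto simp: axis_def intro!: derivative_eq_intros)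
  have c: "continuous_on UNIV (\<lambda>x::real^'d. x $ i)"
    "continuous_on UNIV (\<lambda>x::real^'d. if i = l then 1 else 0 :: real)" for l
    by (intro continuous_intros)+
  show "(\<lambda>x::real^'d::finite. x $ i) \<in> C1_fun"
    and "partial_d l (\<lambda>x::real^'d. x $ i) = (\<lambda>_. if i = l then 1 else 0)"
    using C1_I[OF c(1) D c(2)] by auto
qed

lemma C1_normsq:
  shows "(\<lambda>x::real^'d::finite. (norm x)\<^sup>2) \<in> C1_fun"
    and "partial_d l (\<lambda>x::real^'d. (norm x)\<^sup>2) = (\<lambda>x. 2 * x $ l)"
proof -
  have "((\<lambda>s. (norm (x + s *\<^sub>R axis l 1))\<^sup>2) has_real_derivative 2 * x $ l) (at 0)"
    for x :: "real^'d" and l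
  proof -
    have "(norm (x + s *\<^sub>R axis l 1))\<^sup>2 = (norm x)\<^sup>2 + 2 * s * x $ l + s\<^sup>2" for s
      unfolding power2_norm_eq_inner
      by (simp add: inner_add_left inner_add_right inner_axis inner_axis' power2_eq_square algebra_simps)
    then show ?thesis by (auto intro!: derivative_eq_intros)
  qed
  note D = this
  have c: "continuous_on UNIV (\<lambda>x::real^'d. (norm x)\<^sup>2)" "continuous_on UNIV (\<lambda>x::real^'d. 2 * x $ l)" for l
    by (intro continuous_intros)+
  show "(\<lambda>x::real^'d::finite. (norm x)\<^sup>2) \<in> C1_fun"
    and "partial_d l (\<lambda>x::real^'d. (norm x)\<^sup>2) = (\<lambda>x. 2 * x $ l)"
    using C1_I[OF c(1) D c(2)] by auto
qed

lemma C1_FTC: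
  assumes "h \<in> C1_fun"
  shows "(\<integral>s. indicator {0..1} s * partial_d l h (x + s *\<^sub>R axis l 1) \<partial>lborel) = h (x + axis l 1) - h x"
proof -
  have "(\<integral>s. indicator {0..1} s *\<^sub>R partial_d l h (x + s *\<^sub>R axis l 1) \<partial>lborel)
      = h (x + 1 *\<^sub>R axis l 1) - h (x + 0 *\<^sub>R axis l 1)"
  proof (rule integral_FTC_atLeastAtMost)
    show "continuous_on {0..1} (\<lambda>s. partial_d l h (x + s *\<^sub>R axis l 1))"
      by (intro continuous_on_compose2[OF C1_continuous_partial[OF assms]] continuous_intros) auto
  qed (auto intro!: has_vector_derivative_at_within DERIV_subset[OF C1_has_derivative_line[OF assms]]
         simp flip: has_real_derivative_iff_has_vector_derivative)
  then show ?thesis by simp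
qed

lemma integral_shift:
  fixes k :: "real^'d::finite \<Rightarrow> real"
  assumes "k \<in> borel_measurable borel"
  shows "(\<integral>x. k (x + c) \<partial>lborel) = (\<integral>x. k x \<partial>lborel)"
    and "integrable lborel (\<lambda>x. k (x + c)) \<longleftrightarrow> integrable lborel k"
proof -
  have *: "distr lborel borel ((+) c) = (lborel :: (real^'d) measure)" by (rule lborel_distr_plus)
  show "(\<integral>x. k (x + c) \<partial>lborel) = (\<integral>x. k x \<partial>lborel)"
    using integral_distr[of "(+) c" lborel borel k] assms by (simp add: * add.commute)
  show "integrable lborel (\<lambda>x. k (x + c)) \<longleftrightarrow> integrable lborel k"
    using integrable_distr_eq[of "(+) c" lborel borel k] assms by (simp add: * add.commute)
qed

text \<open>Integrating a derivative against a weight \<open>w\<close>, given translation invariance of the integral.\<close>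

lemma integral_partial_zero:
  fixes h :: "real^'d::finite \<Rightarrow> real" and w :: "real^'d \<Rightarrow> real"
  assumes h: "h \<in> C1_fun" and w[measurable]: "w \<in> borel_measurable borel"
    and int: "\<And>s. s \<in> {0..1} \<Longrightarrow> integrable lborel (\<lambda>x. w x * partial_d l h (x + s *\<^sub>R axis l 1))"
    and abs_inv: "\<And>s. s \<in> {0..1} \<Longrightarrow>
        (\<integral>x. \<bar>w x * partial_d l h (x + s *\<^sub>R axis l 1)\<bar> \<partial>lborel) = A"
    and inv: "\<And>s. s \<in> {0..1} \<Longrightarrow>
        (\<integral>x. w x * partial_d l h (x + s *\<^sub>R axis l 1) \<partial>lborel) = B"
    and zero: "(\<integral>x. w x * (h (x + axis l 1) - h x) \<partial>lborel) = 0"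
  shows "B = 0"
proof -
  have [measurable]: "partial_d l h \<in> borel_measurable borel"
    using C1_continuous_partial[OF h] by (rule borel_measurable_continuous_onI)
  define F where "F s x = indicator {0..1::real} s * (w x * partial_d l h (x + s *\<^sub>R axis l 1))" for s x
  have "integrable (lborel \<Otimes>\<^sub>M lborel) (case_prod F)"
  proof (rule lborel_pair.Fubini_integrable)
    show "case_prod F \<in> borel_measurable (lborel \<Otimes>\<^sub>M lborel)"
      unfolding F_def by measurable
    have "(\<lambda>s. \<integral>x. norm (case_prod F (s, x)) \<partial>lborel) = (\<lambda>s. indicator {0..1} s * A)"
    proof
      fix s show "(\<integral>x. norm (case_prod F (s, x)) \<partial>lborel) = indicator {0..1} s * A"
        using abs_inv[of s] by (cases "s \<in> {0..1}") (auto simp: F_def)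
    qed
    then show "integrable lborel (\<lambda>s. \<integral>x. norm (case_prod F (s, x)) \<partial>lborel)"
      by simp
    show "AE s in lborel. integrable lborel (\<lambda>x. case_prod F (s, x))"
    proof (rule AE_I2)
      fix s :: real show "integrable lborel (\<lambda>x. case_prod F (s, x))"
        using int[of s] by (cases "s \<in> {0..1}") (auto simp: F_def)
    qed
  qed
  from lborel_pair.Fubini_integral[OF this]
  have "(\<integral>x. (\<integral>s. F s x \<partial>lborel) \<partial>lborel) = (\<integral>s. (\<integral>x. F s x \<partial>lborel) \<partial>lborel)" .
  also have "(\<lambda>s. \<integral>x. F s x \<partial>lborel) = (\<lambda>s. indicator {0..1} s * B)"
  proof
    fix s show "(\<integral>x. F s x \<partial>lborel) = indicator {0..1} s * B"
      using inv[of s] by (cases "s \<in> {0..1}") (auto simp: F_def)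
  qed
  also have "(\<integral>s. indicator {0..1::real} s * B \<partial>lborel) = B" by simp
  also have "(\<lambda>x. \<integral>s. F s x \<partial>lborel) = (\<lambda>x. w x * (h (x + axis l 1) - h x))"
  proof
    fix x
    have "(\<integral>s. F s x \<partial>lborel) =
        (\<integral>s. w x * (indicator {0..1} s * partial_d l h (x + s *\<^sub>R axis l 1)) \<partial>lborel)"
      by (simp add: F_def ac_simps)
    also have "\<dots> = w x * (h (x + axis l 1) - h x)"
      unfolding integral_mult_right_zero C1_FTC[OF h] ..
    finally show "(\<integral>s. F s x \<partial>lborel) = w x * (h (x + axis l 1) - h x)" .
  qed
  finally show ?thesis using zero by simp
qed

lemma integral_partial_Rd:
  fixes h :: "real^'d::finite \<Rightarrow> real"
  assumes h: "h \<in> C1_fun" and int: "integrable lborel h" "integrable lborel (partial_d l h)"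
  shows "(\<integral>x. partial_d l h x \<partial>lborel) = 0"
proof -
  have [measurable]: "partial_d l h \<in> borel_measurable borel" "h \<in> borel_measurable borel"
    using C1_continuous_partial[OF h] C1_continuous[OF h] by (auto intro: borel_measurable_continuous_onI)
  show ?thesis
  proof (rule integral_partial_zero[OF h, where w="\<lambda>_. 1" and l=l])
    show "(\<integral>x. \<bar>1 * partial_d l h (x + s *\<^sub>R axis l 1)\<bar> \<partial>lborel) = (\<integral>x. \<bar>partial_d l h x\<bar> \<partial>lborel)" for s
      using integral_shift(1)[of "\<lambda>x. \<bar>partial_d l h x\<bar>"] by simp
    show "(\<integral>x. 1 * (h (x + axis l 1) - h x) \<partial>lborel) = 0"
      using integral_shift[of h "axis l 1"] int by simp
  qed (use integral_shift[of "partial_d l h"] int in auto)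
qed

text \<open>Shift invariance over the unit cube for functions that are periodic in direction \<open>l\<close>.\<close>

lemma unit_cube_measurable[measurable]: "(unit_cube :: (real^'d::finite) set) \<in> sets borel"
  unfolding unit_cube_def by measurable

lemma integrable_on_bounded:
  fixes k :: "real^'d::finite \<Rightarrow> real"
  assumes k: "continuous_on UNIV k" and A: "A \<subseteq> cbox a b" "A \<in> sets borel"
  shows "integrable lborel (\<lambda>x. indicator A x * k x)"
proof -
  have [measurable]: "k \<in> borel_measurable borel"
    using k by (rule borel_measurable_continuous_onI)
  have "integrable lborel (\<lambda>x. indicator (cbox a b) x *\<^sub>R k x)"
    by (intro borel_integrable_compact continuous_on_subset[OF k]) auto
  then show ?thesis
    by (rule Bochner_Integration.integrable_bound) (use A in \<open>auto simp: indicator_def\<close>)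
qed

lemma cube_shift:
  fixes k :: "real^'d::finite \<Rightarrow> real"
  assumes k: "continuous_on UNIV k" and per: "\<And>x. k (x + axis l 1) = k x" and s: "s \<in> {0..1}"
  shows "(\<integral>x. indicator unit_cube x * k (x + s *\<^sub>R axis l 1) \<partial>lborel) = (\<integral>x. indicator unit_cube x * k x \<partial>lborel)"
    and "integrable lborel (\<lambda>x. indicator unit_cube x * k (x + s *\<^sub>R axis l 1))"
proof -
  have [measurable]: "k \<in> borel_measurable borel"
    using k by (rule borel_measurable_continuous_onI)
  define slab :: "real \<Rightarrow> real \<Rightarrow> (real^'d) set"
    where "slab a b = {x. (\<forall>i. i \<noteq> l \<longrightarrow> 0 \<le> x $ i \<and> x $ i < 1) \<and> a \<le> x $ l \<and> x $ l < b}" for a b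
  have [measurable]: "slab a b \<in> sets borel" for a b
    unfolding slab_def by measurable
  have slab_int: "integrable lborel (\<lambda>x. indicator (slab a b) x * k x)" if "0 \<le> a" "b \<le> 2" for a b
  proof (rule integrable_on_bounded[OF k])
    show "slab a b \<subseteq> cbox 0 (\<chi> i. 2)"
    proof
      fix x assume x: "x \<in> slab a b"
      have "0 \<le> x $ i \<and> x $ i \<le> 2" for i
        using x that by (cases "i = l") (force simp: slab_def)+
      then show "x \<in> cbox 0 (\<chi> i. 2)" by (auto simp: mem_box_cart)
    qed
  qed simp
  have shift: "(\<lambda>x. indicator unit_cube (x + (- s) *\<^sub>R axis l 1)) = (indicator (slab s (1 + s)) :: _ \<Rightarrow> real)"
  proof
    fix x :: "real^'d"
    have "x + (- s) *\<^sub>R axis l 1 \<in> unit_cube \<longleftrightarrow> x \<in> slab s (1 + s)"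
      unfolding unit_cube_def slab_def by (auto simp: axis_def)
    then show "indicator unit_cube (x + (- s) *\<^sub>R axis l 1) = (indicator (slab s (1 + s)) x :: real)"
      by (simp add: indicator_def)
  qed
  show "integrable lborel (\<lambda>x. indicator unit_cube x * k (x + s *\<^sub>R axis l 1))"
    by (subst integral_shift(2)[where c="(- s) *\<^sub>R axis l 1", symmetric])
      (use slab_int[of s "1 + s"] s in \<open>simp_all add: fun_cong[OF shift, simplified]\<close>)
  have "(\<integral>x. indicator unit_cube x * k (x + s *\<^sub>R axis l 1) \<partial>lborel)
      = (\<integral>x. indicator (slab s (1 + s)) x * k x \<partial>lborel)"
    by (subst integral_shift(1)[where c="(- s) *\<^sub>R axis l 1", symmetric])
      (simp_all add: fun_cong[OF shift, simplified])
  also have "\<dots> = (\<integral>x. indicator (slab s 1) x * k x + indicator (slab 1 (1 + s)) x * k x \<partial>lborel)"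
    by (intro Bochner_Integration.integral_cong) (use s in \<open>auto simp: indicator_def slab_def\<close>)
  also have "\<dots> = (\<integral>x. indicator (slab s 1) x * k x \<partial>lborel) + (\<integral>x. indicator (slab 1 (1 + s)) x * k x \<partial>lborel)"
    using s by (intro Bochner_Integration.integral_add slab_int) auto
  also have "(\<integral>x. indicator (slab 1 (1 + s)) x * k x \<partial>lborel)
      = (\<integral>x. indicator (slab 1 (1 + s)) (x + axis l 1) * k (x + axis l 1) \<partial>lborel)"
    by (rule integral_shift(1)[symmetric]) measurable
  also have "\<dots> = (\<integral>x. indicator (slab 0 s) x * k x \<partial>lborel)"
  proof (intro Bochner_Integration.integral_cong refl)
    fix x :: "real^'d"
    have "(x + axis l 1) $ i = x $ i + (if i = l then 1 else 0)" for i
      by (simp add: axis_def)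
    then have "x + axis l 1 \<in> slab 1 (1 + s) \<longleftrightarrow> x \<in> slab 0 s"
      unfolding slab_def mem_Collect_eq by simp
    then show "indicator (slab 1 (1 + s)) (x + axis l 1) * k (x + axis l 1) = indicator (slab 0 s) x * k x"
      by (simp add: indicator_def per)
  qed
  also have "(\<integral>x. indicator (slab s 1) x * k x \<partial>lborel) + (\<integral>x. indicator (slab 0 s) x * k x \<partial>lborel)
      = (\<integral>x. indicator (slab s 1) x * k x + indicator (slab 0 s) x * k x \<partial>lborel)"
    using s by (intro Bochner_Integration.integral_add[symmetric] slab_int) auto
  also have "\<dots> = (\<integral>x. indicator unit_cube x * k x \<partial>lborel)"
  proof (intro Bochner_Integration.integral_cong refl)
    fix x :: "real^'d"
    have "x \<in> unit_cube \<longleftrightarrow> x \<in> slab 0 1"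
      unfolding unit_cube_def slab_def by auto
    then show "indicator (slab s 1) x * k x + indicator (slab 0 s) x * k x = indicator unit_cube x * k x"
      using s by (auto simp: indicator_def slab_def)
  qed
  finally show "(\<integral>x. indicator unit_cube x * k (x + s *\<^sub>R axis l 1) \<partial>lborel) = (\<integral>x. indicator unit_cube x * k x \<partial>lborel)" .
qed

lemma integral_partial_cube:
  fixes h :: "real^'d::finite \<Rightarrow> real"
  assumes h: "h \<in> C1_fun" and per: "\<And>x. h (x + axis l 1) = h x"
  shows "(\<integral>x. indicator unit_cube x * partial_d l h x \<partial>lborel) = 0"
proof -
  have per': "partial_d l h (x + axis l 1) = partial_d l h x" for x
  proof -
    have "h (x + axis l 1 + s *\<^sub>R axis l 1) = h (x + s *\<^sub>R axis l 1)" for s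
      using per[of "x + s *\<^sub>R axis l 1"] by (simp add: ac_simps)
    then show ?thesis by (simp add: partial_d_def)
  qed
  note c = C1_continuous_partial[OF h, of l]
  show ?thesis
  proof (rule integral_partial_zero[OF h, where w="indicator unit_cube" and l=l])
    show "(\<integral>x. \<bar>indicator unit_cube x * partial_d l h (x + s *\<^sub>R axis l 1)\<bar> \<partial>lborel)
        = (\<integral>x. indicator unit_cube x * \<bar>partial_d l h x\<bar> \<partial>lborel)" if "s \<in> {0..1}" for s
      using cube_shift(1)[of "\<lambda>x. \<bar>partial_d l h x\<bar>" l s] that c
      by (simp add: per' abs_mult continuous_on_rabs)
  qed (use cube_shift[OF c per'] in \<open>auto simp: per\<close>)
qed

lemma tproj_periodic:
  assumes "\<And>i. z $ i \<in> \<int>"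
  shows "tproj (x + z) = tproj x"
proof -
  have "frac (x $ i + z $ i) = frac (x $ i)" for i
    using assms[of i] by (auto elim!: Ints_cases)
  then show ?thesis by (simp add: tproj_def)
qed

lemma Rep_tproj: "Rep_torus (tproj x) = (\<chi> i. frac (x $ i))"
  unfolding tproj_def by (rule Abs_torus_inverse) (simp add: unit_cube_def frac_lt_1)

lemma tproj_cube: "x \<in> unit_cube \<Longrightarrow> tproj x = Abs_torus x"
  unfolding tproj_def by (rule arg_cong[of _ _ Abs_torus])
    (auto simp: unit_cube_def vec_eq_iff frac_eq)

lemma tproj_Rep: "tproj (Rep_torus t) = t"
  using tproj_cube[OF Rep_torus] by (simp add: Rep_torus_inverse)

lemma Dx_tproj:
  "Dx exact_calculus l g (tproj x) = partial_d l (\<lambda>x. g (tproj x)) x"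
proof -
  define z :: "real^'a" where "z = (\<chi> i. frac (x $ i) - x $ i)"
  have "z $ i \<in> \<int>" for i by (simp add: z_def frac_def)
  then have "tproj (y + z) = tproj y" for y by (rule tproj_periodic)
  moreover have "Rep_torus (tproj x) = x + z" by (simp add: Rep_tproj z_def vec_eq_iff)
  moreover have "x + z + s *\<^sub>R axis l 1 = (x + s *\<^sub>R axis l 1) + z" for s
    by simp
  ultimately show ?thesis
    by (simp only: exact_calculus_def partial_d_def calculus.simps)
qed

lemma Abs_torus_measurable:
  "Abs_torus \<in> restrict_space lborel unit_cube \<rightarrow>\<^sub>M vimage_algebra UNIV Rep_torus borel"
proof (rule measurable_vimage_algebra2)
  have "(\<lambda>x. x) \<in> borel_measurable (restrict_space lborel (unit_cube :: (real^'a) set))"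
    by (intro measurable_restrict_space1) simp
  then show "(\<lambda>x. Rep_torus (Abs_torus x)) \<in> borel_measurable (restrict_space lborel (unit_cube :: (real^'a) set))"
    by (rule measurable_cong[THEN iffD1, rotated])
      (simp add: space_restrict_space Abs_torus_inverse)
qed simp

lemma torus_continuous:
  fixes g :: "'d::finite torus \<Rightarrow> real"
  assumes c: "continuous_on UNIV (\<lambda>x. g (tproj x))"
  shows "g \<in> borel_measurable (Mx exact_calculus)"
    and "bounded (range g)"
    and "integrable (Mx exact_calculus) g"
    and "(\<integral>t. g t \<partial>Mx exact_calculus) = (\<integral>x. indicator unit_cube x * g (tproj x) \<partial>lborel)"
proof -
  have "(\<lambda>x. g (tproj x)) \<in> borel_measurable borel"
    using c by (rule borel_measurable_continuous_onI)
  from measurable_compose[OF measurable_vimage_algebra1 this, of Rep_torus UNIV]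
  have m: "g \<in> borel_measurable (vimage_algebra UNIV Rep_torus borel)"
    by (simp add: tproj_Rep)
  then show "g \<in> borel_measurable (Mx exact_calculus)"
    by (simp add: exact_calculus_def)
  have "compact ((\<lambda>x. g (tproj x)) ` cbox 0 (\<chi> i. 1))"
    by (intro compact_continuous_image continuous_on_subset[OF c]) auto
  then have "bounded ((\<lambda>x. g (tproj x)) ` cbox 0 (\<chi> i. 1))"
    by (rule compact_imp_bounded)
  moreover have "range g \<subseteq> (\<lambda>x. g (tproj x)) ` cbox 0 (\<chi> i. 1)"
  proof safe
    fix t :: "'d torus"
    have "Rep_torus t \<in> cbox 0 (\<chi> i. 1)"
      using Rep_torus[of t] by (auto simp: unit_cube_def mem_box_cart less_imp_le)
    then show "g t \<in> (\<lambda>x. g (tproj x)) ` cbox 0 (\<chi> i. 1)"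
      by (intro image_eqI[of _ _ "Rep_torus t"]) (simp_all add: tproj_Rep)
  qed
  ultimately show "bounded (range g)" by (rule bounded_subset)
  have eq: "indicator unit_cube x * g (Abs_torus x) = indicator unit_cube x * g (tproj x)" for x
    by (auto simp: indicator_def tproj_cube)
  have "unit_cube \<subseteq> cbox 0 ((\<chi> i. 1) :: real^'d)"
    by (auto simp: unit_cube_def mem_box_cart less_imp_le)
  then show "integrable (Mx exact_calculus) g"
    using integrable_on_bounded[OF c, of unit_cube 0 "\<chi> i. 1"]
    by (simp add: exact_calculus_def integrable_distr_eq[OF Abs_torus_measurable m]
        integrable_restrict_space eq)
  show "(\<integral>t. g t \<partial>Mx exact_calculus) = (\<integral>x. indicator unit_cube x * g (tproj x) \<partial>lborel)"
    by (simp add: exact_calculus_def integral_distr[OF Abs_torus_measurable m]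
        integral_restrict_space eq)
qed

lemma funs_subspaceI:
  assumes "\<And>a b (g::'a \<Rightarrow> real) h. g \<in> S \<Longrightarrow> h \<in> S \<Longrightarrow> (\<lambda>x. a * g x + b * h x) \<in> S" and "S \<noteq> {}"
  shows "funs.subspace S"
proof (rule funs.subspaceI)
  obtain g where g: "g \<in> S" using assms(2) by auto
  show "0 \<in> S" using assms(1)[OF g g, of 0 0] by (simp add: zero_fun_def)
  show "g + h \<in> S" if "g \<in> S" "h \<in> S" for g h
    using assms(1)[OF that, of 1 1] by (simp add: plus_fun_def)
  show "(\<lambda>x. c * g x) \<in> S" if "g \<in> S" for c g
    using assms(1)[OF that that, of c 0] by simp
qed

theorem exact_calculus: "vp_calculus (exact_calculus :: ('d::finite torus, real^'d, 'd) calculus)"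
proof -
  let ?C = "exact_calculus :: ('d torus, real^'d, 'd) calculus"
  have Rx: "Rx ?C = {g. (\<lambda>x. g (tproj x)) \<in> C1_fun}"
    and Rv: "Rv ?C = {p \<in> C1_fun. (\<forall>k\<le>3. integrable lborel (\<lambda>v. norm v ^ k * p v)) \<and>
             (\<forall>l. \<forall>k\<le>2. integrable lborel (\<lambda>v. norm v ^ k * partial_d l p v))}"
    and [simp]: "Mv ?C = lborel" "vel ?C = (\<lambda>v. v)" "Dv ?C = partial_d"
    by (simp_all add: exact_calculus_def)
  have nz: "(\<lambda>_. 0) \<in> Rx ?C" "(\<lambda>_. 0) \<in> Rv ?C"
    by (auto simp: Rx Rv C1_const)
  have Dx_cont: "continuous_on UNIV (\<lambda>x. Dx ?C l g (tproj x))" if "g \<in> Rx ?C" for g l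
    unfolding Dx_tproj using that by (auto simp: Rx intro: C1_continuous_partial)
  have ibp: "(\<integral>v. \<phi> v * partial_d l p v \<partial>lborel) = - (\<integral>v. partial_d l \<phi> v * p v \<partial>lborel)"
    if p: "p \<in> Rv ?C" and \<phi>: "\<phi> \<in> C1_fun"
      and b: "\<And>v. \<bar>\<phi> v\<bar> \<le> norm v ^ k" "\<And>v. \<bar>partial_d l \<phi> v\<bar> \<le> 2 * norm v ^ j" and kj: "k \<le> 2" "j \<le> 1"
    for p \<phi> l k j
  proof -
    have p1: "p \<in> C1_fun" using p by (simp add: Rv)
    have [measurable]: "p \<in> borel_measurable borel" "partial_d l p \<in> borel_measurable borel"
      "\<phi> \<in> borel_measurable borel" "partial_d l \<phi> \<in> borel_measurable borel"
      using p1 \<phi> by (auto intro: borel_measurable_continuous_onI C1_continuous C1_continuous_partial)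
    have i1: "integrable lborel (\<lambda>v. \<phi> v * p v)"
      by (rule Bochner_Integration.integrable_bound[of _ "\<lambda>v. norm v ^ k * p v"])
        (use p kj b in \<open>auto simp: Rv abs_mult intro!: mult_right_mono\<close>)
    have i2: "integrable lborel (\<lambda>v. \<phi> v * partial_d l p v)"
      by (rule Bochner_Integration.integrable_bound[of _ "\<lambda>v. norm v ^ k * partial_d l p v"])
        (use p kj b in \<open>auto simp: Rv abs_mult intro!: mult_right_mono\<close>)
    have "integrable lborel (\<lambda>v. 2 * (norm v ^ j * p v))"
      using p kj by (intro integrable_mult_right) (auto simp: Rv)
    then have i3: "integrable lborel (\<lambda>v. partial_d l \<phi> v * p v)"
      by (rule Bochner_Integration.integrable_bound)
        (use b in \<open>auto simp: abs_mult mult.assoc[symmetric] intro!: mult_right_mono\<close>)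
    have "(\<integral>v. partial_d l (\<lambda>v. \<phi> v * p v) v \<partial>lborel) = 0"
      by (rule integral_partial_Rd[OF C1_mult(1)[OF \<phi> p1] i1])
        (simp add: C1_mult(2)[OF \<phi> p1] i2 i3)
    then show ?thesis by (simp add: C1_mult(2)[OF \<phi> p1] i2 i3)
  qed
  show ?thesis
  proof (rule vp_calculus.intro)
    show "finite_measure (Mx ?C)"
    proof (rule finite_measureI)
      have "integrable (Mx ?C) (\<lambda>_. 1::real)" by (rule torus_continuous(3)) simp
      then show "emeasure (Mx ?C) (space (Mx ?C)) \<noteq> \<infinity>"
        by (simp add: integrable_iff_bounded)
    qed
    show "sigma_finite_measure (Mv ?C)" by (simp add: sigma_finite_lborel)
    show "space (Mx ?C) = UNIV" by (simp add: exact_calculus_def)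
    show "funs.subspace (Rx ?C)"
      by (rule funs_subspaceI) (use nz in \<open>auto simp: Rx intro: C1_lin\<close>)
    show "funs.subspace (Rv ?C)"
    proof (rule funs_subspaceI)
      fix a b g h assume "g \<in> Rv ?C" "h \<in> Rv ?C"
      then show "(\<lambda>x. a * g x + b * h x) \<in> Rv ?C"
        by (auto simp: Rv C1_lin distrib_left mult.left_commute[of "norm _ ^ _"])
    qed (use nz in auto)
    show "g \<in> borel_measurable (Mx ?C)" "bounded (range g)" if "g \<in> Rx ?C" for g
      using that torus_continuous[of g] by (auto simp: Rx intro: C1_continuous)
    show "Dx ?C l (\<lambda>x. a * g x + b * h x) = (\<lambda>x. a * Dx ?C l g x + b * Dx ?C l h x)"
      if "g \<in> Rx ?C" "h \<in> Rx ?C" for g h l a b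
      using that by (simp add: exact_calculus_def C1_lin)
    show "integrable (Mx ?C) (Dx ?C l g)" if "g \<in> Rx ?C" for g l
      using Dx_cont[OF that] by (rule torus_continuous)
    show "(\<integral>x. Dx ?C l g x \<partial>Mx ?C) = 0" if "g \<in> Rx ?C" for g l
      unfolding torus_continuous(4)[OF Dx_cont[OF that]] unfolding Dx_tproj
      by (rule integral_partial_cube) (use that in \<open>auto simp: Rx tproj_periodic axis_def\<close>)
    show "(\<integral>v. Dv ?C l p v \<partial>Mv ?C) = 0" if "p \<in> Rv ?C" for p l
      using ibp[OF that C1_const(1)[of 1], where k=0 and j=0 and l=l] by simp
    show "(\<integral>v. vel ?C v $ i * Dv ?C l p v \<partial>Mv ?C) = - (if i = l then 1 else 0) * (\<integral>v. p v \<partial>Mv ?C)"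
      if "p \<in> Rv ?C" for p l i
      using ibp[OF that C1_coord(1)[of i], where k=1 and j=0 and l=l]
      by (simp add: C1_coord(2) component_le_norm_cart)
    show "(\<integral>v. (norm (vel ?C v))\<^sup>2 * Dv ?C l p v \<partial>Mv ?C) = - 2 * (\<integral>v. vel ?C v $ l * p v \<partial>Mv ?C)"
      if "p \<in> Rv ?C" for p l
      using ibp[OF that C1_normsq(1), where k=2 and j=1 and l=l]
      by (simp add: C1_normsq(2) component_le_norm_cart abs_mult mult.assoc)
  qed (auto simp: Rv C1_lin)
qed


section \<open>The centered-difference calculus\<close>

text \<open>
  Periodic spatial grid \<open>'g^'d\<close>, where \<open>'g\<close> is a finite ring such as a numeral type, and velocity
  grid \<open>hv \<int>\<^sup>d\<close>.
\<close>

definition grid_calculus :: "real \<Rightarrow> real \<Rightarrow> ('g::{finite, comm_ring_1}^'d::finite, int^'d, 'd) calculus" where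
  "grid_calculus hx hv = \<lparr>
     Mx = density (count_space UNIV) (\<lambda>_. ennreal (hx ^ CARD('d))),
     Mv = density (count_space UNIV) (\<lambda>_. ennreal (hv ^ CARD('d))),
     vel = (\<lambda>v. \<chi> i. hv * of_int (v $ i)),
     Dx = (\<lambda>l g x. (g (x + axis l 1) - g (x - axis l 1)) / (2 * hx)),
     Dv = (\<lambda>l p v. (p (v + axis l 1) - p (v - axis l 1)) / (2 * hv)),
     Rx = UNIV,
     Rv = {p. \<forall>k\<le>3. integrable (density (count_space UNIV) (\<lambda>_. ennreal (hv ^ CARD('d))))
             (\<lambda>v. norm ((\<chi> i. hv * of_int (v $ i)) :: real^'d) ^ k * p v)} \<rparr>"

lemma bij_add: "bij_betw (\<lambda>v. v + c) UNIV (UNIV :: 'a::group_add set)"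
  by (rule bij_betwI[where g="\<lambda>v. v - c"]) auto

theorem grid_calculus:
  assumes hx: "0 < hx" and hv: "0 < hv"
  shows "vp_calculus (grid_calculus hx hv :: ('g::{finite, comm_ring_1}^'d::finite, int^'d, 'd) calculus)"
proof -
  let ?C = "grid_calculus hx hv :: ('g^'d, int^'d, 'd) calculus"
  define N :: "(int^'d) measure" where "N = count_space UNIV"
  define V :: "int^'d \<Rightarrow> real^'d" where "V v = (\<chi> i. hv * of_int (v $ i))" for v
  have [simp]: "Rx ?C = UNIV" "Dx ?C = (\<lambda>l g x. (g (x + axis l 1) - g (x - axis l 1)) / (2 * hx))"
    "Dv ?C = (\<lambda>l p v. (p (v + axis l 1) - p (v - axis l 1)) / (2 * hv))"
    and velC[simp]: "vel ?C = V"
    by (simp_all add: grid_calculus_def V_def fun_eq_iff)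
  have Mv: "Mv ?C = density N (\<lambda>_. ennreal (hv ^ CARD('d)))"
    and Mx: "Mx ?C = density (count_space UNIV) (\<lambda>_. ennreal (hx ^ CARD('d)))"
    by (simp_all add: grid_calculus_def N_def)
  have [simp]: "integrable (Mv ?C) p \<longleftrightarrow> integrable N p"
    and Mv_int[simp]: "(\<integral>v. p v \<partial>Mv ?C) = hv ^ CARD('d) * (\<integral>v. p v \<partial>N)" for p :: "int^'d \<Rightarrow> real"
    using hv by (simp_all add: Mv N_def integrable_density integral_density)
  have Rv: "Rv ?C = {p. \<forall>k\<le>3. integrable N (\<lambda>v. norm (V v) ^ k * p v)}"
    using hv by (simp add: grid_calculus_def N_def V_def integrable_density)
  have [simp]: "integrable (Mx ?C) g" "(\<integral>x. g x \<partial>Mx ?C) = hx ^ CARD('d) * (\<Sum>x\<in>UNIV. g x)"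
    for g :: "'g^'d \<Rightarrow> real"
    using hx by (simp_all add: Mx integrable_density integral_density lebesgue_integral_count_space_finite
        integrable_count_space sum_distrib_left)
  have shift: "integrable N (\<lambda>v. q (v + c)) \<longleftrightarrow> integrable N q" "(\<integral>v. q (v + c) \<partial>N) = (\<integral>v. q v \<partial>N)"
    for q :: "int^'d \<Rightarrow> real" and c
    unfolding N_def by (rule integrable_bij_count_space[OF bij_add]) (rule integral_bij_count_space[OF bij_add])
  have Vadd: "V (v + c) = V v + V c" for v c by (simp add: V_def vec_eq_iff algebra_simps)
  have Vax: "V (axis l 1) = hv *\<^sub>R axis l 1" for l by (simp add: V_def axis_def vec_eq_iff)
  have Vdiff: "V (v - c) = V v - V c" for v c by (simp add: V_def vec_eq_iff algebra_simps)
  have mom: "integrable N (\<lambda>v. norm (V v) ^ k * p (v + c))" if p: "p \<in> Rv ?C" and k: "k \<le> 3" for p k c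
  proof -
    have "integrable N (\<lambda>v. norm (V (v - c)) ^ k * p v)"
    proof (rule Bochner_Integration.integrable_bound)
      show "integrable N (\<lambda>v. \<Sum>j\<le>k. of_nat (k choose j) * norm (V c) ^ (k - j) * (norm (V v) ^ j * p v))"
        using p k by (intro Bochner_Integration.integrable_sum integrable_mult_right) (auto simp: Rv)
      have "norm (V (v - c)) ^ k \<le> (\<Sum>j\<le>k. of_nat (k choose j) * norm (V v) ^ j * norm (V c) ^ (k - j))" for v
        unfolding binomial_ring[symmetric] Vdiff by (intro power_mono norm_triangle_ineq4) simp
      then have "\<bar>norm (V (v - c)) ^ k * p v\<bar> \<le>
          (\<Sum>j\<le>k. of_nat (k choose j) * norm (V v) ^ j * norm (V c) ^ (k - j)) * \<bar>p v\<bar>" for v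
        by (simp add: abs_mult mult_right_mono)
      also have "\<dots> v = \<bar>\<Sum>j\<le>k. of_nat (k choose j) * norm (V c) ^ (k - j) * (norm (V v) ^ j * p v)\<bar>" for v
      proof -
        have "(\<Sum>j\<le>k. of_nat (k choose j) * norm (V c) ^ (k - j) * (norm (V v) ^ j * p v)) =
          (\<Sum>j\<le>k. of_nat (k choose j) * norm (V v) ^ j * norm (V c) ^ (k - j)) * p v"
          unfolding sum_distrib_right by (simp add: ac_simps)
        then show ?thesis by (simp add: abs_mult sum_nonneg)
      qed
      finally show "AE v in N. norm (norm (V (v - c)) ^ k * p v) \<le>
          norm (\<Sum>j\<le>k. of_nat (k choose j) * norm (V c) ^ (k - j) * (norm (V v) ^ j * p v))"
        by simp
    qed (simp add: N_def)
    then show ?thesis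
      using shift(1)[of "\<lambda>v. norm (V (v - c)) ^ k * p v" c] by simp
  qed
  have bound: "integrable N (\<lambda>v. \<phi> v * p (v + c))"
    if p: "p \<in> Rv ?C" and k: "k \<le> 3" and b: "\<And>v. \<bar>\<phi> v\<bar> \<le> norm (V v) ^ k" for p \<phi> k c
    by (rule Bochner_Integration.integrable_bound[OF mom[OF p k, of c]])
      (use b in \<open>auto simp: N_def abs_mult intro!: mult_right_mono\<close>)
  have ibp: "(\<integral>v. \<phi> v * Dv ?C l p v \<partial>N)
      = (\<integral>v. (\<phi> (v - axis l 1) - \<phi> (v + axis l 1)) / (2 * hv) * p v \<partial>N)"
    if p: "p \<in> Rv ?C" and k: "k \<le> 3" and b: "\<And>v. \<bar>\<phi> v\<bar> \<le> norm (V v) ^ k" for p \<phi> k l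
  proof -
    note i = bound[OF p k b]
    have i': "integrable N (\<lambda>v. \<phi> (v - axis l 1) * p v)" "integrable N (\<lambda>v. \<phi> (v + axis l 1) * p v)"
      using shift(1)[of "\<lambda>v. \<phi> v * p (v + axis l 1)" "- axis l 1"] i[of "axis l 1"]
        shift(1)[of "\<lambda>v. \<phi> v * p (v + - axis l 1)" "axis l 1"] i[of "- axis l 1"] by simp_all
    have "(\<integral>v. \<phi> v * Dv ?C l p v \<partial>N) =
        (\<integral>v. 1 / (2 * hv) * (\<phi> v * p (v + axis l 1) - \<phi> v * p (v + - axis l 1)) \<partial>N)"
      by (intro Bochner_Integration.integral_cong) (simp_all add: field_simps)
    also have "\<dots> = 1 / (2 * hv) * ((\<integral>v. \<phi> v * p (v + axis l 1) \<partial>N) - (\<integral>v. \<phi> v * p (v + - axis l 1) \<partial>N))"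
      unfolding integral_mult_right_zero by (subst Bochner_Integration.integral_diff) (use i[of "axis l 1"] i[of "- axis l 1"] in auto)
    also have "\<dots> = 1 / (2 * hv) * ((\<integral>v. \<phi> (v - axis l 1) * p v \<partial>N) - (\<integral>v. \<phi> (v + axis l 1) * p v \<partial>N))"
      using shift(2)[of "\<lambda>v. \<phi> v * p (v + axis l 1)" "- axis l 1"]
        shift(2)[of "\<lambda>v. \<phi> v * p (v + - axis l 1)" "axis l 1"] by simp
    also have "\<dots> = (\<integral>v. 1 / (2 * hv) * (\<phi> (v - axis l 1) * p v - \<phi> (v + axis l 1) * p v) \<partial>N)"
      unfolding integral_mult_right_zero by (subst Bochner_Integration.integral_diff) (auto intro: i')
    also have "\<dots> = (\<integral>v. (\<phi> (v - axis l 1) - \<phi> (v + axis l 1)) / (2 * hv) * p v \<partial>N)"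
      by (intro Bochner_Integration.integral_cong) (simp_all add: field_simps)
    finally show ?thesis .
  qed
  show ?thesis
  proof (rule vp_calculus.intro)
    show "finite_measure (Mx ?C)"
    proof (rule finite_measureI)
      have "integrable (Mx ?C) (\<lambda>_. 1::real)" by simp
      then show "emeasure (Mx ?C) (space (Mx ?C)) \<noteq> \<infinity>"
        unfolding integrable_iff_bounded by simp
    qed
    show "sigma_finite_measure (Mv ?C)"
      unfolding Mv
    proof (rule sigma_finite_measure.sigma_finite_iff_density_finite[THEN iffD2])
      show "sigma_finite_measure N"
        unfolding N_def by (rule sigma_finite_measure_count_space_countable) simp
    qed (auto simp: N_def)
    show "space (Mx ?C) = UNIV" "space (Mv ?C) = UNIV" "vel ?C \<in> borel_measurable (Mv ?C)"
      by (simp_all add: Mx Mv N_def)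
    show "funs.subspace (Rx ?C)" by (rule funs_subspaceI) auto
    have "(\<lambda>_. 0) \<in> Rv ?C" by (simp add: Rv)
    then show "funs.subspace (Rv ?C)"
      by (intro funs_subspaceI) (auto simp: Rv distrib_left mult.left_commute[of "norm _ ^ _"])
    show "g \<in> borel_measurable (Mx ?C)" "bounded (range g)" for g :: "'g^'d \<Rightarrow> real"
      by (simp_all add: Mx finite_imp_bounded)
    show "(\<integral>x. Dx ?C l g x \<partial>Mx ?C) = 0" for g l
    proof -
      have "(\<Sum>x\<in>UNIV. g (x + axis l 1)) = (\<Sum>x\<in>UNIV. g x)" "(\<Sum>x\<in>UNIV. g (x - axis l 1)) = (\<Sum>x\<in>UNIV. g x)"
        using sum.reindex_bij_betw[OF bij_add, of g "axis l 1"] sum.reindex_bij_betw[OF bij_add, of g "- axis l 1"]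
        by simp_all
      then show ?thesis by (simp add: sum_divide_distrib[symmetric] sum_subtractf)
    qed
    show "integrable (Mv ?C) (\<lambda>v. norm (vel ?C v) ^ k * p v)" if "p \<in> Rv ?C" "k \<le> 3" for p k
      using that by (simp add: Rv)
    show "integrable (Mv ?C) (\<lambda>v. norm (vel ?C v) ^ k * Dv ?C l p v)" if "p \<in> Rv ?C" "k \<le> 2" for p k l
      using mom[OF that(1), of k "axis l 1"] mom[OF that(1), of k "- axis l 1"] that(2)
      by (simp add: right_diff_distrib diff_divide_distrib)
    show "(\<integral>v. Dv ?C l p v \<partial>Mv ?C) = 0" if "p \<in> Rv ?C" for p l
      using ibp[OF that, of 0 "\<lambda>_. 1" l] by simp
    show "(\<integral>v. vel ?C v $ i * Dv ?C l p v \<partial>Mv ?C) = - (if i = l then 1 else 0) * (\<integral>v. p v \<partial>Mv ?C)"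
      if "p \<in> Rv ?C" for p i l
    proof -
      have *: "(V (v - axis l 1) $ i - V (v + axis l 1) $ i) / (2 * hv) = - (if i = l then 1 else 0)" for v
        using hv unfolding Vadd Vdiff Vax by (simp add: axis_def)
      have "(\<integral>v. V v $ i * Dv ?C l p v \<partial>N) = - (if i = l then 1 else 0) * (\<integral>v. p v \<partial>N)"
        using ibp[OF that, of 1 "\<lambda>v. V v $ i" l] unfolding * by (simp add: component_le_norm_cart)
      then show ?thesis
        by (simp only: velC Mv_int mult.left_commute[of "hv ^ CARD('d)"])
    qed
    show "(\<integral>v. (norm (vel ?C v))\<^sup>2 * Dv ?C l p v \<partial>Mv ?C) = - 2 * (\<integral>v. vel ?C v $ l * p v \<partial>Mv ?C)"
      if "p \<in> Rv ?C" for p l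
    proof -
      have *: "((norm (V (v - axis l 1)))\<^sup>2 - (norm (V (v + axis l 1)))\<^sup>2) / (2 * hv) = - 2 * V v $ l" for v
        using hv unfolding power2_norm_eq_inner Vadd Vdiff Vax
        by (simp add: inner_add_left inner_add_right inner_diff_left inner_diff_right inner_axis inner_axis' field_simps)
      have "(\<integral>v. (norm (V v))\<^sup>2 * Dv ?C l p v \<partial>N) = (\<integral>v. - 2 * V v $ l * p v \<partial>N)"
        unfolding *[symmetric] by (rule ibp[OF that, of 2]) simp_all
      also have "\<dots> = - 2 * (\<integral>v. V v $ l * p v \<partial>N)"
        by (simp only: mult.assoc integral_mult_right_zero)
      finally show ?thesis
        by (simp only: velC Mv_int mult.left_commute[of "hv ^ CARD('d)"])
    qed
  qed (simp_all add: fun_eq_iff algebra_simps add_divide_distrib diff_divide_distrib)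
qed

end

theory Submission
  imports Defs
begin

text \<open>
  The density is a finite sum of products, so Fubini's theorem applies in the S-step: the
  column of \<open>U\<^sub>a\<close> after the S-step is the spatial projection of its K-step value.  The K-step functions were put into the augmented basis, so this
  projection is the identity, and truncation keeps the column; hence the column of \<open>U\<^sub>a\<close> is updated exactly
  by the moment of the full increment against \<open>U\<^sub>a\<close>.  Since \<open>|v|\<^sup>2\<close> is a combination of \<open>U\<^sub>1\<close> and
  \<open>U\<^bsub>d+2\<^esub>\<close>, the kinetic energy changes by half the second velocity moment of the increment.

  For that moment both integrators have the form \<open>- b \<cdot> \<nabla>\<^sub>v f + 1/2 \<nabla>\<^sub>v \<cdot> (B \<nabla>\<^sub>v f)\<close> with the
  random shift \<open>b = \<Sum>\<^sub>s \<Delta>\<beta>\<^sub>s \<sigma>\<^sub>s\<close> and \<open>B = \<tau> \<sigma> \<sigma>\<^sup>T\<close> (EM) or \<open>B = b b\<^sup>T\<close> (Heun), and in both cases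
  \<open>\<Theta> = 1/2 Tr(B) \<rho>\<close>.
\<close>

section \<open>Linear combinations of functions and products of square-integrable functions\<close>

text \<open>The operators \<open>Dx\<close> and \<open>Dv\<close> are linear only on regular
  functions, so each partial sum must be known to stay in \<open>S\<close> before linearity applies
  to the next one. The two conclusions therefore go through one induction.\<close>

lemma subspace_sum_linear:
  fixes D :: "('a \<Rightarrow> real) \<Rightarrow> 'b \<Rightarrow> real"
  assumes S: "funs.subspace S"
    and lin: "\<And>g h a b. g \<in> S \<Longrightarrow> h \<in> S \<Longrightarrow>
      D (\<lambda>x. a * g x + b * h x) = (\<lambda>x. a * D g x + b * D h x)"
    and I: "finite I" "\<And>i. i \<in> I \<Longrightarrow> g i \<in> S"
  shows "(\<lambda>x. \<Sum>i\<in>I. a i * g i x) \<in> S"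
    and "D (\<lambda>x. \<Sum>i\<in>I. a i * g i x) = (\<lambda>x. \<Sum>i\<in>I. a i * D (g i) x)"
proof -
  have "(\<lambda>x. \<Sum>i\<in>I. a i * g i x) \<in> S \<and>
      D (\<lambda>x. \<Sum>i\<in>I. a i * g i x) = (\<lambda>x. \<Sum>i\<in>I. a i * D (g i) x)"
    using I
  proof (induction I rule: finite_induct)
    case empty
    \<comment> \<open>Linearity with both coefficients zero yields the value of \<open>D\<close> at
      the zero function.\<close>
    have 0: "(\<lambda>_. 0) \<in> S" using funs.subspace_0[OF S] by (simp add: zero_fun_def)
    show ?case using 0 lin[OF 0 0, of 0 0] by simp
  next
    case (insert i I)
    let ?h = "\<lambda>x. \<Sum>i\<in>I. a i * g i x"
    have h: "?h \<in> S" "D ?h = (\<lambda>x. \<Sum>i\<in>I. a i * D (g i) x)" using insert by auto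
    have g: "g i \<in> S" using insert by auto
    have "(\<lambda>x. a i * g i x) + ?h \<in> S"
      by (intro funs.subspace_add[OF S] funs.subspace_scale[OF S] g h)
    then show ?case
      using insert.hyps lin[OF g h(1), of "a i" 1] h(2) by (simp add: plus_fun_def)
  qed
  then show "(\<lambda>x. \<Sum>i\<in>I. a i * g i x) \<in> S"
    "D (\<lambda>x. \<Sum>i\<in>I. a i * g i x) = (\<lambda>x. \<Sum>i\<in>I. a i * D (g i) x)" by auto
qed

lemma span_sum_scaled:
  assumes "\<And>i. i \<in> I \<Longrightarrow> g i \<in> funs.span B"
  shows "(\<lambda>x. \<Sum>i\<in>I. a i * g i x) \<in> funs.span B"
proof -
  have "(\<Sum>i\<in>I. (\<lambda>x. a i * g i x)) \<in> funs.span B"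
    by (intro funs.span_sum funs.span_scale assms)
  moreover have "(\<Sum>i\<in>I. (\<lambda>x. a i * g i x)) = (\<lambda>x. \<Sum>i\<in>I. a i * g i x)"
    by (induction I rule: infinite_finite_induct) (auto simp: plus_fun_def zero_fun_def)
  ultimately show ?thesis by simp
qed

text \<open>Domination by |gh| \<le> g^2 + h^2. The weight is \<open>wt P\<close> for velocity
  functions, and 1 for spatial functions and for Brownian increments.\<close>

lemma integrable_mult_of_squares:
  fixes g h w :: "'a \<Rightarrow> real"
  assumes [measurable]: "w \<in> borel_measurable M" "g \<in> borel_measurable M" "h \<in> borel_measurable M"
    and w: "\<And>x. 0 \<le> w x"
    and int: "integrable M (\<lambda>x. w x * (g x)\<^sup>2)" "integrable M (\<lambda>x. w x * (h x)\<^sup>2)"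
  shows "integrable M (\<lambda>x. w x * g x * h x)"
proof (rule Bochner_Integration.integrable_bound[OF Bochner_Integration.integrable_add[OF int]])
  have "\<bar>g x * h x\<bar> \<le> (g x)\<^sup>2 + (h x)\<^sup>2" for x
    using sum_squares_bound[of "\<bar>g x\<bar>" "\<bar>h x\<bar>"] abs_ge_zero[of "g x * h x"]
    unfolding abs_mult power2_abs by linarith
  then have "w x * \<bar>g x * h x\<bar> \<le> w x * ((g x)\<^sup>2 + (h x)\<^sup>2)" for x
    using w by (intro mult_left_mono) auto
  then show "AE x in M. norm (w x * g x * h x) \<le> norm (w x * (g x)\<^sup>2 + w x * (h x)\<^sup>2)"
    using w by (simp add: abs_mult distrib_left mult.assoc)
qed simp

section \<open>Moments and separated densities\<close>

text \<open>Bounds hold everywhere, not almost everywhere. The closure rules below make this an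
  algebra; it contains \<open>Rx\<close>, the components of Poisson fields and the entries of
  \<open>sig\<close>, hence every spatial coefficient that multiplies a velocity derivative in an
  increment.\<close>

definition Linf_x :: "('x, 'v, 'd::finite) calculus \<Rightarrow> ('x \<Rightarrow> real) set" where
  "Linf_x C = {g. g \<in> borel_measurable (Mx C) \<and> bounded (range g)}"

lemma Linf_x_mult:
  assumes "g \<in> Linf_x C" "h \<in> Linf_x C"
  shows "(\<lambda>x. g x * h x) \<in> Linf_x C"
proof -
  obtain a b where ab: "\<And>x. \<bar>g x\<bar> \<le> a" "\<And>x. \<bar>h x\<bar> \<le> b"
    using assms by (auto simp: Linf_x_def bounded_iff)
  have "0 \<le> a" using ab(1) abs_ge_zero order_trans by blast
  then have "\<bar>g x * h x\<bar> \<le> a * b" for x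
    unfolding abs_mult by (intro mult_mono ab) auto
  then show ?thesis using assms by (auto simp: Linf_x_def bounded_iff)
qed

lemma Linf_x_const: "(\<lambda>_. a) \<in> Linf_x C"
  by (auto simp: Linf_x_def bounded_iff)

lemma Linf_x_add:
  assumes "g \<in> Linf_x C" "h \<in> Linf_x C"
  shows "(\<lambda>x. g x + h x) \<in> Linf_x C"
  using assms bounded_plus_comp[of g UNIV h] by (auto simp: Linf_x_def)

lemma Linf_x_sum: "(\<And>i. i \<in> I \<Longrightarrow> g i \<in> Linf_x C) \<Longrightarrow> (\<lambda>x. \<Sum>i\<in>I. g i x) \<in> Linf_x C"
proof (induction I rule: infinite_finite_induct)
  case (insert i I)
  then show ?case using Linf_x_add[of "g i" C "\<lambda>x. \<Sum>i\<in>I. g i x"] by auto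
qed (auto intro: Linf_x_const)

context vp_calculus
begin

text \<open>The spatial measure is finite, so the bounded function g^2 is integrable.\<close>

lemma Linf_x_L2x:
  assumes g: "g \<in> Linf_x C"
  shows "g \<in> L2x C"
proof -
  have m: "g \<in> borel_measurable (Mx C)" using g by (simp add: Linf_x_def)
  have "(\<lambda>x. g x * g x) \<in> Linf_x C" by (intro Linf_x_mult g)
  then obtain B where B: "\<And>x. \<bar>g x * g x\<bar> \<le> B" by (auto simp: Linf_x_def bounded_iff)
  have "integrable (Mx C) (\<lambda>x. g x * g x)"
  proof (rule finite_measure.integrable_const_bound[OF finite_Mx])
    show "AE x in Mx C. norm (g x * g x) \<le> B"
      using B by (intro AE_I2) (simp only: real_norm_def)
    show "(\<lambda>x. g x * g x) \<in> borel_measurable (Mx C)"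
      using m by (intro borel_measurable_times)
  qed
  with m show ?thesis unfolding L2x_def power2_eq_square by blast
qed

lemma L2x_integrable_mult:
  assumes "g \<in> L2x C" "h \<in> L2x C"
  shows "integrable (Mx C) (\<lambda>x. g x * h x)"
proof -
  have "integrable (Mx C) (\<lambda>x. 1 * g x * h x)"
    by (rule integrable_mult_of_squares) (use assms in \<open>simp_all add: L2x_def\<close>)
  then show ?thesis by simp
qed

text \<open>Serves the spatial derivatives of the old basis: the calculus only makes them
  integrable, but augmentation places them in the span of an orthonormal, hence square-integrable,
  family.\<close>

lemma L2x_span:
  assumes "\<And>g. g \<in> B \<Longrightarrow> g \<in> L2x C" "h \<in> funs.span B"
  shows "h \<in> L2x C"
proof -
  have "funs.subspace (L2x C)"
  proof (rule funs.subspaceI)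
    show "0 \<in> L2x C" by (simp add: L2x_def zero_fun_def)
    show "(\<lambda>x. c * g x) \<in> L2x C" if "g \<in> L2x C" for c g
      using that by (auto simp: L2x_def power_mult_distrib)
    show "g + h \<in> L2x C" if "g \<in> L2x C" "h \<in> L2x C" for g h
    proof -
      have "integrable (Mx C) (\<lambda>x. (g x)\<^sup>2 + 2 * (g x * h x) + (h x)\<^sup>2)"
        using that L2x_integrable_mult[OF that] by (auto simp: L2x_def)
      then show ?thesis using that by (auto simp: L2x_def plus_fun_def power2_sum algebra_simps)
    qed
  qed
  with assms(1) have "funs.span B \<subseteq> L2x C" by (intro funs.span_minimal) auto
  with assms(2) show ?thesis by auto
qed

lemma Rx_Linf_x: "g \<in> Rx C \<Longrightarrow> g \<in> Linf_x C"
  by (simp add: Linf_x_def Rx_measurable Rx_bounded)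

section \<open>Velocity moments of regular functions\<close>

lemma vel_component_measurable: "(\<lambda>v. vel C v $ l) \<in> borel_measurable (Mv C)"
  using measurable_compose[OF vel_measurable borel_measurable_nth] by simp

text \<open>The moments of \<open>q\<close> of orders 0 and \<open>k\<close> dominate. The constants
  \<open>a\<close> and \<open>b\<close> may be negative, hence the absolute values in the dominating
  function. With \<open>k\<close> = 2 this pairs the constant and the quadratic mode with the
  increments.\<close>

lemma integrable_growth:
  assumes "\<phi> \<in> borel_measurable (Mv C)" "\<And>v. \<bar>\<phi> v\<bar> \<le> a + b * norm (vel C v) ^ k"
    and q: "integrable (Mv C) q" "integrable (Mv C) (\<lambda>v. norm (vel C v) ^ k * q v)"
  shows "integrable (Mv C) (\<lambda>v. \<phi> v * q v)"
proof (rule Bochner_Integration.integrable_bound)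
  show "integrable (Mv C) (\<lambda>v. \<bar>a * q v\<bar> + \<bar>b * (norm (vel C v) ^ k * q v)\<bar>)"
    by (intro Bochner_Integration.integrable_add integrable_abs integrable_mult_right q)
  show "(\<lambda>v. \<phi> v * q v) \<in> borel_measurable (Mv C)"
    using assms by (intro borel_measurable_times) auto
  have "\<bar>\<phi> v * q v\<bar> \<le> \<bar>a * q v\<bar> + \<bar>b * (norm (vel C v) ^ k * q v)\<bar>" for v
  proof -
    have "\<bar>\<phi> v * q v\<bar> \<le> (\<bar>a\<bar> + \<bar>b\<bar> * norm (vel C v) ^ k) * \<bar>q v\<bar>"
      unfolding abs_mult
    proof (intro mult_right_mono)
      have "b * norm (vel C v) ^ k \<le> \<bar>b\<bar> * norm (vel C v) ^ k" by (intro mult_right_mono) auto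
      then show "\<bar>\<phi> v\<bar> \<le> \<bar>a\<bar> + \<bar>b\<bar> * norm (vel C v) ^ k" using assms(2)[of v] by linarith
    qed simp
    then show ?thesis by (simp add: abs_mult distrib_right mult.assoc)
  qed
  then show "AE v in Mv C. norm (\<phi> v * q v) \<le> norm (\<bar>a * q v\<bar> + \<bar>b * (norm (vel C v) ^ k * q v)\<bar>)"
    by simp
qed

lemma Rv_integrable: "p \<in> Rv C \<Longrightarrow> integrable (Mv C) p"
  and Dv_integrable: "p \<in> Rv C \<Longrightarrow> integrable (Mv C) (Dv C l p)"
  using Rv_moments[of p 0] Dv_moments[of p 0 l] by simp_all

text \<open>A velocity component costs one further power of |v|. The case \<open>k\<close> = 2 is
  the energy flux and uses the third moments granted by \<open>Rv_moments\<close>.\<close>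

lemma Rv_norm_vel_integrable:
  assumes p: "p \<in> Rv C" and k: "k \<le> 2"
  shows "integrable (Mv C) (\<lambda>v. norm (vel C v) ^ k * (vel C v $ l * p v))"
proof -
  have m[measurable]: "(\<lambda>v. norm (vel C v)) \<in> borel_measurable (Mv C)"
    using vel_measurable by measurable
  note [measurable] = vel_component_measurable
  have "integrable (Mv C) (\<lambda>v. (norm (vel C v) ^ k * vel C v $ l) * p v)"
    by (rule integrable_growth[where a=0 and b=1 and k="Suc k"])
      (use p k Rv_moments[of p "Suc k"] component_le_norm_cart[of "vel C _" l]
        in \<open>auto simp: Rv_integrable abs_mult mult.commute intro!: mult_right_mono\<close>)
  then show ?thesis by (simp add: mult.assoc)
qed

lemma Rv_vel_integrable: "p \<in> Rv C \<Longrightarrow> integrable (Mv C) (\<lambda>v. vel C v $ l * p v)"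
  using Rv_norm_vel_integrable[of p 0 l] by simp

lemma Dv_sum:
  assumes "finite I" "\<And>j. j \<in> I \<Longrightarrow> p j \<in> Rv C"
  shows "(\<lambda>v. \<Sum>j\<in>I. a j * p j v) \<in> Rv C"
    and "Dv C l (\<lambda>v. \<Sum>j\<in>I. a j * p j v) = (\<lambda>v. \<Sum>j\<in>I. a j * Dv C l (p j) v)"
  by (rule subspace_sum_linear[where D="Dv C l", OF subspace_Rv]; simp add: Dv_linear assms)+

lemma Dx_sum:
  assumes "finite I" "\<And>j. j \<in> I \<Longrightarrow> g j \<in> Rx C"
  shows "(\<lambda>x. \<Sum>j\<in>I. a j * g j x) \<in> Rx C"
    and "Dx C l (\<lambda>x. \<Sum>j\<in>I. a j * g j x) = (\<lambda>x. \<Sum>j\<in>I. a j * Dx C l (g j) x)"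
  by (rule subspace_sum_linear[where D="Dx C l", OF subspace_Rx]; simp add: Dx_linear assms)+

end

text \<open>Fubini for a test function that is itself a product: the phase-space product of the
  S-step becomes the spatial product with the velocity moment occurring in the K-step. The second
  conclusion later permits integrals of sums to be split.\<close>

lemma (in vp_calculus) prxv_product:
  assumes int: "integrable (Mx C \<Otimes>\<^sub>M Mv C) (\<lambda>(x, v). \<psi> x * \<phi> v * g x v)"
  shows "prxv C (\<lambda>x v. \<psi> x * \<phi> v) g = ipx C \<psi> (\<lambda>x. prv C \<phi> (g x))"
    and "integrable (Mx C) (\<lambda>x. \<psi> x * prv C \<phi> (g x))"
proof -
  interpret X: finite_measure "Mx C" by (rule finite_Mx)
  interpret V: sigma_finite_measure "Mv C" by (rule sigma_finite_Mv)
  interpret XV: pair_sigma_finite "Mx C" "Mv C" ..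
  have eq: "(\<integral>v. \<psi> x * \<phi> v * g x v \<partial>Mv C) = \<psi> x * prv C \<phi> (g x)" for x
    by (simp add: prv_def mult.assoc)
  show "prxv C (\<lambda>x v. \<psi> x * \<phi> v) g = ipx C \<psi> (\<lambda>x. prv C \<phi> (g x))"
    using XV.integral_fst'[OF int] by (simp add: eq ipx_def prxv_def)
  show "integrable (Mx C) (\<lambda>x. \<psi> x * prv C \<phi> (g x))"
    using XV.integrable_fst'[OF int] by (simp add: eq)
qed

lemma (in vp_calculus) integrable_product:
  fixes a :: "'x \<Rightarrow> real" and b :: "'v \<Rightarrow> real"
  assumes "integrable (Mx C) a" "integrable (Mv C) b"
  shows "integrable (Mx C \<Otimes>\<^sub>M Mv C) (\<lambda>(x, v). a x * b v)"
proof -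
  interpret X: finite_measure "Mx C" by (rule finite_Mx)
  interpret V: sigma_finite_measure "Mv C" by (rule sigma_finite_Mv)
  interpret XV: pair_sigma_finite "Mx C" "Mv C" ..
  note [measurable] = borel_measurable_integrable[OF assms(1)] borel_measurable_integrable[OF assms(2)]
  show ?thesis
  proof (rule XV.Fubini_integrable)
    have "integrable (Mx C) (\<lambda>x. \<bar>a x\<bar> * (\<integral>v. \<bar>b v\<bar> \<partial>Mv C))"
      by (intro integrable_mult_left integrable_abs assms)
    then show "integrable (Mx C) (\<lambda>x. \<integral>v. norm (case (x, v) of (x, v) \<Rightarrow> a x * b v) \<partial>Mv C)"
      by (simp add: abs_mult)
    show "AE x in Mx C. integrable (Mv C) (\<lambda>v. case (x, v) of (x, v) \<Rightarrow> a x * b v)"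
      using assms(2) by simp
  qed measurable
qed

section \<open>The stochastic increments as drift plus diffusion in velocity\<close>

definition kick :: "('x, 'v, 'd::finite, 'k::finite) vp_data \<Rightarrow> ('k \<Rightarrow> real) \<Rightarrow> 'x \<Rightarrow> real^'d" where
  "kick P \<Delta>\<beta> x = (\<Sum>s\<in>UNIV. \<Delta>\<beta> s *\<^sub>R column s (sig P x))"

definition diffusion :: "integrator \<Rightarrow> ('x, 'v, 'd::finite, 'k::finite) vp_data \<Rightarrow>
    ('k \<Rightarrow> real) \<Rightarrow> 'x \<Rightarrow> real^'d^'d" where
  "diffusion \<theta> P \<Delta>\<beta> x = (case \<theta> of
     EM \<Rightarrow> tau P *\<^sub>R sig_sq P x
   | Heun \<Rightarrow> (\<chi> i j. kick P \<Delta>\<beta> x $ i * kick P \<Delta>\<beta> x $ j))"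

lemma kick_nth: "kick P \<Delta>\<beta> x $ l = (\<Sum>s\<in>UNIV. \<Delta>\<beta> s * sig P x $ l $ s)"
  by (simp add: kick_def column_def)

lemma sum_column_inner: "(\<Sum>s\<in>UNIV. \<Delta>\<beta> s * (column s (sig P x) \<bullet> w)) = kick P \<Delta>\<beta> x \<bullet> w"
  by (simp add: kick_def inner_sum_left)

text \<open>For Heun the double sum over the noises is the squared length of \<open>kick\<close>,
  which is the trace of the rank-one matrix formed from it.\<close>

lemma Theta_eq: "Theta \<theta> P \<Delta>\<beta> \<rho> x = 1 / 2 * trace (diffusion \<theta> P \<Delta>\<beta> x) * \<rho> x"
proof (cases \<theta>)
  case EM
  then show ?thesis
    by (simp add: Theta_def diffusion_def trace_def sum_distrib_left)
next
  case Heun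
  have "(\<Sum>s\<in>UNIV. \<Sum>r\<in>UNIV. \<Delta>\<beta> s * \<Delta>\<beta> r * (column s (sig P x) \<bullet> column r (sig P x)))
      = (\<Sum>s\<in>UNIV. \<Delta>\<beta> s * (column s (sig P x) \<bullet> kick P \<Delta>\<beta> x))"
    by (simp add: kick_def inner_sum_right sum_distrib_left ac_simps)
  also have "\<dots> = kick P \<Delta>\<beta> x \<bullet> kick P \<Delta>\<beta> x"
    by (rule sum_column_inner)
  also have "\<dots> = trace (diffusion \<theta> P \<Delta>\<beta> x)"
    using Heun by (simp add: diffusion_def trace_def inner_vec_def)
  finally show ?thesis using Heun by (simp add: Theta_def)
qed

lemma noise_sum_eq:
  "(\<Sum>s\<in>UNIV. noise_term C P s f x v * \<Delta>\<beta> s) = (\<Sum>l\<in>UNIV. kick P \<Delta>\<beta> x $ l * Dv C l (f x) v)"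
  unfolding noise_term_def kick_nth sum_distrib_right
  by (subst sum.swap) (simp add: column_def ac_simps)

context vp_calculus
begin

text \<open>For Heun the predictor is f - b \<cdot> \<nabla>f, so the average of the two slopes is
  -b \<cdot> \<nabla>f plus half of b \<cdot> \<nabla>(b \<cdot> \<nabla>f). In both cases the
  coefficients do not depend on v and pass through the velocity derivatives. Only the slice of f at
  x enters.\<close>

lemma S_inc_eq:
  assumes f: "f x \<in> Rv C" and Df: "\<And>l. Dv C l (f x) \<in> Rv C"
  shows "S_inc \<theta> C P \<Delta>\<beta> f x v = - (\<Sum>l\<in>UNIV. kick P \<Delta>\<beta> x $ l * Dv C l (f x) v)
    + 1 / 2 * (\<Sum>i\<in>UNIV. \<Sum>j\<in>UNIV. diffusion \<theta> P \<Delta>\<beta> x $ i $ j * Dv C i (Dv C j (f x)) v)"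
proof (cases \<theta>)
  case EM
  have "Dv C i (\<lambda>w. \<Sum>j\<in>UNIV. sig_sq P x $ i $ j * Dv C j (f x) w)
      = (\<lambda>w. \<Sum>j\<in>UNIV. sig_sq P x $ i $ j * Dv C i (Dv C j (f x)) w)" for i
    by (rule Dv_sum(2)) (use Df in auto)
  then show ?thesis
    using EM by (simp add: S_inc_def S_EM_def noise_sum_eq diffusion_def sum_distrib_left mult.assoc)
next
  case Heun
  define b where "b = kick P \<Delta>\<beta> x"
  define ft where "ft = (\<lambda>y w. f y w - (\<Sum>s\<in>UNIV. noise_term C P s f y w * \<Delta>\<beta> s))"
  let ?g = "\<lambda>w. \<Sum>l\<in>UNIV. b $ l * Dv C l (f x) w"
  have g: "?g \<in> Rv C" "Dv C k ?g = (\<lambda>w. \<Sum>l\<in>UNIV. b $ l * Dv C k (Dv C l (f x)) w)" for k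
    by (rule Dv_sum, simp, rule Df)+
  have "ft x = (\<lambda>w. 1 * f x w + (- 1) * ?g w)"
    by (simp add: ft_def noise_sum_eq b_def fun_eq_iff)
  then have D: "Dv C k (ft x) v = Dv C k (f x) v - (\<Sum>l\<in>UNIV. b $ l * Dv C k (Dv C l (f x)) v)" for k
    using Dv_linear[OF f g(1), of k 1 "- 1"] by (simp add: g(2))
  have "S_inc \<theta> C P \<Delta>\<beta> f x v = - (1 / 2) * (\<Sum>s\<in>UNIV. (noise_term C P s f x v + noise_term C P s ft x v) * \<Delta>\<beta> s)"
    using Heun by (simp add: S_inc_def S_Heun_def ft_def)
  also have "\<dots> = - (1 / 2) * ((\<Sum>l\<in>UNIV. b $ l * Dv C l (f x) v) + (\<Sum>l\<in>UNIV. b $ l * Dv C l (ft x) v))"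
    unfolding distrib_right sum.distrib noise_sum_eq b_def ..
  also have "(\<Sum>l\<in>UNIV. b $ l * Dv C l (ft x) v) = (\<Sum>l\<in>UNIV. b $ l * Dv C l (f x) v)
      - (\<Sum>i\<in>UNIV. \<Sum>j\<in>UNIV. diffusion \<theta> P \<Delta>\<beta> x $ i $ j * Dv C i (Dv C j (f x)) v)"
    using Heun by (simp add: D right_diff_distrib sum_subtractf diffusion_def b_def sum_distrib_left mult.assoc)
  finally show ?thesis unfolding b_def by (simp add: diff_divide_distrib)
qed

text \<open>One integration by parts turns |v|^2 into 2 v, a second one turns v into a Kronecker
  delta. Mixed second derivatives thus contribute nothing and only the trace of the diffusion matrix
  survives. The form \<open>has_bochner_integral\<close> carries integrability along with the
  value.\<close>

lemma second_moment_S_inc: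
  assumes f: "f x \<in> Rv C" and Df: "\<And>l. Dv C l (f x) \<in> Rv C"
  shows "has_bochner_integral (Mv C) (\<lambda>v. (norm (vel C v))\<^sup>2 * S_inc \<theta> C P \<Delta>\<beta> f x v)
    (2 * (kick P \<Delta>\<beta> x \<bullet> Jmom C f x) + trace (diffusion \<theta> P \<Delta>\<beta> x) * rho C f x)"
proof -
  let ?b = "kick P \<Delta>\<beta> x" and ?B = "diffusion \<theta> P \<Delta>\<beta> x"
  have D1: "has_bochner_integral (Mv C) (\<lambda>v. (norm (vel C v))\<^sup>2 * Dv C l (f x) v) (- 2 * Jmom C f x $ l)" for l
    using has_bochner_integral_integrable[OF Dv_moments[OF f, of 2 l]] Dv_square[OF f, of l]
    by (simp add: Jmom_def)
  have D2: "has_bochner_integral (Mv C) (\<lambda>v. (norm (vel C v))\<^sup>2 * Dv C i (Dv C j (f x)) v)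
      (2 * (if i = j then rho C f x else 0))" for i j
    using has_bochner_integral_integrable[OF Dv_moments[OF Df[of j], of 2 i]] Dv_square[OF Df[of j], of i]
      Dv_coord[OF f, of i j] by (simp add: rho_def split: if_splits)
  have "has_bochner_integral (Mv C)
     (\<lambda>v. (\<Sum>l\<in>UNIV. (- ?b $ l) * ((norm (vel C v))\<^sup>2 * Dv C l (f x) v))
       + (\<Sum>i\<in>UNIV. \<Sum>j\<in>UNIV. (1 / 2 * ?B $ i $ j) * ((norm (vel C v))\<^sup>2 * Dv C i (Dv C j (f x)) v)))
     ((\<Sum>l\<in>UNIV. (- ?b $ l) * (- 2 * Jmom C f x $ l))
       + (\<Sum>i\<in>UNIV. \<Sum>j\<in>UNIV. (1 / 2 * ?B $ i $ j) * (2 * (if i = j then rho C f x else 0))))"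
    by (intro has_bochner_integral_add has_bochner_integral_sum has_bochner_integral_mult_right D1 D2)
  also have "(\<lambda>v. (\<Sum>l\<in>UNIV. (- ?b $ l) * ((norm (vel C v))\<^sup>2 * Dv C l (f x) v))
       + (\<Sum>i\<in>UNIV. \<Sum>j\<in>UNIV. (1 / 2 * ?B $ i $ j) * ((norm (vel C v))\<^sup>2 * Dv C i (Dv C j (f x)) v)))
     = (\<lambda>v. (norm (vel C v))\<^sup>2 * S_inc \<theta> C P \<Delta>\<beta> f x v)"
    unfolding S_inc_eq[of f x, OF assms] by (rule ext) (simp add: algebra_simps sum_distrib_left sum_negf)
  also have "(\<Sum>l\<in>UNIV. (- ?b $ l) * (- 2 * Jmom C f x $ l))
       + (\<Sum>i\<in>UNIV. \<Sum>j\<in>UNIV. (1 / 2 * ?B $ i $ j) * (2 * (if i = j then rho C f x else 0)))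
     = 2 * (?b \<bullet> Jmom C f x) + trace ?B * rho C f x"
    by (simp add: inner_vec_def trace_def sum_distrib_left sum_distrib_right ac_simps if_distrib cong: if_cong)
  finally show ?thesis .
qed

end

section \<open>Densities that are finite sums of products\<close>

text \<open>For a low-rank state the index is that of the velocity basis: \<open>c j\<close> is the
  column \<open>K_old st j\<close> and \<open>p j\<close> the weighted basis function. This leaves
  one sum instead of two. Two velocity derivatives are provided for, as the second-order part of the
  noise requires.\<close>

locale separable_density = vp_calculus C for C :: "('x, 'v, 'd::finite) calculus" +
  fixes I :: "'i set" and c :: "'i \<Rightarrow> 'x \<Rightarrow> real" and p :: "'i \<Rightarrow> 'v \<Rightarrow> real"
    and f :: "'x \<Rightarrow> 'v \<Rightarrow> real"
  assumes finite_I: "finite I"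
    and c_Rx: "j \<in> I \<Longrightarrow> c j \<in> Rx C"
    and p_Rv: "j \<in> I \<Longrightarrow> p j \<in> Rv C"
    and Dp_Rv: "j \<in> I \<Longrightarrow> Dv C l (p j) \<in> Rv C"
    and f_eq: "f = (\<lambda>x v. \<Sum>j\<in>I. c j x * p j v)"
begin

lemma f_Rv: "f x \<in> Rv C"
  unfolding f_eq by (rule Dv_sum(1)) (auto simp: p_Rv finite_I)

lemma Dv_f: "Dv C l (f x) = (\<lambda>v. \<Sum>j\<in>I. c j x * Dv C l (p j) v)"
  unfolding f_eq by (rule Dv_sum(2)) (auto simp: p_Rv finite_I)

lemma Dv_f_Rv: "Dv C l (f x) \<in> Rv C"
  unfolding Dv_f by (rule Dv_sum(1)) (auto simp: Dp_Rv finite_I)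

lemma Dv_Dv_f: "Dv C i (Dv C l (f x)) = (\<lambda>v. \<Sum>j\<in>I. c j x * Dv C i (Dv C l (p j)) v)"
  unfolding Dv_f by (rule Dv_sum(2)) (auto simp: Dp_Rv finite_I)

lemma Dx_f: "Dx C l (\<lambda>y. f y v) x = (\<Sum>j\<in>I. Dx C l (c j) x * p j v)"
  using Dx_sum(2)[of I c l "\<lambda>j. p j v"] c_Rx finite_I by (simp add: f_eq mult.commute)

lemma transport_eq:
  "transport C \<E> f x v = - (\<Sum>l\<in>UNIV. \<Sum>j\<in>I. Dx C l (c j) x * (vel C v $ l * p j v))
    - (\<Sum>l\<in>UNIV. \<E> (rho C f) x $ l * Dv C l (f x) v)"
  by (simp add: transport_def Dx_f sum_distrib_left ac_simps)

text \<open>Each flux component is a linear combination of the \<open>c j\<close> whose constant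
  coefficients are third-order velocity moments. Linearity of \<open>Dx\<close> alone thus moves the
  spatial derivative past the velocity integral, for derivatives and for differences alike.\<close>

lemma div_Qflux:
  "div_x C (Qflux C f) x = (\<Sum>l\<in>UNIV. \<Sum>j\<in>I. Dx C l (c j) x *
     (1 / 2 * (\<integral>v. (norm (vel C v))\<^sup>2 * (vel C v $ l * p j v) \<partial>Mv C)))"
  unfolding div_x_def
proof (rule sum.cong)
  fix l
  let ?q = "\<lambda>j. 1 / 2 * (\<integral>v. (norm (vel C v))\<^sup>2 * (vel C v $ l * p j v) \<partial>Mv C)"
  have "Qflux C f y $ l = (\<Sum>j\<in>I. ?q j * c j y)" for y
  proof -
    have "(\<integral>v. (norm (vel C v))\<^sup>2 * vel C v $ l * f y v \<partial>Mv C)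
        = (\<integral>v. (\<Sum>j\<in>I. c j y * ((norm (vel C v))\<^sup>2 * (vel C v $ l * p j v))) \<partial>Mv C)"
      by (simp add: f_eq sum_distrib_left ac_simps)
    also have "\<dots> = (\<Sum>j\<in>I. c j y * (\<integral>v. (norm (vel C v))\<^sup>2 * (vel C v $ l * p j v) \<partial>Mv C))"
      by (subst Bochner_Integration.integral_sum) (use Rv_norm_vel_integrable[of _ 2 l] p_Rv in auto)
    finally show ?thesis by (simp add: Qflux_def sum_distrib_left ac_simps)
  qed
  then show "Dx C l (\<lambda>y. Qflux C f y $ l) x = (\<Sum>j\<in>I. Dx C l (c j) x * ?q j)"
    using Dx_sum(2)[of I c l ?q] c_Rx finite_I by (simp add: mult.commute)
qed simp

text \<open>Free transport produces third moments, the factor 2 undoing the one half in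
  \<open>Qflux\<close>. The field term gives 2 E \<cdot> J by one integration by parts.\<close>

lemma second_moment_transport:
  "has_bochner_integral (Mv C) (\<lambda>v. (norm (vel C v))\<^sup>2 * transport C \<E> f x v)
    (- 2 * div_x C (Qflux C f) x + 2 * (\<E> (rho C f) x \<bullet> Jmom C f x))"
proof -
  let ?E = "\<E> (rho C f) x"
  let ?m = "\<lambda>l j. \<integral>v. (norm (vel C v))\<^sup>2 * (vel C v $ l * p j v) \<partial>Mv C"
  have M: "has_bochner_integral (Mv C) (\<lambda>v. (norm (vel C v))\<^sup>2 * (vel C v $ l * p j v)) (?m l j)"
    if "j \<in> I" for l j
    using Rv_norm_vel_integrable[OF p_Rv[OF that], of 2 l] by (auto intro: has_bochner_integral_integrable)
  have D: "has_bochner_integral (Mv C) (\<lambda>v. (norm (vel C v))\<^sup>2 * Dv C l (f x) v) (- 2 * Jmom C f x $ l)" for l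
    using has_bochner_integral_integrable[OF Dv_moments[OF f_Rv, of 2 l]] Dv_square[OF f_Rv, of l]
    by (simp add: Jmom_def)
  have "has_bochner_integral (Mv C)
     (\<lambda>v. (\<Sum>l\<in>UNIV. \<Sum>j\<in>I. (- Dx C l (c j) x) * ((norm (vel C v))\<^sup>2 * (vel C v $ l * p j v)))
       + (\<Sum>l\<in>UNIV. (- ?E $ l) * ((norm (vel C v))\<^sup>2 * Dv C l (f x) v)))
     ((\<Sum>l\<in>UNIV. \<Sum>j\<in>I. (- Dx C l (c j) x) * ?m l j) + (\<Sum>l\<in>UNIV. (- ?E $ l) * (- 2 * Jmom C f x $ l)))"
    by (intro has_bochner_integral_add has_bochner_integral_sum has_bochner_integral_mult_right M D)
  also have "(\<lambda>v. (\<Sum>l\<in>UNIV. \<Sum>j\<in>I. (- Dx C l (c j) x) * ((norm (vel C v))\<^sup>2 * (vel C v $ l * p j v)))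
       + (\<Sum>l\<in>UNIV. (- ?E $ l) * ((norm (vel C v))\<^sup>2 * Dv C l (f x) v)))
     = (\<lambda>v. (norm (vel C v))\<^sup>2 * transport C \<E> f x v)"
    unfolding transport_eq by (rule ext) (simp add: algebra_simps sum_distrib_left sum_negf)
  also have "(\<Sum>l\<in>UNIV. \<Sum>j\<in>I. (- Dx C l (c j) x) * ?m l j) + (\<Sum>l\<in>UNIV. (- ?E $ l) * (- 2 * Jmom C f x $ l))
     = - 2 * div_x C (Qflux C f) x + 2 * (?E \<bullet> Jmom C f x)"
    by (simp add: div_Qflux inner_vec_def sum_distrib_left sum_negf ac_simps)
  finally show ?thesis .
qed

end

section \<open>Integrability over phase space\<close>

context vp_calculus
begin

lemma integrable_sum_product:
  fixes a :: "'i \<Rightarrow> 'x \<Rightarrow> real" and b :: "'i \<Rightarrow> 'v \<Rightarrow> real"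
  assumes "\<And>j. j \<in> I \<Longrightarrow> integrable (Mx C) (a j)" "\<And>j. j \<in> I \<Longrightarrow> integrable (Mv C) (b j)"
  shows "integrable (Mx C \<Otimes>\<^sub>M Mv C) (\<lambda>(x, v). \<Sum>j\<in>I. a j x * b j v)"
proof -
  have "integrable (Mx C \<Otimes>\<^sub>M Mv C) (\<lambda>z. \<Sum>j\<in>I. case z of (x, v) \<Rightarrow> a j x * b j v)"
    using assms by (intro Bochner_Integration.integrable_sum integrable_product)
  then show ?thesis by (simp add: case_prod_unfold)
qed

end

context separable_density
begin

text \<open>The integrand is again a finite sum of products, so each factor can be treated alone:
  square integrability in x, moments up to third order in v. Square integrability of the
  \<open>Dx C l (c j)\<close> is a hypothesis because the locale says nothing about them.\<close>

lemma integrable_product_transport: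
  assumes \<psi>: "\<psi> \<in> L2x C" and Dc: "\<And>j l. j \<in> I \<Longrightarrow> Dx C l (c j) \<in> L2x C"
    and E: "\<And>l. (\<lambda>x. \<E> (rho C f) x $ l) \<in> Linf_x C"
    and \<phi>: "\<phi> \<in> borel_measurable (Mv C)" "\<And>v. \<bar>\<phi> v\<bar> \<le> a + b * (norm (vel C v))\<^sup>2"
  shows "integrable (Mx C \<Otimes>\<^sub>M Mv C) (\<lambda>(x, v). \<psi> x * \<phi> v * transport C \<E> f x v)"
proof -
  have int_v: "integrable (Mv C) (\<lambda>v. \<phi> v * (vel C v $ l * p j v))"
    "integrable (Mv C) (\<lambda>v. \<phi> v * Dv C l (p j) v)" if "j \<in> I" for l j
    using Rv_norm_vel_integrable[OF p_Rv[OF that], of 2 l] Dv_moments[OF p_Rv[OF that], of 2 l]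
    by (intro integrable_growth[OF \<phi>] Rv_vel_integrable Dv_integrable p_Rv that; simp)+
  have int_x: "integrable (Mx C) (\<lambda>x. \<psi> x * - Dx C l (c j) x)"
    "integrable (Mx C) (\<lambda>x. \<psi> x * - (\<E> (rho C f) x $ l * c j x))" if "j \<in> I" for l j
    using L2x_integrable_mult[OF \<psi> Dc[OF that, of l]]
      L2x_integrable_mult[OF \<psi> Linf_x_L2x[OF Linf_x_mult[OF E[of l] Rx_Linf_x[OF c_Rx[OF that]]]]]
    by simp_all
  \<comment> \<open>The nested sums are flattened to sums over pairs to fit
    \<open>integrable_sum_product\<close>; \<open>sum.cartesian_product\<close> restores the nesting
    at the end.\<close>
  have "integrable (Mx C \<Otimes>\<^sub>M Mv C) (\<lambda>(x, v). \<Sum>(l, j)\<in>UNIV \<times> I. (\<psi> x * - Dx C l (c j) x) * (\<phi> v * (vel C v $ l * p j v)))"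
    using integrable_sum_product[of "UNIV \<times> I" "\<lambda>(l, j) x. \<psi> x * - Dx C l (c j) x"
        "\<lambda>(l, j) v. \<phi> v * (vel C v $ l * p j v)"] int_v(1) int_x(1)
    by (auto simp: case_prod_unfold)
  moreover have "integrable (Mx C \<Otimes>\<^sub>M Mv C)
      (\<lambda>(x, v). \<Sum>(l, j)\<in>UNIV \<times> I. (\<psi> x * - (\<E> (rho C f) x $ l * c j x)) * (\<phi> v * Dv C l (p j) v))"
    using integrable_sum_product[of "UNIV \<times> I" "\<lambda>(l, j) x. \<psi> x * - (\<E> (rho C f) x $ l * c j x)"
        "\<lambda>(l, j) v. \<phi> v * Dv C l (p j) v"] int_v(2) int_x(2)
    by (auto simp: case_prod_unfold)
  ultimately have "integrable (Mx C \<Otimes>\<^sub>M Mv C) (\<lambda>z.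
      (case z of (x, v) \<Rightarrow> \<Sum>(l, j)\<in>UNIV \<times> I. (\<psi> x * - Dx C l (c j) x) * (\<phi> v * (vel C v $ l * p j v)))
    + (case z of (x, v) \<Rightarrow> \<Sum>(l, j)\<in>UNIV \<times> I. (\<psi> x * - (\<E> (rho C f) x $ l * c j x)) * (\<phi> v * Dv C l (p j) v)))"
    by (rule Bochner_Integration.integrable_add)
  also have "(\<lambda>z. (case z of (x, v) \<Rightarrow> \<Sum>(l, j)\<in>UNIV \<times> I. (\<psi> x * - Dx C l (c j) x) * (\<phi> v * (vel C v $ l * p j v)))
    + (case z of (x, v) \<Rightarrow> \<Sum>(l, j)\<in>UNIV \<times> I. (\<psi> x * - (\<E> (rho C f) x $ l * c j x)) * (\<phi> v * Dv C l (p j) v)))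
    = (\<lambda>(x, v). \<psi> x * \<phi> v * transport C \<E> f x v)"
    unfolding sum.cartesian_product[symmetric] transport_eq Dv_f
    by (rule ext) (simp add: case_prod_unfold algebra_simps sum_distrib_left sum_negf)
  finally show ?thesis .
qed

text \<open>As for transport, but with bounded coefficients throughout; regularity of
  \<open>Dv C l (p j)\<close> supplies the moments of the second derivatives.\<close>

lemma integrable_product_S_inc:
  assumes \<psi>: "\<psi> \<in> L2x C"
    and b: "\<And>l. (\<lambda>x. kick P \<Delta>\<beta> x $ l) \<in> Linf_x C"
    and B: "\<And>i j. (\<lambda>x. diffusion \<theta> P \<Delta>\<beta> x $ i $ j) \<in> Linf_x C"
    and \<phi>: "\<phi> \<in> borel_measurable (Mv C)" "\<And>v. \<bar>\<phi> v\<bar> \<le> a + b * (norm (vel C v))\<^sup>2"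
  shows "integrable (Mx C \<Otimes>\<^sub>M Mv C) (\<lambda>(x, v). \<psi> x * \<phi> v * S_inc \<theta> C P \<Delta>\<beta> f x v)"
proof -
  have int_v: "integrable (Mv C) (\<lambda>v. \<phi> v * Dv C l (p j) v)"
    "integrable (Mv C) (\<lambda>v. \<phi> v * Dv C i (Dv C l (p j)) v)" if "j \<in> I" for i l j
    using Dv_moments[OF p_Rv[OF that], of 2 l] Dv_moments[OF Dp_Rv[OF that, of l], of 2 i]
    by (intro integrable_growth[OF \<phi>] Dv_integrable p_Rv Dp_Rv that; simp)+
  have int_x: "integrable (Mx C) (\<lambda>x. \<psi> x * - (kick P \<Delta>\<beta> x $ l * c j x))"
    "integrable (Mx C) (\<lambda>x. \<psi> x * (1 / 2 * (diffusion \<theta> P \<Delta>\<beta> x $ i $ l * c j x)))" if "j \<in> I" for i l j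
    using L2x_integrable_mult[OF \<psi> Linf_x_L2x[OF Linf_x_mult[OF b[of l] Rx_Linf_x[OF c_Rx[OF that]]]]]
      L2x_integrable_mult[OF \<psi> Linf_x_L2x[OF Linf_x_mult[OF B[of i l] Rx_Linf_x[OF c_Rx[OF that]]]]]
    by simp_all
  have "integrable (Mx C \<Otimes>\<^sub>M Mv C)
      (\<lambda>(x, v). \<Sum>(l, j)\<in>UNIV \<times> I. (\<psi> x * - (kick P \<Delta>\<beta> x $ l * c j x)) * (\<phi> v * Dv C l (p j) v))"
    using integrable_sum_product[of "UNIV \<times> I" "\<lambda>(l, j) x. \<psi> x * - (kick P \<Delta>\<beta> x $ l * c j x)"
        "\<lambda>(l, j) v. \<phi> v * Dv C l (p j) v"] int_v(1) int_x(1)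
    by (auto simp: case_prod_unfold)
  moreover have "integrable (Mx C \<Otimes>\<^sub>M Mv C) (\<lambda>(x, v). \<Sum>(i, l, j)\<in>UNIV \<times> UNIV \<times> I.
      (\<psi> x * (1 / 2 * (diffusion \<theta> P \<Delta>\<beta> x $ i $ l * c j x))) * (\<phi> v * Dv C i (Dv C l (p j)) v))"
    using integrable_sum_product[of "UNIV \<times> UNIV \<times> I"
        "\<lambda>(i, l, j) x. \<psi> x * (1 / 2 * (diffusion \<theta> P \<Delta>\<beta> x $ i $ l * c j x))"
        "\<lambda>(i, l, j) v. \<phi> v * Dv C i (Dv C l (p j)) v"] int_v(2) int_x(2)
    by (auto simp: case_prod_unfold)
  ultimately have "integrable (Mx C \<Otimes>\<^sub>M Mv C) (\<lambda>z.
      (case z of (x, v) \<Rightarrow> \<Sum>(l, j)\<in>UNIV \<times> I. (\<psi> x * - (kick P \<Delta>\<beta> x $ l * c j x)) * (\<phi> v * Dv C l (p j) v))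
    + (case z of (x, v) \<Rightarrow> \<Sum>(i, l, j)\<in>UNIV \<times> UNIV \<times> I.
      (\<psi> x * (1 / 2 * (diffusion \<theta> P \<Delta>\<beta> x $ i $ l * c j x))) * (\<phi> v * Dv C i (Dv C l (p j)) v)))"
    by (rule Bochner_Integration.integrable_add)
  also have "(\<lambda>z. (case z of (x, v) \<Rightarrow> \<Sum>(l, j)\<in>UNIV \<times> I. (\<psi> x * - (kick P \<Delta>\<beta> x $ l * c j x)) * (\<phi> v * Dv C l (p j) v))
    + (case z of (x, v) \<Rightarrow> \<Sum>(i, l, j)\<in>UNIV \<times> UNIV \<times> I.
      (\<psi> x * (1 / 2 * (diffusion \<theta> P \<Delta>\<beta> x $ i $ l * c j x))) * (\<phi> v * Dv C i (Dv C l (p j)) v)))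
    = (\<lambda>(x, v). \<psi> x * \<phi> v * S_inc \<theta> C P \<Delta>\<beta> f x v)"
    unfolding sum.cartesian_product[symmetric] S_inc_eq[of f, OF f_Rv Dv_f_Rv]
    unfolding Dv_Dv_f unfolding Dv_f
    by (rule ext) (simp add: case_prod_unfold algebra_simps sum_distrib_left sum_negf)
  finally show ?thesis .
qed

lemma integrable_transport: "integrable (Mv C) (transport C \<E> f x)"
  unfolding transport_eq
  by (intro Bochner_Integration.integrable_diff Bochner_Integration.integrable_minus
      Bochner_Integration.integrable_sum integrable_mult_right
      Rv_vel_integrable p_Rv Dv_integrable f_Rv)

lemma integrable_S_inc: "integrable (Mv C) (S_inc \<theta> C P \<Delta>\<beta> f x)"
  unfolding S_inc_eq[of f, OF f_Rv Dv_f_Rv]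
  by (intro Bochner_Integration.integrable_add Bochner_Integration.integrable_minus
      Bochner_Integration.integrable_sum integrable_mult_right Dv_integrable f_Rv Dv_f_Rv)

end

section \<open>The conserved columns of one step\<close>

text \<open>The combinations on the right form a subspace containing the family. Coefficients are
  attached to indices rather than to functions, so repeated members of the family do no
  harm.\<close>

lemma span_family_explicit:
  assumes "g \<in> funs.span (X ` {1..n::nat})"
  obtains a where "g = (\<lambda>x. \<Sum>i=1..n. a i * X i x)"
proof -
  let ?S = "{g. \<exists>a. g = (\<lambda>x. \<Sum>i=1..n. a i * X i x)}"
  have "funs.subspace ?S"
  proof (rule funs_subspaceI)
    fix b c g h assume "g \<in> ?S" "h \<in> ?S"
    then obtain a a' where "g = (\<lambda>x. \<Sum>i=1..n. a i * X i x)" "h = (\<lambda>x. \<Sum>i=1..n. a' i * X i x)"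
      by auto
    then have "(\<lambda>x. b * g x + c * h x) = (\<lambda>x. \<Sum>i=1..n. (b * a i + c * a' i) * X i x)"
      by (simp add: sum.distrib sum_distrib_left distrib_right mult.assoc)
    then show "(\<lambda>x. b * g x + c * h x) \<in> ?S" by (auto intro!: exI)
  qed auto
  moreover have "X ` {1..n} \<subseteq> ?S"
  proof safe
    fix i assume "i \<in> {1..n}"
    then have "X i = (\<lambda>x. \<Sum>j=1..n. (if j = i then 1 else 0) * X j x)"
      by (simp add: if_distrib if_distribR cong: if_cong)
    then show "\<exists>a. X i = (\<lambda>x. \<Sum>j=1..n. a j * X j x)"
      by (rule exI[of _ "\<lambda>j. if j = i then 1 else 0"])
  qed
  ultimately have "funs.span (X ` {1..n}) \<subseteq> ?S" by (rule funs.span_minimal[rotated])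
  with assms that show ?thesis by blast
qed

context vp_calculus
begin

lemma proj_x_span:
  assumes o: "orthonormal_x C n X" and g: "g \<in> funs.span (X ` {1..n})"
  shows "proj_x C n X g = g"
proof -
  obtain a where a: "g = (\<lambda>x. \<Sum>i=1..n. a i * X i x)"
    using g by (rule span_family_explicit)
  have "ipx C (X k) g = a k" if k: "k \<in> {1..n}" for k
  proof -
    have "ipx C (X k) g = (\<integral>x. (\<Sum>i=1..n. a i * (X k x * X i x)) \<partial>Mx C)"
      by (simp add: ipx_def a sum_distrib_left ac_simps)
    also have "\<dots> = (\<Sum>i=1..n. a i * ipx C (X k) (X i))"
      using o k by (subst Bochner_Integration.integral_sum)
        (auto simp: ipx_def orthonormal_x_def intro!: L2x_integrable_mult)
    also have "\<dots> = (\<Sum>i=1..n. if i = k then a i else 0)"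
      using o k by (intro sum.cong) (auto simp: orthonormal_x_def)
    finally show ?thesis using k by simp
  qed
  then show ?thesis by (simp add: proj_x_def a)
qed

lemma L2v_integrable_mult:
  assumes "valid_data C P" "g \<in> L2v C P" "h \<in> L2v C P"
  shows "integrable (Mv C) (\<lambda>v. wt P v * g v * h v)"
proof (rule integrable_mult_of_squares)
  show "0 \<le> wt P v" for v using assms(1) by (simp add: valid_data_def less_imp_le)
qed (use assms in \<open>auto simp: L2v_def valid_data_def\<close>)

lemma expansion_v_span:
  assumes P: "valid_data C P" and o: "orthonormal_v C P n V" and g: "g \<in> funs.span (V ` {1..n})"
  shows "(\<Sum>l=1..n. ipv C P g (V l) * V l v) = g v"
proof -
  obtain a where a: "g = (\<lambda>x. \<Sum>i=1..n. a i * V i x)"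
    using g by (rule span_family_explicit)
  have "ipv C P g (V k) = a k" if k: "k \<in> {1..n}" for k
  proof -
    have "ipv C P g (V k) = (\<integral>x. (\<Sum>i=1..n. a i * (wt P x * V i x * V k x)) \<partial>Mv C)"
      by (simp add: ipv_def a sum_distrib_left sum_distrib_right ac_simps)
    also have "\<dots> = (\<Sum>i=1..n. a i * ipv C P (V i) (V k))"
      using o k by (subst Bochner_Integration.integral_sum)
        (auto simp: ipv_def orthonormal_v_def intro!: L2v_integrable_mult[OF P])
    also have "\<dots> = (\<Sum>i=1..n. if i = k then a i else 0)"
      using o k by (intro sum.cong) (auto simp: orthonormal_v_def)
    finally show ?thesis using k by simp
  qed
  then show ?thesis by (simp add: a)
qed

section \<open>Augmented bases and the S-step\<close>

lemma separable_density_dens: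
  assumes "low_rank_state C P st"
  shows "separable_density C {1..rk P} (K_old st) (\<lambda>j v. wt P v * Vb st j v) (dens P st)"
proof (intro separable_density.intro separable_density_axioms.intro vp_calculus_axioms)
  fix j assume "j \<in> {1..rk P}"
  have "(\<lambda>x. \<Sum>i=1..nx st. Sc st i j * Xb st i x) \<in> Rx C"
    using assms by (intro Dx_sum(1)) (auto simp: low_rank_state_def)
  then show "K_old st j \<in> Rx C" by (simp add: K_old_def[abs_def] mult.commute)
next
  show "dens P st = (\<lambda>x v. \<Sum>j=1..rk P. K_old st j x * (wt P v * Vb st j v))"
    unfolding dens_def K_old_def sum_distrib_left sum_distrib_right
    by (intro ext, subst sum.swap) (simp add: ac_simps)
qed (use assms in \<open>auto simp: low_rank_state_def\<close>)

lemma augmentation_span_x: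
  assumes "augmentation \<theta> C P \<E> \<Delta>\<beta> st na Xa nb Va"
  shows "i \<in> {1..nx st} \<Longrightarrow> Xb st i \<in> funs.span (Xa ` {1..na})"
    and "i \<in> {1..nx st} \<Longrightarrow> Dx C l (Xb st i) \<in> funs.span (Xa ` {1..na})"
    and "j \<in> {1..rk P} \<Longrightarrow> K_new \<theta> C P \<E> \<Delta>\<beta> st j \<in> funs.span (Xa ` {1..na})"
proof -
  obtain G where G: "funs.span (Xa ` {1..na}) =
        funs.span (Xb st ` {1..nx st} \<union> (\<Union>l. (\<lambda>i. Dx C l (Xb st i)) ` {1..nx st}) \<union>
          K_new \<theta> C P \<E> \<Delta>\<beta> st ` {1..rk P} \<union> G)"
    using assms unfolding augmentation_def by blast
  show "i \<in> {1..nx st} \<Longrightarrow> Xb st i \<in> funs.span (Xa ` {1..na})"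
    "i \<in> {1..nx st} \<Longrightarrow> Dx C l (Xb st i) \<in> funs.span (Xa ` {1..na})"
    "j \<in> {1..rk P} \<Longrightarrow> K_new \<theta> C P \<E> \<Delta>\<beta> st j \<in> funs.span (Xa ` {1..na})"
    unfolding G by (rule funs.span_base, blast)+
qed

text \<open>The augmented spans contain the old bases, so both projections in \<open>S_proj\<close>
  act as identities. Consequently the S-step evaluates its increments at the same density, and with
  the same field, as the K-step.\<close>

lemma dens_aug_eq:
  assumes P: "valid_data C P" and st: "low_rank_state C P st"
    and aug: "augmentation \<theta> C P \<E> \<Delta>\<beta> st na Xa nb Va"
  shows "dens_aug C P st na Xa nb Va = dens P st"
proof (intro ext)
  fix x v
  have X: "(\<Sum>k=1..na. ipx C (Xa k) (Xb st i) * Xa k x) = Xb st i x" if "i \<in> {1..nx st}" for i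
  proof -
    have "Xb st i \<in> funs.span (Xa ` {1..na})"
      by (rule augmentation_span_x(1)[OF aug that])
    then show ?thesis
      using proj_x_span[of na Xa] aug by (auto simp: augmentation_def proj_x_def dest: fun_cong)
  qed
  have V: "(\<Sum>l=1..nb. ipv C P (Vb st j) (Va l) * Va l v) = Vb st j v" if "j \<in> {1..rk P}" for j
  proof -
    \<comment> \<open>The augmentation lists fixed modes and evolving basis functions separately, so
      the index decides which generator is meant.\<close>
    have "Vb st j \<in> Umode P ` {1..nfix P} \<union> Vb st ` {nfix P + 1..rk P}"
      using st that by (cases "j \<le> nfix P") (auto simp: low_rank_state_def)
    then have "Vb st j \<in> funs.span (Va ` {1..nb})"
      using aug unfolding augmentation_def by (metis UnI1 funs.span_base)
    then show ?thesis
      using aug by (intro expansion_v_span[OF P]) (auto simp: augmentation_def)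
  qed
  have "dens_aug C P st na Xa nb Va x v = wt P v * (\<Sum>i=1..nx st. \<Sum>j=1..rk P. \<Sum>k=1..na. \<Sum>l=1..nb.
      (ipx C (Xa k) (Xb st i) * Xa k x) * Sc st i j * (ipv C P (Vb st j) (Va l) * Va l v))"
  proof -
    let ?t = "\<lambda>k l i j. (ipx C (Xa k) (Xb st i) * Xa k x) * Sc st i j * (ipv C P (Vb st j) (Va l) * Va l v)"
    have "(\<Sum>k=1..na. \<Sum>l=1..nb. Xa k x * S_proj C P st Xa Va k l * Va l v)
      = (\<Sum>(k, l)\<in>{1..na} \<times> {1..nb}. \<Sum>(i, j)\<in>{1..nx st} \<times> {1..rk P}. ?t k l i j)"
      unfolding sum.cartesian_product[symmetric] S_proj_def
      by (simp only: sum_distrib_left sum_distrib_right ac_simps)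
    also have "\<dots> = (\<Sum>(i, j)\<in>{1..nx st} \<times> {1..rk P}. \<Sum>(k, l)\<in>{1..na} \<times> {1..nb}. ?t k l i j)"
      unfolding case_prod_unfold by (rule sum.swap)
    finally show ?thesis
      unfolding dens_aug_def sum.cartesian_product[symmetric] by simp
  qed
  also have "\<dots> = wt P v * (\<Sum>i=1..nx st. \<Sum>j=1..rk P. (\<Sum>k=1..na. ipx C (Xa k) (Xb st i) * Xa k x)
      * Sc st i j * (\<Sum>l=1..nb. ipv C P (Vb st j) (Va l) * Va l v))"
    unfolding sum_distrib_right[of _ "{1..na}"] unfolding sum_distrib_left[of _ _ "{1..nb}"] ..
  also have "\<dots> = dens P st x v"
    unfolding dens_def by (intro arg_cong[of _ _ "\<lambda>y. wt P v * y"] sum.cong refl) (simp only: X V)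
  finally show "dens_aug C P st na Xa nb Va x v = dens P st x v" .
qed

lemma field_Linf_x:
  assumes "poisson_field C \<rho> E"
  shows "(\<lambda>x. E x $ l) \<in> Linf_x C"
proof -
  obtain u where "\<And>l. Dx C l u \<in> Rx C" and E: "\<And>x. E x = (\<chi> l. - Dx C l u x)"
    using assms unfolding poisson_field_def by blast
  then have "(\<lambda>x. - 1 * Dx C l u x) \<in> Linf_x C"
    by (intro Linf_x_mult[OF Linf_x_const] Rx_Linf_x)
  then show ?thesis by (simp add: E)
qed

lemma sig_Linf_x: "valid_data C P \<Longrightarrow> (\<lambda>x. sig P x $ l $ s) \<in> Linf_x C"
  by (simp add: valid_data_def Linf_x_def)

lemma kick_Linf_x:
  assumes "valid_data C P"
  shows "(\<lambda>x. kick P \<Delta>\<beta> x $ l) \<in> Linf_x C"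
  unfolding kick_nth by (intro Linf_x_sum Linf_x_mult[OF Linf_x_const] sig_Linf_x assms)

lemma diffusion_Linf_x:
  assumes P: "valid_data C P"
  shows "(\<lambda>x. diffusion \<theta> P \<Delta>\<beta> x $ i $ j) \<in> Linf_x C"
proof (cases \<theta>)
  case EM
  have "(\<lambda>x. tau P * (\<Sum>s\<in>UNIV. sig P x $ i $ s * sig P x $ j $ s)) \<in> Linf_x C"
    by (intro Linf_x_mult[OF Linf_x_const] Linf_x_sum Linf_x_mult[OF sig_Linf_x sig_Linf_x] P)
  then show ?thesis
    using EM by (simp add: diffusion_def sig_sq_def matrix_matrix_mult_def transpose_def)
next
  case Heun
  then show ?thesis using Linf_x_mult[OF kick_Linf_x[OF P] kick_Linf_x[OF P]] by (simp add: diffusion_def)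
qed

text \<open>The increment of a conserved column is that of the K-step, which the augmented spatial
  basis contains, so the projection in the S-step acts as the identity on it.\<close>

lemma conserved_column:
  assumes P: "valid_data C P" and st: "low_rank_state C P st"
    and E: "poisson_field C (rho C (dens P st)) (\<E> (rho C (dens P st)))"
    and aug: "augmentation \<theta> C P \<E> \<Delta>\<beta> st na Xa nb Va"
    and a: "a \<in> {1..nfix P}"
    and growth: "\<And>v. \<bar>Umode P a v\<bar> \<le> A + B * (norm (vel C v))\<^sup>2"
  shows "(\<Sum>k=1..na. Xa k x * S_new \<theta> C P \<E> \<Delta>\<beta> st na Xa nb Va k a) = K_new \<theta> C P \<E> \<Delta>\<beta> st a x"
proof -
  interpret separable_density C "{1..rk P}" "K_old st" "\<lambda>j v. wt P v * Vb st j v" "dens P st"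
    by (rule separable_density_dens[OF st])
  let ?f = "dens P st" and ?U = "Umode P a"
  have a': "a \<in> {1..rk P}" using a P by (auto simp: valid_data_def)
  have o: "orthonormal_x C na Xa" and Va: "Va a = ?U" and Vb: "Vb st a = ?U"
    using aug a st by (auto simp: augmentation_def low_rank_state_def)
  have Xa: "Xa k \<in> L2x C" if "k \<in> {1..na}" for k
    using o that by (auto simp: orthonormal_x_def)
  have L2: "h \<in> L2x C" if "h \<in> funs.span (Xa ` {1..na})" for h
    using that by (rule L2x_span[rotated]) (auto simp: Xa)
  \<comment> \<open>Here the spatial derivatives in the augmented basis are used: they make the
    derivative of an old column square integrable.\<close>
  have Dc: "Dx C l (K_old st j) \<in> L2x C" if "j \<in> {1..rk P}" for j l
  proof -
    have "Dx C l (\<lambda>x. \<Sum>i=1..nx st. Sc st i j * Xb st i x) = (\<lambda>x. \<Sum>i=1..nx st. Sc st i j * Dx C l (Xb st i) x)"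
      using st by (intro Dx_sum(2)) (auto simp: low_rank_state_def)
    then have "Dx C l (K_old st j) = (\<lambda>x. \<Sum>i=1..nx st. Sc st i j * Dx C l (Xb st i) x)"
      by (simp add: K_old_def[abs_def] mult.commute)
    moreover have "\<dots> \<in> funs.span (Xa ` {1..na})"
      by (intro span_sum_scaled augmentation_span_x[OF aug])
    ultimately show ?thesis using L2 by simp
  qed
  have U: "?U \<in> borel_measurable (Mv C)"
    using P a by (auto simp: valid_data_def orthonormal_v_def L2v_def)
  have S: "S_new \<theta> C P \<E> \<Delta>\<beta> st na Xa nb Va k a = ipx C (Xa k) (K_new \<theta> C P \<E> \<Delta>\<beta> st a)"
    if k: "k \<in> {1..na}" for k
  proof -
    \<comment> \<open>In \<open>T\<close> and \<open>I\<close> the first fact is the Fubini identity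
      and the second the integrability of the resulting spatial integrand.\<close>
    note T = prxv_product[OF integrable_product_transport[where \<E>=\<E>,
          OF Xa[OF k] Dc field_Linf_x[OF E] U growth]]
    note I = prxv_product[OF integrable_product_S_inc[where \<theta>=\<theta> and \<Delta>\<beta>=\<Delta>\<beta>,
          OF Xa[OF k] kick_Linf_x[OF P] diffusion_Linf_x[OF P] U growth]]
    have X: "integrable (Mx C) (\<lambda>x. Xa k x * Xb st i x)" if "i \<in> {1..nx st}" for i
      using that st by (intro L2x_integrable_mult Xa[OF k]) (auto simp: low_rank_state_def orthonormal_x_def)
    have K: "ipx C (Xa k) (K_old st a) = (\<Sum>i=1..nx st. ipx C (Xa k) (Xb st i) * Sc st i a)"
    proof -
      have "ipx C (Xa k) (K_old st a) = (\<integral>x. (\<Sum>i=1..nx st. Sc st i a * (Xa k x * Xb st i x)) \<partial>Mx C)"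
        by (simp add: ipx_def K_old_def sum_distrib_left ac_simps)
      also have "\<dots> = (\<Sum>i=1..nx st. Sc st i a * ipx C (Xa k) (Xb st i))"
        using X by (subst Bochner_Integration.integral_sum) (auto simp: ipx_def)
      finally show ?thesis by (simp add: mult.commute)
    qed
    have Ki: "integrable (Mx C) (\<lambda>x. Xa k x * K_old st a x)"
      by (intro L2x_integrable_mult Xa[OF k] Linf_x_L2x Rx_Linf_x c_Rx a')
    \<comment> \<open>Since \<open>Va a\<close> coincides with \<open>Vb st a\<close>,
      orthonormality of the old velocity basis leaves the single term j = a.\<close>
    have "S_proj C P st Xa Va k a = (\<Sum>i=1..nx st. \<Sum>j=1..rk P.
        if j = a then ipx C (Xa k) (Xb st i) * Sc st i j else 0)"
      unfolding S_proj_def using a' Va Vb[symmetric] st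
      by (intro sum.cong refl) (auto simp: low_rank_state_def orthonormal_v_def)
    then have "S_proj C P st Xa Va k a = ipx C (Xa k) (K_old st a)"
      using a' by (simp add: K)
    then have "S_new \<theta> C P \<E> \<Delta>\<beta> st na Xa nb Va k a = ipx C (Xa k) (K_old st a)
        + tau P * ipx C (Xa k) (\<lambda>x. prv C ?U (transport C \<E> ?f x))
        + ipx C (Xa k) (\<lambda>x. prv C ?U (S_inc \<theta> C P \<Delta>\<beta> ?f x))"
      unfolding S_new_def Let_def dens_aug_eq[OF P st aug] Va by (simp only: T(1) I(1))
    \<comment> \<open>The three spatial integrals merge into one, by \<open>Ki\<close>,
      \<open>T(2)\<close> and \<open>I(2)\<close>.\<close>
    also have "\<dots> = ipx C (Xa k) (K_new \<theta> C P \<E> \<Delta>\<beta> st a)"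
      unfolding ipx_def K_new_def Vb distrib_left using T(2) I(2) Ki
      by (simp add: mult.left_commute[of _ "tau P"])
    finally show ?thesis .
  qed
  have "K_new \<theta> C P \<E> \<Delta>\<beta> st a \<in> funs.span (Xa ` {1..na})"
    by (rule augmentation_span_x(3)[OF aug a'])
  then have "K_new \<theta> C P \<E> \<Delta>\<beta> st a x = (\<Sum>k=1..na. ipx C (Xa k) (K_new \<theta> C P \<E> \<Delta>\<beta> st a) * Xa k x)"
    using fun_cong[OF proj_x_span[OF o], of _ x] by (simp only: proj_x_def)
  then show ?thesis by (simp add: S mult.commute)
qed

end

section \<open>The second moment of one step\<close>

context vp_calculus
begin

text \<open>Division by zero gives zero, so a vanishing norm would turn the normalized function into
  the zero function, against its unit length.\<close>

lemma normv_nonzero: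
  assumes "ipv C P (\<lambda>v. g v / normv C P g) (\<lambda>v. g v / normv C P g) = 1"
  shows "normv C P g \<noteq> 0"
proof
  assume "normv C P g = 0"
  with assms show False by (simp add: ipv_def)
qed

lemma mode_norms_nonzero:
  assumes "valid_data C P"
  shows "normv C P (\<lambda>_. 1) \<noteq> 0" and "normv C P (chi2 C P) \<noteq> 0"
proof -
  have U: "Umode P 1 = (\<lambda>v. 1 / normv C P (\<lambda>_. 1))"
    "Umode P (CARD('d) + 2) = (\<lambda>v. chi2 C P v / normv C P (chi2 C P))"
    and o: "orthonormal_v C P (nfix P) (Umode P)" and m: "CARD('d) + 2 \<le> nfix P"
    using assms by (simp_all add: valid_data_def)
  have "ipv C P (Umode P a) (Umode P a) = 1" if "a \<in> {1..nfix P}" for a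
    using o that by (simp add: orthonormal_v_def)
  from this[of 1] this[of "CARD('d) + 2"]
  have i: "ipv C P (Umode P 1) (Umode P 1) = 1" "ipv C P (Umode P (CARD('d) + 2)) (Umode P (CARD('d) + 2)) = 1"
    using m by auto
  show "normv C P (\<lambda>_. 1) \<noteq> 0" "normv C P (chi2 C P) \<noteq> 0"
    using normv_nonzero[of P "\<lambda>_. 1"] normv_nonzero[of P "chi2 C P"] i unfolding U by blast+
qed

lemma norm_sq_modes:
  assumes "valid_data C P"
  shows "(norm (vel C v))\<^sup>2 = normv C P (chi2 C P) * Umode P (CARD('d) + 2) v
    + alpha2 C P * normv C P (\<lambda>_. 1) * Umode P 1 v"
proof -
  have "Umode P 1 = (\<lambda>v. 1 / normv C P (\<lambda>_. 1))"
    "Umode P (CARD('d) + 2) = (\<lambda>v. chi2 C P v / normv C P (chi2 C P))"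
    using assms by (simp_all add: valid_data_def)
  then show ?thesis using mode_norms_nonzero[OF assms] by (simp add: chi2_def)
qed

text \<open>Provides the growth hypothesis of \<open>conserved_column\<close> for the two modes that
  make up |v|^2. Further fixed modes are only known to be square integrable with the weight.\<close>

lemma mode_growth:
  assumes "valid_data C P"
  shows "\<exists>A B. \<forall>v. \<bar>Umode P 1 v\<bar> \<le> A + B * (norm (vel C v))\<^sup>2"
    and "\<exists>A B. \<forall>v. \<bar>Umode P (CARD('d) + 2) v\<bar> \<le> A + B * (norm (vel C v))\<^sup>2"
proof -
  have U: "Umode P 1 = (\<lambda>v. 1 / normv C P (\<lambda>_. 1))"
    "Umode P (CARD('d) + 2) = (\<lambda>v. chi2 C P v / normv C P (chi2 C P))"
    using assms by (simp_all add: valid_data_def)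
  show "\<exists>A B. \<forall>v. \<bar>Umode P 1 v\<bar> \<le> A + B * (norm (vel C v))\<^sup>2"
    unfolding U by (rule exI[of _ "\<bar>1 / normv C P (\<lambda>_. 1)\<bar>"], rule exI[of _ 0]) simp
  let ?n = "normv C P (chi2 C P)"
  have "\<bar>chi2 C P v / ?n\<bar> \<le> \<bar>alpha2 C P\<bar> / \<bar>?n\<bar> + 1 / \<bar>?n\<bar> * (norm (vel C v))\<^sup>2" for v
  proof -
    have "\<bar>chi2 C P v\<bar> \<le> \<bar>alpha2 C P\<bar> + (norm (vel C v))\<^sup>2"
      using abs_triangle_ineq4[of "(norm (vel C v))\<^sup>2" "alpha2 C P"] by (simp add: chi2_def)
    from divide_right_mono[OF this, of "\<bar>?n\<bar>"] show ?thesis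
      by (simp add: abs_divide add_divide_distrib)
  qed
  then show "\<exists>A B. \<forall>v. \<bar>Umode P (CARD('d) + 2) v\<bar> \<le> A + B * (norm (vel C v))\<^sup>2"
    unfolding U by blast
qed

text \<open>Its coefficients do not depend on \<open>h\<close>. The old density, the new density and
  both increments are therefore expanded alike, and identities for two columns suffice.\<close>

lemma second_moment_modes:
  assumes P: "valid_data C P"
    and h: "integrable (Mv C) h" "integrable (Mv C) (\<lambda>v. (norm (vel C v))\<^sup>2 * h v)"
  shows "(\<integral>v. (norm (vel C v))\<^sup>2 * h v \<partial>Mv C) = normv C P (chi2 C P) * prv C (Umode P (CARD('d) + 2)) h
    + alpha2 C P * normv C P (\<lambda>_. 1) * prv C (Umode P 1) h"
proof -
  have "orthonormal_v C P (nfix P) (Umode P)" "CARD('d) + 2 \<le> nfix P"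
    using P by (simp_all add: valid_data_def)
  then have m: "Umode P 1 \<in> borel_measurable (Mv C)" "Umode P (CARD('d) + 2) \<in> borel_measurable (Mv C)"
    by (auto simp: orthonormal_v_def L2v_def)
  have i: "integrable (Mv C) (\<lambda>v. Umode P 1 v * h v)"
    "integrable (Mv C) (\<lambda>v. Umode P (CARD('d) + 2) v * h v)"
    using mode_growth[OF P] integrable_growth[OF m(1) _ h(1), of _ _ 2] integrable_growth[OF m(2) _ h(1), of _ _ 2] h(2)
    by blast+
  have "(\<integral>v. (norm (vel C v))\<^sup>2 * h v \<partial>Mv C)
    = (\<integral>v. normv C P (chi2 C P) * (Umode P (CARD('d) + 2) v * h v)
      + alpha2 C P * normv C P (\<lambda>_. 1) * (Umode P 1 v * h v) \<partial>Mv C)"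
    unfolding norm_sq_modes[OF P] distrib_right mult.assoc ..
  then show ?thesis using i by (simp add: prv_def)
qed

section \<open>Truncated densities and their conserved columns\<close>

text \<open>The weight inside the density converts the unweighted product into the weighted one, so
  testing with a mode reads off its coefficient. Only products with \<open>U\<close> enter, which is
  what \<open>truncation_velocity_basis\<close> delivers.\<close>

lemma prv_combination:
  fixes n :: nat
  assumes P: "valid_data C P" and W: "\<And>j. j \<in> {1..n} \<Longrightarrow> W j \<in> L2v C P"
    and a: "a \<in> {1..n}" and U: "\<And>j. j \<in> {1..n} \<Longrightarrow> ipv C P U (W j) = (if j = a then 1 else 0)"
    and "U \<in> L2v C P"
  shows "prv C U (\<lambda>v. \<Sum>j=1..n. c j * (wt P v * W j v)) = c a"
proof -
  have "prv C U (\<lambda>v. \<Sum>j=1..n. c j * (wt P v * W j v))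
      = (\<integral>v. (\<Sum>j=1..n. c j * (wt P v * U v * W j v)) \<partial>Mv C)"
    by (simp add: prv_def sum_distrib_left ac_simps)
  also have "\<dots> = (\<Sum>j=1..n. c j * ipv C P U (W j))"
    by (subst Bochner_Integration.integral_sum) (auto simp: ipv_def intro!: L2v_integrable_mult[OF P] assms)
  also have "\<dots> = (\<Sum>j=1..n. if j = a then c j else 0)"
    using U by (intro sum.cong) auto
  finally show ?thesis using a by simp
qed

text \<open>Meant above all for the truncated state, whose velocity functions are not assumed
  regular: its moments exist because 1 and |v|^2 lie in the weighted L2 space.\<close>

lemma combination_moments_integrable:
  fixes n :: nat
  assumes P: "valid_data C P" and W: "\<And>j. j \<in> {1..n} \<Longrightarrow> W j \<in> L2v C P"
  shows "integrable (Mv C) (\<lambda>v. \<Sum>j=1..n. c j * (wt P v * W j v))"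
    and "integrable (Mv C) (\<lambda>v. (norm (vel C v))\<^sup>2 * (\<Sum>j=1..n. c j * (wt P v * W j v)))"
proof -
  have L: "(\<lambda>_. 1) \<in> L2v C P" "(\<lambda>v. (norm (vel C v))\<^sup>2) \<in> L2v C P"
    using P by (auto simp: valid_data_def)
  have *: "integrable (Mv C) (\<lambda>v. \<phi> v * (\<Sum>j=1..n. c j * (wt P v * W j v)))" if "\<phi> \<in> L2v C P" for \<phi>
  proof -
    have "integrable (Mv C) (\<lambda>v. \<Sum>j=1..n. c j * (wt P v * \<phi> v * W j v))"
      by (intro Bochner_Integration.integrable_sum integrable_mult_right L2v_integrable_mult[OF P] W that)
    then show ?thesis by (simp add: sum_distrib_left ac_simps)
  qed
  from *[OF L(1)] *[OF L(2)] show "integrable (Mv C) (\<lambda>v. \<Sum>j=1..n. c j * (wt P v * W j v))"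
    "integrable (Mv C) (\<lambda>v. (norm (vel C v))\<^sup>2 * (\<Sum>j=1..n. c j * (wt P v * W j v)))"
    by simp_all
qed

lemma L2v_sum:
  assumes P: "valid_data C P" and "\<And>l. l \<in> I \<Longrightarrow> W l \<in> L2v C P"
  shows "(\<lambda>v. \<Sum>l\<in>I. W l v * a l) \<in> L2v C P"
  using assms(2)
proof (induction I rule: infinite_finite_induct)
  case (insert i I)
  let ?g = "W i" and ?h = "\<lambda>v. \<Sum>l\<in>I. W l v * a l"
  have g: "?g \<in> L2v C P" "?h \<in> L2v C P" using insert by auto
  have "integrable (Mv C) (\<lambda>v. (a i)\<^sup>2 * (wt P v * (?g v)\<^sup>2) + 2 * a i * (wt P v * ?g v * ?h v) + wt P v * (?h v)\<^sup>2)"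
    using g L2v_integrable_mult[OF P g] by (auto simp: L2v_def)
  also have "(\<lambda>v. (a i)\<^sup>2 * (wt P v * (?g v)\<^sup>2) + 2 * a i * (wt P v * ?g v * ?h v) + wt P v * (?h v)\<^sup>2)
      = (\<lambda>v. wt P v * (?g v * a i + ?h v)\<^sup>2)"
    by (simp add: power2_eq_square algebra_simps)
  finally show ?case using g insert.hyps by (auto simp: L2v_def)
qed (auto simp: L2v_def)

lemma truncation_velocity_basis:
  assumes P: "valid_data C P" and o: "orthonormal_v C P nb Va"
    and U: "nfix P \<le> nb" "\<And>a. a \<in> {1..nfix P} \<Longrightarrow> Va a = Umode P a"
    and V: "\<And>j. j \<in> {1..rk P} \<Longrightarrow> V j = (if j \<le> nfix P then Umode P j
        else (\<lambda>v. \<Sum>l=1..nb - nfix P. Va (nfix P + l) v * w l (j - nfix P)))"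
    and j: "j \<in> {1..rk P}"
  shows "V j \<in> L2v C P"
    and "a \<in> {1..nfix P} \<Longrightarrow> ipv C P (Umode P a) (V j) = (if j = a then 1 else 0)"
proof -
  let ?m = "nfix P"
  have Va: "Va (?m + l) \<in> L2v C P" if "l \<in> {1..nb - ?m}" for l
    using o that by (auto simp: orthonormal_v_def)
  have Uo: "orthonormal_v C P ?m (Umode P)" using P by (simp add: valid_data_def)
  show "V j \<in> L2v C P"
  proof (cases "j \<le> ?m")
    case True
    then show ?thesis using V[OF j] Uo j by (auto simp: orthonormal_v_def)
  next
    case False
    then show ?thesis using V[OF j] by (auto intro!: L2v_sum[OF P] Va)
  qed
  show "ipv C P (Umode P a) (V j) = (if j = a then 1 else 0)" if a: "a \<in> {1..?m}"
  proof (cases "j \<le> ?m")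
    case True
    then show ?thesis using V[OF j] Uo j a by (auto simp: orthonormal_v_def)
  next
    case False
    have Ua: "Umode P a \<in> L2v C P" using Uo a by (auto simp: orthonormal_v_def)
    have "ipv C P (Umode P a) (V j)
        = (\<integral>v. (\<Sum>l=1..nb - ?m. w l (j - ?m) * (wt P v * Umode P a v * Va (?m + l) v)) \<partial>Mv C)"
      using V[OF j] False by (simp add: ipv_def sum_distrib_left ac_simps)
    also have "\<dots> = (\<Sum>l=1..nb - ?m. w l (j - ?m) * ipv C P (Va a) (Va (?m + l)))"
      by (subst Bochner_Integration.integral_sum)
        (auto simp: ipv_def U(2)[OF a] intro!: L2v_integrable_mult[OF P] Ua Va)
    \<comment> \<open>The indices differ, as \<open>a\<close> is at most m and \<open>?m + l\<close>
      exceeds m.\<close>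
    also have "\<dots> = 0"
      using o a U(1) by (intro sum.neutral) (auto simp: orthonormal_v_def)
    finally show ?thesis using False a by auto
  qed
qed

text \<open>A conserved column of the block-diagonal coefficient matrix is supported on the
  \<open>Scons\<close> block, whereas the singular value truncation acts on the other block. Undoing
  the two QR factorizations returns the column unchanged.\<close>

lemma truncation_conserved_column:
  assumes t: "cons_truncation C P na Xa nb Va St st'" and a: "a \<in> {1..nfix P}" and P: "valid_data C P"
  shows "K_old st' a x = (\<Sum>k=1..na. Xa k x * St k a)"
proof -
  let ?m = "nfix P" and ?r = "rk P"
  have ar: "a \<in> {1..?r}" using a P by (auto simp: valid_data_def)
  from t obtain c Xc Scons q Xr and u :: "nat \<Rightarrow> nat \<Rightarrow> real" and \<sigma> :: "nat \<Rightarrow> real" and R where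
    qc: "qr_fact C ?m (\<lambda>l x. \<Sum>k=1..na. Xa k x * St k l) c Xc Scons"
    and qx: "qr_fact C (c + (?r - ?m)) (\<lambda>a. if a \<le> c then Xc a else (\<lambda>x. \<Sum>i=1..q. Xr i x * u i (a - c)))
        (nx st') (Xb st') R"
    and S: "\<forall>i\<in>{1..nx st'}. \<forall>j\<in>{1..?r}. Sc st' i j = (\<Sum>b=1..c + (?r - ?m).
        R i b * (if b \<le> c \<and> j \<le> ?m then Scons b j
                 else if c < b \<and> ?m < j \<and> b - c = j - ?m then \<sigma> (b - c) else 0))"
    unfolding cons_truncation_def Let_def by (elim exE conjE) (rule that; assumption)
  let ?blk = "\<lambda>b. if b \<le> c then Xc b else (\<lambda>x. \<Sum>i=1..q. Xr i x * u i (b - c))"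
  have "\<not> ?m < a" "a \<le> ?m" using a by auto
  then have "Sc st' i a = (\<Sum>b=1..c + (?r - ?m). R i b * (if b \<le> c then Scons b a else 0))"
    if "i \<in> {1..nx st'}" for i
    using bspec[OF bspec[OF S that] ar] by (simp cong: if_cong)
  then have "K_old st' a x = (\<Sum>i=1..nx st'. \<Sum>b=1..c + (?r - ?m). Xb st' i x * (R i b * (if b \<le> c then Scons b a else 0)))"
    by (simp add: K_old_def sum_distrib_left)
  also have "\<dots> = (\<Sum>b=1..c + (?r - ?m). (\<Sum>i=1..nx st'. Xb st' i x * R i b) * (if b \<le> c then Scons b a else 0))"
    by (subst sum.swap) (simp only: sum_distrib_right mult.assoc)
  \<comment> \<open>The final QR identity reassembles the block columns from the new spatial
    basis.\<close>
  also have "\<dots> = (\<Sum>b=1..c + (?r - ?m). ?blk b x * (if b \<le> c then Scons b a else 0))"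
    using qx by (intro sum.cong refl) (simp add: qr_fact_def)
  \<comment> \<open>Block columns beyond \<open>c\<close> have coefficient zero here, so only the
    conserved ones remain.\<close>
  also have "\<dots> = (\<Sum>b=1..c. Xc b x * Scons b a)"
    by (rule sum.mono_neutral_cong_right) auto
  also have "\<dots> = (\<Sum>k=1..na. Xa k x * St k a)"
    using qc a by (simp add: qr_fact_def)
  finally show ?thesis .
qed

section \<open>Kinetic energy balance of one step\<close>

text \<open>Purely deterministic: \<Delta>\<beta> is an arbitrary vector, which makes the later
  identity pathwise. The field energies do not appear yet.\<close>

lemma bug_step_second_moment:
  assumes P: "valid_data C P" and st: "low_rank_state C P st"
    and E: "poisson_field C (rho C (dens P st)) (\<E> (rho C (dens P st)))"
    and step: "bug_step \<theta> C P \<E> \<Delta>\<beta> st st'"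
  shows "1 / 2 * (\<integral>v. (norm (vel C v))\<^sup>2 * dens P st' x v \<partial>Mv C)
    = 1 / 2 * (\<integral>v. (norm (vel C v))\<^sup>2 * dens P st x v \<partial>Mv C)
      - tau P * div_x C (Qflux C (dens P st)) x
      + tau P * (\<E> (rho C (dens P st)) x \<bullet> Jmom C (dens P st) x)
      + kick P \<Delta>\<beta> x \<bullet> Jmom C (dens P st) x
      + Theta \<theta> P \<Delta>\<beta> (rho C (dens P st)) x"
proof -
  interpret separable_density C "{1..rk P}" "K_old st" "\<lambda>j v. wt P v * Vb st j v" "dens P st"
    by (rule separable_density_dens[OF st])
  let ?f = "dens P st" and ?f' = "dens P st'" and ?m = "nfix P"
  let ?D = "transport C \<E> ?f x" and ?S = "S_inc \<theta> C P \<Delta>\<beta> ?f x"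
  obtain na Xa nb Va where aug: "augmentation \<theta> C P \<E> \<Delta>\<beta> st na Xa nb Va"
    and tr: "cons_truncation C P na Xa nb Va (S_new \<theta> C P \<E> \<Delta>\<beta> st na Xa nb Va) st'"
    using step unfolding bug_step_def by blast
  have Vo: "orthonormal_v C P nb Va" and Vm: "?m \<le> nb" "\<And>a. a \<in> {1..?m} \<Longrightarrow> Va a = Umode P a"
    using aug by (auto simp: augmentation_def)
  from tr obtain w where V': "\<forall>j\<in>{1..rk P}. Vb st' j = (if j \<le> ?m then Umode P j
        else (\<lambda>v. \<Sum>l=1..nb - ?m. Va (?m + l) v * w l (j - ?m)))"
    unfolding cons_truncation_def Let_def by (elim exE conjE) (rule that; assumption)
  have V'L: "Vb st' j \<in> L2v C P"
    and V'U: "a \<in> {1..?m} \<Longrightarrow> ipv C P (Umode P a) (Vb st' j) = (if j = a then 1 else 0)"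
    if "j \<in> {1..rk P}" for j a
    using truncation_velocity_basis[OF P Vo Vm bspec[OF V'] that] by blast+
  have mr: "?m \<le> rk P" and Uo: "orthonormal_v C P ?m (Umode P)" using P by (simp_all add: valid_data_def)
  have UL: "Umode P a \<in> L2v C P" if "a \<in> {1..?m}" for a
    using Uo that by (auto simp: orthonormal_v_def)
  have f': "?f' x = (\<lambda>v. \<Sum>j=1..rk P. K_old st' j x * (wt P v * Vb st' j v))"
    unfolding dens_def K_old_def sum_distrib_left sum_distrib_right
    by (intro ext, subst sum.swap) (simp add: ac_simps)
  have f: "?f x = (\<lambda>v. \<Sum>j=1..rk P. K_old st j x * (wt P v * Vb st j v))"
    by (simp add: f_eq)
  have VL: "Vb st j \<in> L2v C P" if "j \<in> {1..rk P}" for j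
    using st that by (auto simp: low_rank_state_def orthonormal_v_def)
  have pf': "prv C (Umode P a) (?f' x) = K_old st' a x" if "a \<in> {1..?m}" for a
    unfolding f' using that mr V'L V'U by (intro prv_combination[OF P] UL) auto
  have pf: "prv C (Umode P a) (?f x) = K_old st a x" if "a \<in> {1..?m}" for a
  proof -
    have "Vb st a = Umode P a" using st that by (auto simp: low_rank_state_def)
    moreover have "orthonormal_v C P (rk P) (Vb st)" using st by (simp add: low_rank_state_def)
    then have "ipv C P (Vb st a) (Vb st j) = (if j = a then 1 else 0)" if "j \<in> {1..rk P}" for j
      using that \<open>a \<in> {1..?m}\<close> mr by (simp add: orthonormal_v_def)
    ultimately show ?thesis
      unfolding f using that mr by (intro prv_combination[OF P VL] UL) auto
  qed
  \<comment> \<open>Truncation returns the S-step column, and that is the K-step column.\<close>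
  have col: "prv C (Umode P a) (?f' x)
      = prv C (Umode P a) (?f x) + tau P * prv C (Umode P a) ?D + prv C (Umode P a) ?S"
    if a: "a \<in> {1, CARD('d) + 2}" for a
  proof -
    have am: "a \<in> {1..?m}" using a P by (auto simp: valid_data_def)
    obtain A B where g: "\<And>v. \<bar>Umode P a v\<bar> \<le> A + B * (norm (vel C v))\<^sup>2"
      using mode_growth[OF P] a by auto
    have "Vb st a = Umode P a" using st am by (auto simp: low_rank_state_def)
    then show ?thesis
      using pf'[OF am] pf[OF am] truncation_conserved_column[OF tr am P] conserved_column[OF P st E aug am g]
      by (simp add: K_new_def)
  qed
  let ?I = "\<lambda>h. \<integral>v. (norm (vel C v))\<^sup>2 * h v \<partial>Mv C"
  note mD = second_moment_transport[of \<E> x] and mS = second_moment_S_inc[of ?f x \<theta> P \<Delta>\<beta>, OF f_Rv Dv_f_Rv]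
  have If': "integrable (Mv C) (?f' x)" "integrable (Mv C) (\<lambda>v. (norm (vel C v))\<^sup>2 * ?f' x v)"
    unfolding f' by (intro combination_moments_integrable[OF P] V'L; assumption)+
  have If: "integrable (Mv C) (?f x)" "integrable (Mv C) (\<lambda>v. (norm (vel C v))\<^sup>2 * ?f x v)"
    unfolding f by (intro combination_moments_integrable[OF P] VL; assumption)+
  \<comment> \<open>The four expansions by \<open>second_moment_modes\<close> share their two
    coefficients, so the identities for modes 1 and d+2 combine linearly.\<close>
  have "?I (?f' x) = ?I (?f x) + tau P * ?I ?D + ?I ?S"
    using second_moment_modes[OF P If'] second_moment_modes[OF P If]
      second_moment_modes[OF P integrable_transport integrable.intros[OF mD]]
      second_moment_modes[OF P integrable_S_inc integrable.intros[OF mS]]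
      col[of 1] col[of "CARD('d) + 2"]
    by (simp add: algebra_simps)
  also have "?I ?D = - 2 * div_x C (Qflux C ?f) x + 2 * (\<E> (rho C ?f) x \<bullet> Jmom C ?f x)"
    using mD by (rule has_bochner_integral_integral_eq)
  also have "?I ?S = 2 * (kick P \<Delta>\<beta> x \<bullet> Jmom C ?f x) + trace (diffusion \<theta> P \<Delta>\<beta> x) * rho C ?f x"
    using mS by (rule has_bochner_integral_integral_eq)
  finally show ?thesis by (simp add: Theta_eq algebra_simps)
qed

end

section \<open>Conditional expectation of the stochastic source\<close>

text \<open>Since \<open>g \<ge> 0\<close>, positive and negative parts of \<open>g f\<close> factor separately, and \<open>g f\<close> need not be
  integrable.\<close>

lemma (in sigma_finite_subalgebra) real_cond_exp_mult_nonneg: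
  assumes f: "f \<in> borel_measurable F" and g: "g \<in> borel_measurable M" "\<And>x. 0 \<le> g x"
  shows "AE x in M. real_cond_exp M F (\<lambda>x. g x * f x) x = real_cond_exp M F g x * f x"
proof -
  have [measurable]: "f \<in> borel_measurable M"
    by (rule measurable_from_subalg[OF subalg f])
  note [measurable] = f g(1)
  \<comment> \<open>As g is nonnegative, the positive and negative parts of gf are g times those of
    f; \<open>ennreal\<close> sends negative numbers to zero.\<close>
  have e: "ennreal (g x * f x) = ennreal (f x) * ennreal (g x)"
    "ennreal (- (g x * f x)) = ennreal (- f x) * ennreal (g x)" "ennreal (- g x) = 0" for x
    using ennreal_mult'[OF g(2)[of x], of "f x"] ennreal_mult'[OF g(2)[of x], of "- f x"] g(2)[of x]
    by (simp_all add: mult.commute ennreal_neg)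
  have "AE x in M. ennreal (f x) * nn_cond_exp M F (\<lambda>x. ennreal (g x)) x
      = nn_cond_exp M F (\<lambda>x. ennreal (f x) * ennreal (g x)) x"
    by (rule nn_cond_exp_prod) measurable
  moreover have "AE x in M. ennreal (- f x) * nn_cond_exp M F (\<lambda>x. ennreal (g x)) x
      = nn_cond_exp M F (\<lambda>x. ennreal (- f x) * ennreal (g x)) x"
    by (rule nn_cond_exp_prod) measurable
  \<comment> \<open>Covers the negative part of g, which is the zero function.\<close>
  moreover have "AE x in M. 0 = nn_cond_exp M F (\<lambda>x. 0) x"
    by (rule AE_mp[OF nn_cond_exp_F_meas[of "\<lambda>_. 0"]]) auto
  ultimately show ?thesis
  proof eventually_elim
    case (elim x)
    have "enn2real (ennreal (f x)) - enn2real (ennreal (- f x)) = f x"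
      by (cases "0 \<le> f x") (simp_all add: ennreal_neg)
    then show ?case
      using elim(3) unfolding real_cond_exp_def e elim(1,2)[symmetric] enn2real_mult
      by (simp add: algebra_simps left_diff_distrib[symmetric])
  qed
qed

section \<open>Second moments of the Brownian increments\<close>

lemma normal_square_integrable:
  assumes "distributed M lborel X (\<lambda>x. ennreal (normal_density 0 \<sigma> x))" and "0 < \<sigma>"
  shows "integrable M (\<lambda>\<omega>. (X \<omega>)\<^sup>2)"
  using distributed_integrable[OF assms(1), of "\<lambda>x. x\<^sup>2"] integrable_normal_moment[OF assms(2), of 0 2]
  by simp

text \<open>Each increment is Gaussian over an interval of positive length, hence square integrable;
  mixed products follow by domination.\<close>

lemma dB_product_integrable:
  assumes B: "independent_brownian_motions M F \<beta>" and \<tau>: "0 < \<tau>"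
  shows "(\<lambda>\<omega>. dB \<beta> \<tau> n \<omega> s) \<in> borel_measurable M"
    and "integrable M (\<lambda>\<omega>. dB \<beta> \<tau> n \<omega> s * dB \<beta> \<tau> n \<omega> r)"
proof -
  let ?t = "real (n + 1) * \<tau> - real n * \<tau>"
  have t: "0 \<le> real n * \<tau> \<and> real n * \<tau> < real (n + 1) * \<tau>"
    using \<tau> by simp
  have D: "distributed M lborel (\<lambda>\<omega>. dB \<beta> \<tau> n \<omega> s) (\<lambda>x. ennreal (normal_density 0 (sqrt ?t) x))" for s
    using B t unfolding independent_brownian_motions_def brownian_motion_def dB_def by blast
  have m: "(\<lambda>\<omega>. dB \<beta> \<tau> n \<omega> s) \<in> borel_measurable M" for s
    using distributed_measurable[OF D] by simp
  show "(\<lambda>\<omega>. dB \<beta> \<tau> n \<omega> s) \<in> borel_measurable M" by (rule m)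
  have "integrable M (\<lambda>\<omega>. 1 * (dB \<beta> \<tau> n \<omega> s)\<^sup>2)" for s
    using normal_square_integrable[OF D] t by simp
  then have "integrable M (\<lambda>\<omega>. 1 * dB \<beta> \<tau> n \<omega> s * dB \<beta> \<tau> n \<omega> r)"
    by (intro integrable_mult_of_squares m) auto
  then show "integrable M (\<lambda>\<omega>. dB \<beta> \<tau> n \<omega> s * dB \<beta> \<tau> n \<omega> r)" by simp
qed

lemma trace_sig_sq: "trace (sig_sq P x) = (\<Sum>s\<in>UNIV. column s (sig P x) \<bullet> column s (sig P x))"
  unfolding trace_def sig_sq_def inner_vec_def
  by (subst sum.swap) (simp add: matrix_matrix_mult_def transpose_def column_def)

text \<open>At fixed x the source is a nonnegative quadratic form in the increments times a
  measurable factor. Nonnegativity lets \<rho> be pulled out even when it is unbounded in \<omega>;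
  the covariance condition then reduces the form to its diagonal.\<close>

lemma (in sigma_finite_subalgebra) real_cond_exp_Theta_Heun:
  fixes P :: "('x, 'v, 'd::finite, 'k::finite) vp_data"
  assumes m: "\<And>s. (\<lambda>\<omega>. b \<omega> s) \<in> borel_measurable M"
    and i: "\<And>s r. integrable M (\<lambda>\<omega>. b \<omega> s * b \<omega> r)"
    and c: "\<And>s r. AE \<omega> in M. real_cond_exp M F (\<lambda>\<omega>. b \<omega> s * b \<omega> r) \<omega> = \<tau> * (if s = r then 1 else 0)"
    and \<rho>: "(\<lambda>\<omega>. \<rho> \<omega> x) \<in> borel_measurable F"
  shows "AE \<omega> in M. real_cond_exp M F (\<lambda>\<omega>. Theta Heun P (b \<omega>) (\<rho> \<omega>) x) \<omega>
    = \<tau> / 2 * trace (sig_sq P x) * \<rho> \<omega> x"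
proof -
  let ?a = "\<lambda>s r. 1 / 2 * (column s (sig P x) \<bullet> column r (sig P x))"
  let ?g = "\<lambda>\<omega>. \<Sum>(s, r)\<in>UNIV. ?a s r * (b \<omega> s * b \<omega> r)"
  have T: "Theta Heun P (b \<omega>) q x = ?g \<omega> * q x" for \<omega> q
    by (simp add: Theta_def UNIV_Times_UNIV[symmetric] sum.cartesian_product[symmetric]
        sum_distrib_left ac_simps del: UNIV_Times_UNIV)
  \<comment> \<open>The form is the source for unit density, half the squared length of
    \<open>kick\<close>.\<close>
  have g0: "0 \<le> ?g \<omega>" for \<omega>
  proof -
    have "0 \<le> Theta Heun P (b \<omega>) (\<lambda>_. 1) x"
      by (simp add: Theta_eq diffusion_def trace_def sum_nonneg)
    then show ?thesis by (simp only: T mult_1_right)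
  qed
  have gi: "integrable M (\<lambda>\<omega>. case z of (s, r) \<Rightarrow> ?a s r * (b \<omega> s * b \<omega> r))" for z
    using i by (cases z) simp
  have "AE \<omega> in M. real_cond_exp M F ?g \<omega> = (\<Sum>z\<in>UNIV. real_cond_exp M F (\<lambda>\<omega>. case z of (s, r) \<Rightarrow> ?a s r * (b \<omega> s * b \<omega> r)) \<omega>)"
    by (rule real_cond_exp_sum[OF gi])
  \<comment> \<open>Finitely many pairs of noises share one null set.\<close>
  moreover have "AE \<omega> in M. \<forall>z\<in>UNIV. real_cond_exp M F (\<lambda>\<omega>. case z of (s, r) \<Rightarrow> ?a s r * (b \<omega> s * b \<omega> r)) \<omega>
      = (case z of (s, r) \<Rightarrow> ?a s r * (\<tau> * (if s = r then 1 else 0)))"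
  proof (rule AE_finite_allI)
    fix z :: "'k \<times> 'k"
    obtain s r where z: "z = (s, r)" by (cases z)
    show "AE \<omega> in M. real_cond_exp M F (\<lambda>\<omega>. case z of (s, r) \<Rightarrow> ?a s r * (b \<omega> s * b \<omega> r)) \<omega>
      = (case z of (s, r) \<Rightarrow> ?a s r * (\<tau> * (if s = r then 1 else 0)))"
      unfolding z prod.case using real_cond_exp_cmult[OF i[of s r], of "?a s r"] c[of s r]
      by eventually_elim simp
  qed simp
  moreover have "AE \<omega> in M. real_cond_exp M F (\<lambda>\<omega>. ?g \<omega> * \<rho> \<omega> x) \<omega> = real_cond_exp M F ?g \<omega> * \<rho> \<omega> x"
  proof (rule real_cond_exp_mult_nonneg[OF \<rho> _ g0])
    show "?g \<in> borel_measurable M"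
      using gi by (intro borel_measurable_sum borel_measurable_integrable)
  qed
  ultimately show ?thesis
  proof eventually_elim
    case (elim \<omega>)
    have "(\<Sum>z\<in>UNIV. case z of (s, r) \<Rightarrow> ?a s r * (\<tau> * (if s = r then 1 else 0))) = \<tau> / 2 * trace (sig_sq P x)"
      by (simp add: UNIV_Times_UNIV[symmetric] sum.cartesian_product[symmetric] trace_sig_sq
          sum_distrib_left if_distrib mult.commute del: UNIV_Times_UNIV cong: if_cong)
    moreover have "(\<Sum>z\<in>UNIV. real_cond_exp M F (\<lambda>\<omega>. case z of (s, r) \<Rightarrow> ?a s r * (b \<omega> s * b \<omega> r)) \<omega>)
        = (\<Sum>z\<in>UNIV. case z of (s, r) \<Rightarrow> ?a s r * (\<tau> * (if s = r then 1 else 0)))"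
      using elim(2) by (intro sum.cong refl) blast
    ultimately show ?case unfolding T elim(3) elim(1) by simp
  qed
qed

text \<open>Freezing x preserves joint measurability in \<omega> and v, and integrals over a
  \<sigma>-finite space depend measurably on the parameter.\<close>

lemma (in vp_calculus) rho_measurable:
  assumes "(\<lambda>(\<omega>, x, v). f \<omega> x v) \<in> borel_measurable (N \<Otimes>\<^sub>M (Mx C \<Otimes>\<^sub>M Mv C))"
  shows "(\<lambda>\<omega>. rho C (f \<omega>) x) \<in> borel_measurable N"
proof -
  interpret sigma_finite_measure "Mv C" by (rule sigma_finite_Mv)
  have [measurable]: "x \<in> space (Mx C)" by (simp add: space_Mx)
  have "(\<lambda>(\<omega>, v). (\<omega>, x, v)) \<in> N \<Otimes>\<^sub>M Mv C \<rightarrow>\<^sub>M N \<Otimes>\<^sub>M (Mx C \<Otimes>\<^sub>M Mv C)" by measurable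
  from measurable_compose[OF this assms] show ?thesis
    unfolding rho_def by (intro borel_measurable_lebesgue_integral) (simp add: case_prod_unfold)
qed

section \<open>Pathwise energy identity and conditional mean of the source\<close>

theorem theorem4p7:
  fixes C :: "('x, 'v, 'd::finite) calculus"
    and P :: "('x, 'v, 'd, 'k::finite) vp_data"
    and M :: "'w measure" and F :: "real \<Rightarrow> 'w measure"
    and \<beta> :: "'k \<Rightarrow> real \<Rightarrow> 'w \<Rightarrow> real"
    and \<E> :: "('x \<Rightarrow> real) \<Rightarrow> 'x \<Rightarrow> real^'d"
    and \<theta> :: integrator and n :: nat
    and st st' :: "'w \<Rightarrow> ('x, 'v) lr_state"
  defines "\<tau> \<equiv> tau P"
    and "\<Delta>\<beta> \<equiv> dB \<beta> (tau P) n"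
    and "\<F>n \<equiv> F (real n * tau P)"
    and "f \<equiv> \<lambda>\<omega>. dens P (st \<omega>)"
    and "f' \<equiv> \<lambda>\<omega>. dens P (st' \<omega>)"
    and "\<rho> \<equiv> \<lambda>\<omega>. rho C (dens P (st \<omega>))"
    and "J \<equiv> \<lambda>\<omega>. Jmom C (dens P (st \<omega>))"
    and "E \<equiv> \<lambda>\<omega>. \<E> (rho C (dens P (st \<omega>)))"
    and "E' \<equiv> \<lambda>\<omega>. \<E> (rho C (dens P (st' \<omega>)))"
  assumes calculus: "vp_calculus C"
    and data: "valid_data C P"
    and filtered: "complete_filtered_space M F"
    and brownian: "independent_brownian_motions M F \<beta>"
    and solver: "poisson_solver C \<E>"
    and state: "\<forall>\<omega>\<in>space M. low_rank_state C P (st \<omega>)"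
    and adapted: "(\<lambda>(\<omega>, x, v). f \<omega> x v) \<in> borel_measurable (\<F>n \<Otimes>\<^sub>M (Mx C \<Otimes>\<^sub>M Mv C))"
    and solvable: "\<forall>\<omega>\<in>space M. poisson_field C (\<rho> \<omega>) (E \<omega>)"
    and solvable': "\<forall>\<omega>\<in>space M. poisson_field C (rho C (f' \<omega>)) (E' \<omega>)"
    and step: "\<forall>\<omega>\<in>space M. bug_step \<theta> C P \<E> (\<Delta>\<beta> \<omega>) (st \<omega>) (st' \<omega>)"
    and proj_Theta: "\<forall>\<omega>\<in>space M.
      proj_x C (nx (st' \<omega>)) (Xb (st' \<omega>)) (Theta \<theta> P (\<Delta>\<beta> \<omega>) (\<rho> \<omega>)) = Theta \<theta> P (\<Delta>\<beta> \<omega>) (\<rho> \<omega>)"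
    and proj_work: "\<theta> = Heun \<Longrightarrow> \<forall>\<omega>\<in>space M.
      (let g = (\<lambda>x. \<tau> * (E \<omega> x \<bullet> J \<omega> x) + (\<Sum>s\<in>UNIV. \<Delta>\<beta> \<omega> s * (column s (sig P x) \<bullet> J \<omega> x)))
       in proj_x C (nx (st' \<omega>)) (Xb (st' \<omega>)) g = g)"
  shows "(\<forall>\<omega>\<in>space M. \<forall>x.
       (let R_E = 1 / 2 * ((norm (E' \<omega> x))\<^sup>2 - (norm (E \<omega> x))\<^sup>2) + \<tau> * (E \<omega> x \<bullet> J \<omega> x)
        in energy C (f' \<omega>) (E' \<omega>) x - energy C (f \<omega>) (E \<omega>) x
             + \<tau> * div_x C (Qflux C (f \<omega>)) x
             - (\<Sum>s\<in>UNIV. \<Delta>\<beta> \<omega> s * (column s (sig P x) \<bullet> J \<omega> x))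
             - Theta \<theta> P (\<Delta>\<beta> \<omega>) (\<rho> \<omega>) x - R_E = 0
           \<and> R_E = \<tau> * (E \<omega> x \<bullet> ((1 / \<tau>) *\<^sub>R (E' \<omega> x - E \<omega> x) + J \<omega> x))
                    + 1 / 2 * (norm (E' \<omega> x - E \<omega> x))\<^sup>2))
    \<and> (\<theta> = Heun
       \<and> prob_space.indep_set M (sets \<F>n)
           (sets (vimage_algebra (space M) (\<lambda>\<omega>. (\<chi> s. \<Delta>\<beta> \<omega> s) :: real^'k) borel))
       \<and> (\<forall>s r. AE \<omega> in M. real_cond_exp M \<F>n (\<lambda>\<omega>. \<Delta>\<beta> \<omega> s * \<Delta>\<beta> \<omega> r) \<omega> = \<tau> * (if s = r then 1 else 0))
       \<longrightarrow> (\<forall>x. AE \<omega> in M. real_cond_exp M \<F>n (\<lambda>\<omega>. Theta Heun P (\<Delta>\<beta> \<omega>) (\<rho> \<omega>) x) \<omega>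
              = \<tau> / 2 * trace (sig_sq P x) * \<rho> \<omega> x))"
proof (intro conjI ballI allI impI)
  interpret vp_calculus C by (rule calculus)
  have \<tau>: "0 < \<tau>" using data by (simp add: valid_data_def \<tau>_def)
  {
    fix \<omega> x assume \<omega>: "\<omega> \<in> space M"
    have m: "1 / 2 * (\<integral>v. (norm (vel C v))\<^sup>2 * f' \<omega> x v \<partial>Mv C)
      = 1 / 2 * (\<integral>v. (norm (vel C v))\<^sup>2 * f \<omega> x v \<partial>Mv C) - \<tau> * div_x C (Qflux C (f \<omega>)) x
        + \<tau> * (E \<omega> x \<bullet> J \<omega> x) + kick P (\<Delta>\<beta> \<omega>) x \<bullet> J \<omega> x + Theta \<theta> P (\<Delta>\<beta> \<omega>) (\<rho> \<omega>) x"
      using bug_step_second_moment[of P "st \<omega>" \<E> \<theta> "\<Delta>\<beta> \<omega>" "st' \<omega>" x] data state solvable step \<omega>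
      by (simp add: f_def f'_def \<tau>_def E_def J_def \<rho>_def)
    \<comment> \<open>Polarization: |E'|^2 - |E|^2 = 2 E \<cdot> (E' - E) + |E' - E|^2; positivity
      of \<tau> cancels the quotient.\<close>
    have "1 / 2 * ((norm (E' \<omega> x))\<^sup>2 - (norm (E \<omega> x))\<^sup>2) + \<tau> * (E \<omega> x \<bullet> J \<omega> x)
      = \<tau> * (E \<omega> x \<bullet> ((1 / \<tau>) *\<^sub>R (E' \<omega> x - E \<omega> x) + J \<omega> x)) + 1 / 2 * (norm (E' \<omega> x - E \<omega> x))\<^sup>2"
      using \<tau> unfolding power2_norm_eq_inner
      by (simp add: inner_add_right inner_diff_left inner_diff_right inner_commute field_simps)
    then show "let R_E = 1 / 2 * ((norm (E' \<omega> x))\<^sup>2 - (norm (E \<omega> x))\<^sup>2) + \<tau> * (E \<omega> x \<bullet> J \<omega> x)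
        in energy C (f' \<omega>) (E' \<omega>) x - energy C (f \<omega>) (E \<omega>) x
             + \<tau> * div_x C (Qflux C (f \<omega>)) x
             - (\<Sum>s\<in>UNIV. \<Delta>\<beta> \<omega> s * (column s (sig P x) \<bullet> J \<omega> x))
             - Theta \<theta> P (\<Delta>\<beta> \<omega>) (\<rho> \<omega>) x - R_E = 0
           \<and> R_E = \<tau> * (E \<omega> x \<bullet> ((1 / \<tau>) *\<^sub>R (E' \<omega> x - E \<omega> x) + J \<omega> x))
                    + 1 / 2 * (norm (E' \<omega> x - E \<omega> x))\<^sup>2"
      using m unfolding Let_def energy_def sum_column_inner by (simp add: algebra_simps)
  }
  fix x
  assume H: "\<theta> = Heun
       \<and> prob_space.indep_set M (sets \<F>n)
           (sets (vimage_algebra (space M) (\<lambda>\<omega>. (\<chi> s. \<Delta>\<beta> \<omega> s) :: real^'k) borel))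
       \<and> (\<forall>s r. AE \<omega> in M. real_cond_exp M \<F>n (\<lambda>\<omega>. \<Delta>\<beta> \<omega> s * \<Delta>\<beta> \<omega> r) \<omega> = \<tau> * (if s = r then 1 else 0))"
  have "prob_space M" "subalgebra M \<F>n"
    using filtered by (simp_all add: complete_filtered_space_def \<F>n_def)
  then interpret finite_measure_subalgebra M \<F>n
    by (simp add: finite_measure_subalgebra_def finite_measure_subalgebra_axioms_def prob_space_def)
  show "AE \<omega> in M. real_cond_exp M \<F>n (\<lambda>\<omega>. Theta Heun P (\<Delta>\<beta> \<omega>) (\<rho> \<omega>) x) \<omega>
      = \<tau> / 2 * trace (sig_sq P x) * \<rho> \<omega> x"
  proof (rule real_cond_exp_Theta_Heun)
    show "(\<lambda>\<omega>. \<Delta>\<beta> \<omega> s) \<in> borel_measurable M" "integrable M (\<lambda>\<omega>. \<Delta>\<beta> \<omega> s * \<Delta>\<beta> \<omega> r)" for s r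
      using dB_product_integrable[OF brownian \<tau>] unfolding \<Delta>\<beta>_def \<tau>_def by auto
    show "AE \<omega> in M. real_cond_exp M \<F>n (\<lambda>\<omega>. \<Delta>\<beta> \<omega> s * \<Delta>\<beta> \<omega> r) \<omega> = \<tau> * (if s = r then 1 else 0)" for s r
      using H by blast
    show "(\<lambda>\<omega>. \<rho> \<omega> x) \<in> borel_measurable \<F>n"
      using rho_measurable[OF adapted] by (simp add: \<rho>_def f_def)
  qed
qed

end
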